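(* Let $\alpha>0$, $\varepsilon>0$, $\eta>0$ and $\mathbf{b}\in\mathcal{S}(\mathbb{R}^3)$. Define $b^\eta(t)=(1-2t\eta)\,\mathbf{b}$ for $t\in[0,1/\eta]$, and let $(Y^\eta,\mu^\eta)$ be the solution on $[0,1/\eta]$ of the Itô system $$dY^\eta_t=-\mu^\eta_t\wedge(b^\eta(t)\,dt+\varepsilon\,dW_t)-\alpha\,\mu^\eta_t\wedge\big(\mu^\eta_t\wedge(b^\eta(t)\,dt+\varepsilon\,dW_t)\big),\qquad \mu^\eta_t=\frac{Y^\eta_t}{|Y^\eta_t|},\qquad Y^\eta_0=\mathbf{b}.$$ For $t\in[0,1]$ set $\lambda^\eta_t=\mu^\eta_{t/\eta}$ and $h^\eta(t)=\sqrt{2(1+\alpha^2)\varepsilon^2t/\eta+1}$. Then for all $t\in[0,1/2]$, $$\mathbb{E}(\lambda^\eta_t\cdot\mathbf{b})\ \ge\ \frac{1}{h^\eta(t)}\ \ge\ \frac{1}{\sqrt{1+\frac{(1+\alpha^2)\varepsilon^2}{\eta}}}.$$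
   Context: $|\cdot|$ is the Euclidean norm, $\cdot$ the scalar product and $\wedge$ the vector (cross) product on $\mathbb{R}^3$; $\mathcal{S}(\mathbb{R}^3)=\{u\in\mathbb{R}^3: |u|=1\}$. $W$ is a standard $\mathbb{R}^3$-valued Brownian motion on a probability space $(\Omega,\mathcal{A},\mathbb{P})$, with natural filtration augmented with the $\mathbb{P}$-null sets. For $x\in\mathbb{R}^3$, $L(x)$ is the antisymmetric $3\times3$ matrix with $L(x)v=x\wedge v$ for all $v\in\mathbb{R}^3$; for an adapted process $H$, $\int_0^t H_s\wedge dW_s$ means the Itô integral $\int_0^t L(H_s)\,dW_s$. *)

theory Defs
  imports "HOL-Probability.Probability"
begin

unbundle cross3_syntax

section \<open>Brownian motion and its augmented natural filtration\<close>

text \<open>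
  Processes are indexed by \<^typ>\<open>real\<close>; only times \<open>t \<ge> 0\<close> matter.
\<close>

definition natural_filtration :: "'a measure \<Rightarrow> (real \<Rightarrow> 'a \<Rightarrow> real^'n) \<Rightarrow> real \<Rightarrow> 'a measure" where
  "natural_filtration M W t =
     sigma (space M) {W s -` A \<inter> space M | s A. 0 \<le> s \<and> s \<le> t \<and> A \<in> sets borel}"

definition augmented_filtration :: "'a measure \<Rightarrow> (real \<Rightarrow> 'a \<Rightarrow> real^'n) \<Rightarrow> real \<Rightarrow> 'a measure" where
  "augmented_filtration M W t =
     sigma (space M) (sets (natural_filtration M W t) \<union> null_sets M)"

text \<open>
  The increment over \<open>(s, t]\<close> is centred Gaussian with covariance matrix \<open>(t - s) I\<close>, and it is
  independent of the past up to time \<open>s\<close>.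
\<close>

locale standard_brownian_motion = prob_space M
  for M :: "'a measure" and W :: "real \<Rightarrow> 'a \<Rightarrow> real^'n" +
  assumes measurable_W: "\<And>t. 0 \<le> t \<Longrightarrow> W t \<in> borel_measurable M"
    and W_0: "AE \<omega> in M. W 0 \<omega> = 0"
    and continuous_W: "AE \<omega> in M. continuous_on {0..} (\<lambda>t. W t \<omega>)"
    and increment_distributed: "\<And>s t. 0 \<le> s \<Longrightarrow> s < t \<Longrightarrow>
      distributed M lborel (\<lambda>\<omega>. W t \<omega> - W s \<omega>)
        (\<lambda>x. ennreal (\<Prod>i\<in>UNIV. normal_density 0 (sqrt (t - s)) (x $ i)))"
    and increment_indep: "\<And>s t. 0 \<le> s \<Longrightarrow> s < t \<Longrightarrow>
      indep_set (sets (natural_filtration M W s))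
        (sets (vimage_algebra (space M) (\<lambda>\<omega>. W t \<omega> - W s \<omega>) borel))"

lemma space_augmented_filtration [simp]: "space (augmented_filtration M W t) = space M"
  unfolding augmented_filtration_def natural_filtration_def
  by (rule space_measure_of)
    (use sets.space_closed[of "sigma (space M) {W s -` A \<inter> space M | s A. 0 \<le> s \<and> s \<le> t \<and> A \<in> sets borel}"]
         sets.sets_into_space[of _ M] in \<open>auto simp: space_measure_of_conv null_sets_def\<close>)

lemma sets_natural_filtration:
  "sets (natural_filtration M W t) =
     sigma_sets (space M) {W s -` A \<inter> space M | s A. 0 \<le> s \<and> s \<le> t \<and> A \<in> sets borel}"
  unfolding natural_filtration_def by (rule sets_measure_of) auto

lemma sets_augmented_filtration:
  "sets (augmented_filtration M W t) =
     sigma_sets (space M) (sets (natural_filtration M W t) \<union> null_sets M)"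
  unfolding augmented_filtration_def
proof (rule sets_measure_of)
  have "space (natural_filtration M W t) = space M"
    unfolding natural_filtration_def by (rule space_measure_of) auto
  then show "sets (natural_filtration M W t) \<union> null_sets M \<subseteq> Pow (space M)"
    using sets.space_closed[of "natural_filtration M W t"] sets.space_closed[of M]
    by (auto simp: null_sets_def)
qed

lemma filtration_augmented: "filtration (space M) (augmented_filtration M W)"
proof
  fix s t :: real assume "s \<le> t"
  then have "sets (natural_filtration M W s) \<subseteq> sets (natural_filtration M W t)"
    unfolding sets_natural_filtration by (intro sigma_sets_mono') (force intro: order_trans)
  then show "sets (augmented_filtration M W s) \<subseteq> sets (augmented_filtration M W t)"
    unfolding sets_augmented_filtration by (intro sigma_sets_mono') auto
qed simp

section \<open>The Ito integral of square-integrable adapted processes\<close>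

text \<open>
  A list of triples \<open>(a, b, \<xi>)\<close> encodes the matrix-valued simple predictable process
  \<open>s \<mapsto> \<Sum> \<xi> 1\<^bsub>(a, b]\<^esub>(s)\<close>; the intervals may overlap.
\<close>

type_synonym ('a, 'n, 'm) simple_process = "(real \<times> real \<times> ('a \<Rightarrow> real^'n^'m)) list"

definition simple_process ::
  "(real \<Rightarrow> 'a measure) \<Rightarrow> real \<Rightarrow> ('a, 'n::finite, 'm::finite) simple_process \<Rightarrow> bool" where
  "simple_process F T S \<longleftrightarrow>
     (\<forall>(a, b, \<xi>)\<in>set S. 0 \<le> a \<and> a \<le> b \<and> b \<le> T \<and>
        \<xi> \<in> borel_measurable (F a) \<and> bounded (\<xi> ` space (F a)))"

definition simple_value ::
  "('a, 'n::finite, 'm::finite) simple_process \<Rightarrow> real \<Rightarrow> 'a \<Rightarrow> real^'n^'m" where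
  "simple_value S s \<omega> = (\<Sum>(a, b, \<xi>)\<leftarrow>S. indicator {a<..b} s *\<^sub>R \<xi> \<omega>)"

definition simple_integral ::
  "(real \<Rightarrow> 'a \<Rightarrow> real^'n) \<Rightarrow> ('a, 'n::finite, 'm::finite) simple_process \<Rightarrow> 'a \<Rightarrow> real^'m" where
  "simple_integral W S \<omega> = (\<Sum>(a, b, \<xi>)\<leftarrow>S. \<xi> \<omega> *v (W b \<omega> - W a \<omega>))"

text \<open>
  \<open>has_ito_integral M F W T H I\<close> means that the random variable \<open>I\<close> is a version of
  \<open>\<integral>\<^sub>0\<^sup>T H dW\<close>: the integrand is measurable, adapted and square-integrable, and \<open>I\<close> is the
  \<open>L\<^sup>2\<close>-limit of the integrals of simple processes that converge to \<open>H\<close> in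
  \<open>L\<^sup>2([0, T] \<times> \<Omega>)\<close>. By the Ito isometry such an \<open>I\<close> is unique up to null sets and does not
  depend on the approximating sequence. The norm on matrices is the Frobenius norm.
\<close>

definition has_ito_integral ::
  "'a measure \<Rightarrow> (real \<Rightarrow> 'a measure) \<Rightarrow> (real \<Rightarrow> 'a \<Rightarrow> real^'n::finite) \<Rightarrow> real \<Rightarrow>
   (real \<Rightarrow> 'a \<Rightarrow> real^'n^'m::finite) \<Rightarrow> ('a \<Rightarrow> real^'m) \<Rightarrow> bool" where
  "has_ito_integral M F W T H I \<longleftrightarrow>
     (\<lambda>(s, \<omega>). H s \<omega>) \<in> borel_measurable (restrict_space lborel {0..T} \<Otimes>\<^sub>M M) \<and>
     (\<forall>s\<in>{0..T}. H s \<in> borel_measurable (F s)) \<and>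
     (\<integral>\<^sup>+\<omega>. (\<integral>\<^sup>+s\<in>{0..T}. ennreal ((norm (H s \<omega>))\<^sup>2) \<partial>lborel) \<partial>M) < \<infinity> \<and>
     I \<in> borel_measurable M \<and>
     (\<exists>S. (\<forall>n::nat. simple_process F T (S n)) \<and>
        (\<lambda>n. \<integral>\<^sup>+\<omega>. (\<integral>\<^sup>+s\<in>{0..T}. ennreal ((norm (simple_value (S n) s \<omega> - H s \<omega>))\<^sup>2) \<partial>lborel) \<partial>M)
          \<longlonglongrightarrow> 0 \<and>
        (\<lambda>n. \<integral>\<^sup>+\<omega>. ennreal ((norm (simple_integral W (S n) \<omega> - I \<omega>))\<^sup>2) \<partial>M) \<longlonglongrightarrow> 0)"

section \<open>The stochastic system\<close>

definition L :: "real^3 \<Rightarrow> real^3^3" where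
  "L x = matrix (\<lambda>v. x \<times> v)"

lemma L_mult_vec: "L x *v v = x \<times> v"
proof -
  have "linear (\<lambda>v. x \<times> v)"
    using bilinear_cross by (simp add: bilinear_def)
  then show ?thesis
    unfolding L_def by (metis matrix_vector_mul(2))
qed

lemma L_antisym: "transpose (L x) = - L x"
  by (simp add: L_def matrix_def transpose_def vec_eq_iff forall_3 cross_components axis_def)

definition b_eta :: "real \<Rightarrow> real^3 \<Rightarrow> real \<Rightarrow> real^3" where
  "b_eta \<eta> b t = (1 - 2 * t * \<eta>) *\<^sub>R b"

text \<open>
  Here \<open>I\<close> and \<open>J\<close> are the stochastic integrals \<open>\<integral>\<^sub>0\<^sup>t \<mu> \<and> dW\<close> and \<open>\<integral>\<^sub>0\<^sup>t \<mu> \<and> (\<mu> \<and> dW)\<close>; the second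
  one has the integrand \<open>L(\<mu>) L(\<mu>)\<close>. The requirement \<open>Y \<noteq> 0\<close> makes \<open>\<mu> = Y / |Y|\<close> meaningful,
  as division by zero is total. Both sides of the integral equation have almost surely continuous
  versions, so it is enough to ask for it almost surely at each fixed time.
\<close>

definition is_solution ::
  "'a measure \<Rightarrow> (real \<Rightarrow> 'a \<Rightarrow> real^3) \<Rightarrow> real \<Rightarrow> real \<Rightarrow> real \<Rightarrow> real^3 \<Rightarrow>
   (real \<Rightarrow> 'a \<Rightarrow> real^3) \<Rightarrow> (real \<Rightarrow> 'a \<Rightarrow> real^3) \<Rightarrow> bool" where
  "is_solution M W \<alpha> \<epsilon> \<eta> b Y \<mu> \<longleftrightarrow>
     (\<forall>t\<in>{0..1/\<eta>}. Y t \<in> borel_measurable (augmented_filtration M W t)) \<and>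
     (AE \<omega> in M. continuous_on {0..1/\<eta>} (\<lambda>t. Y t \<omega>)) \<and>
     (AE \<omega> in M. \<forall>t\<in>{0..1/\<eta>}. Y t \<omega> \<noteq> 0) \<and>
     (\<forall>t\<in>{0..1/\<eta>}. \<forall>\<omega>\<in>space M. \<mu> t \<omega> = Y t \<omega> /\<^sub>R norm (Y t \<omega>)) \<and>
     (AE \<omega> in M. Y 0 \<omega> = b) \<and>
     (\<forall>t\<in>{0..1/\<eta>}. \<exists>I J.
        has_ito_integral M (augmented_filtration M W) W t (\<lambda>s \<omega>. L (\<mu> s \<omega>)) I \<and>
        has_ito_integral M (augmented_filtration M W) W t (\<lambda>s \<omega>. L (\<mu> s \<omega>) ** L (\<mu> s \<omega>)) J \<and>
        (AE \<omega> in M. Y t \<omega> = Y 0 \<omega>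
           - ((LBINT s:{0..t}. \<mu> s \<omega> \<times> b_eta \<eta> b s) + \<epsilon> *\<^sub>R I \<omega>)
           - \<alpha> *\<^sub>R ((LBINT s:{0..t}. \<mu> s \<omega> \<times> (\<mu> s \<omega> \<times> b_eta \<eta> b s)) + \<epsilon> *\<^sub>R J \<omega>)))"

definition lambda_eta :: "real \<Rightarrow> (real \<Rightarrow> 'a \<Rightarrow> real^3) \<Rightarrow> real \<Rightarrow> 'a \<Rightarrow> real^3" where
  "lambda_eta \<eta> \<mu> t \<omega> = \<mu> (t / \<eta>) \<omega>"

definition h_eta :: "real \<Rightarrow> real \<Rightarrow> real \<Rightarrow> real \<Rightarrow> real" where
  "h_eta \<alpha> \<epsilon> \<eta> t = sqrt (2 * (1 + \<alpha>\<^sup>2) * \<epsilon>\<^sup>2 * t / \<eta> + 1)"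

unbundle no cross3_syntax

end

theory Submission
  imports Defs
begin

text \<open>
  Write the system as \<open>dY = A dt + H dW\<close>, where \<open>A = - \<mu> \<and> b\<^sup>\<eta> - \<alpha> \<mu> \<and> (\<mu> \<and> b\<^sup>\<eta>)\<close> and
  \<open>H = - \<epsilon> (L(\<mu>) + \<alpha> L(\<mu>)\<^sup>2)\<close>. Both coefficients are tangential: \<open>\<mu> \<bullet> A = 0\<close> and \<open>\<mu>\<^sup>T H = 0\<close>. Moreover the
  Frobenius norm of \<open>H\<close> is constant, with square \<open>c = 2 (1 + \<alpha>\<^sup>2) \<epsilon>\<^sup>2\<close>, because \<open>|\<mu>| = 1\<close>. The Ito formula for
  \<open>|Y|\<^sup>2\<close> therefore leaves only the bracket term, and \<open>|Y\<^sub>t|\<^sup>2 = 1 + c t\<close> almost surely: the norm of \<open>Y\<close> is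
  deterministic (\<open>norm_square_deterministic\<close>), and equals \<open>h(\<eta> t)\<close>.

  Hence \<open>E(\<mu>\<^sub>t \<bullet> b) = E(Y\<^sub>t \<bullet> b) / h(\<eta> t)\<close>. The stochastic integral has mean zero, and
  \<open>A \<bullet> b = \<alpha> (1 - 2 t \<eta>) (1 - (\<mu> \<bullet> b)\<^sup>2) \<ge> 0\<close> as long as \<open>t \<le> 1 / (2 \<eta>)\<close>, so that \<open>E(Y\<^sub>t \<bullet> b) \<ge> 1\<close>
  (\<open>mean_alignment\<close>). This is the first inequality. The second one only expresses that \<open>2 t \<le> 1\<close> in rescaled time.

  The Ito formula is proved by hand in the case that is needed. The isometry for simple processes
  (\<open>simple_isometry\<close>) passes to the limit as an inequality of second moments (\<open>ito_limit_sqnorm_le\<close>,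
  \<open>ito_limit_inner\<close>), and this is all that the argument uses besides adaptedness, mean zero and
  linearity, also with respect to factors that are known at the start of the interval.

  Along a partition of \<open>[0, t]\<close> with mesh \<open>\<Delta>\<close>, the increment of \<open>|Y|\<^sup>2\<close> over
  \<open>(u, v]\<close> is \<open>2 Y\<^sub>u \<bullet> \<delta>Y + |\<delta>Y|\<^sup>2\<close>. Split \<open>\<delta>Y\<close> into the drift, the main part \<open>H\<^sub>u (W\<^sub>v - W\<^sub>u)\<close> and an error that
  is small by mean square continuity of \<open>H\<close>. Tangentiality lets one replace \<open>Y\<^sub>u\<close> by \<open>Y\<^sub>u - Y\<^sub>r\<close> in \<open>Y\<^sub>u \<bullet> A\<^sub>r\<close> and
  \<open>Y\<^sub>u\<^sup>T H\<^sub>r\<close>, which gains a factor \<open>\<surd>\<Delta>\<close> in the linear terms, and the variables \<open>|H\<^sub>u (W\<^sub>v - W\<^sub>u)|\<^sup>2 - c \<Delta>\<close> are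
  orthogonal with variance of order \<open>\<Delta>\<^sup>2\<close>.
\<close>

section \<open>Moments of centred Gaussian vectors\<close>

lemma borel_measurable_vec_nth [measurable]:
  "(\<lambda>x::'a::real_normed_vector^'n. x $ k) \<in> borel_measurable borel"
  by (intro borel_measurable_continuous_onI continuous_intros)

lemma has_bochner_integral_prod_coordinates:
  fixes f :: "'n::finite \<Rightarrow> real \<Rightarrow> real"
  assumes f: "\<And>k. has_bochner_integral lborel (f k) (c k)"
  shows "has_bochner_integral lborel (\<lambda>x::real^'n. \<Prod>k\<in>UNIV. f k (x $ k)) (\<Prod>k\<in>UNIV. c k)"
proof -
  have bij: "bij_betw (\<lambda>k. axis k (1::real)) UNIV (Basis :: (real^'n) set)"
    by (auto simp: bij_betw_def inj_on_def axis_eq_axis Basis_vec_def)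
  have idx: "axis_index (axis k (1::real)) = k" for k :: 'n
    by (simp add: axis_eq_axis axis_index_def)
  have [measurable]: "f k \<in> borel_measurable borel" for k
    using borel_measurable_has_bochner_integral[OF f[of k]] by simp
  let ?P = "\<lambda>x::real^'n. \<Prod>k\<in>UNIV. f k (x $ k)"
  have [measurable]: "?P \<in> borel_measurable borel"
    by measurable
  have P: "?P (\<Sum>b\<in>Basis. z b *\<^sub>R b) = (\<Prod>b\<in>Basis. f (axis_index b) (z b))" for z
  proof -
    have "?P (\<Sum>b\<in>Basis. z b *\<^sub>R b) = (\<Prod>k\<in>UNIV. f k (z (axis k 1)))"
    proof (intro prod.cong refl arg_cong[where f="f _"])
      fix k :: 'n
      have "(\<Sum>b\<in>Basis. z b *\<^sub>R b) $ k = (\<Sum>b\<in>Basis. z b *\<^sub>R b) \<bullet> axis k 1"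
        by (simp add: inner_axis)
      also have "\<dots> = z (axis k 1)"
        by (subst inner_sum_left_Basis) (auto simp: Basis_vec_def)
      finally show "(\<Sum>b\<in>Basis. z b *\<^sub>R b) $ k = z (axis k 1)" .
    qed
    also have "\<dots> = (\<Prod>b\<in>Basis. f (axis_index b) (z b))"
      by (subst prod.reindex_bij_betw[OF bij, symmetric]) (simp add: idx)
    finally show ?thesis .
  qed
  interpret product_sigma_finite "\<lambda>_::real^'n. lborel :: real measure" ..
  have int: "integrable lborel (f k)" and ieq: "integral\<^sup>L lborel (f k) = c k" for k
    using f[of k] by (auto simp: has_bochner_integral_iff)
  have "integrable (\<Pi>\<^sub>M b\<in>(Basis::(real^'n) set). lborel) (\<lambda>z. \<Prod>b\<in>Basis. f (axis_index b) (z b))"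
    by (intro product_integrable_prod int) auto
  moreover have "(\<integral>z. (\<Prod>b\<in>(Basis::(real^'n) set). f (axis_index b) (z b)) \<partial>(\<Pi>\<^sub>M b\<in>(Basis::(real^'n) set). lborel))
      = (\<Prod>b\<in>(Basis::(real^'n) set). c (axis_index b))"
    by (subst product_integral_prod) (auto simp: int ieq)
  moreover have "(\<Prod>b\<in>(Basis::(real^'n) set). c (axis_index b)) = (\<Prod>k\<in>UNIV. c k)"
    by (subst prod.reindex_bij_betw[OF bij, symmetric]) (simp add: idx)
  ultimately have *: "has_bochner_integral (\<Pi>\<^sub>M b\<in>(Basis::(real^'n) set). lborel)
      (\<lambda>z. ?P (\<Sum>b\<in>Basis. z b *\<^sub>R b)) (\<Prod>k\<in>UNIV. c k)"
    by (simp add: has_bochner_integral_iff P del: sum_component)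
  show ?thesis
    by (subst lborel_eq, rule has_bochner_integral_distr[where f="?P" and g="\<lambda>z. \<Sum>b\<in>Basis. z b *\<^sub>R b"])
      (measurable, rule *)
qed

text \<open>
  The density of a centred Gaussian vector with covariance matrix \<open>\<sigma>\<^sup>2\<close> times the identity.
\<close>

definition gauss_density :: "real \<Rightarrow> real^'n::finite \<Rightarrow> real" where
  "gauss_density \<sigma> x = (\<Prod>i\<in>UNIV. normal_density 0 \<sigma> (x $ i))"

lemma gauss_density_nonneg: "0 \<le> gauss_density \<sigma> x"
  by (simp add: gauss_density_def prod_nonneg)

lemma gauss_moment:
  fixes m :: "'n::finite \<Rightarrow> nat"
  assumes "\<sigma> > 0"
    and m: "\<And>k. has_bochner_integral lborel (\<lambda>x. normal_density 0 \<sigma> x * x ^ m k) (c k)"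
  shows "has_bochner_integral lborel (\<lambda>x::real^'n. gauss_density \<sigma> x * (\<Prod>k\<in>UNIV. (x $ k) ^ m k)) (\<Prod>k\<in>UNIV. c k)"
  using has_bochner_integral_prod_coordinates[OF m]
  by (simp add: gauss_density_def prod.distrib)

lemma normal_moments_0124:
  assumes "\<sigma> > 0"
  shows "has_bochner_integral lborel (\<lambda>x. normal_density 0 \<sigma> x * x ^ 0) 1"
    and "has_bochner_integral lborel (\<lambda>x. normal_density 0 \<sigma> x * x ^ 1) 0"
    and "has_bochner_integral lborel (\<lambda>x. normal_density 0 \<sigma> x * x ^ 2) (\<sigma>\<^sup>2)"
    and "has_bochner_integral lborel (\<lambda>x. normal_density 0 \<sigma> x * x ^ 4) (3 * \<sigma> ^ 4)"
  using normal_moment_even[OF assms, of 0 0] normal_moment_odd[OF assms, of 0 0]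
    normal_moment_even[OF assms, of 0 1] normal_moment_even[OF assms, of 0 2]
  by (simp_all add: fact_numeral power2_eq_square power4_eq_xxxx algebra_simps)

lemma gauss_moments:
  fixes k l :: "'n::finite"
  assumes "\<sigma> > 0"
  shows "has_bochner_integral lborel (\<lambda>x::real^'n. gauss_density \<sigma> x * x $ k) 0"
    and "has_bochner_integral lborel (\<lambda>x::real^'n. gauss_density \<sigma> x * (x $ k * x $ l)) (if k = l then \<sigma>\<^sup>2 else 0)"
    and "has_bochner_integral lborel (\<lambda>x::real^'n. gauss_density \<sigma> x * (x $ k) ^ 4) (3 * \<sigma> ^ 4)"
proof -
  note nm = normal_moments_0124[OF assms]
  have pow: "(\<Prod>j\<in>UNIV. (y $ j) ^ (if j = k then p else 0)) = (y $ k) ^ p" for y :: "real^'n" and p k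
    by (subst prod.remove[of UNIV k]) auto
  have pc: "(\<Prod>j\<in>UNIV. if j = k then c else (1::real)) = c" for c
    by (subst prod.remove[of UNIV k]) auto
  have one: "has_bochner_integral lborel (\<lambda>x::real^'n. gauss_density \<sigma> x * (x $ k) ^ p) c"
    if "has_bochner_integral lborel (\<lambda>x. normal_density 0 \<sigma> x * x ^ p) c" for p c
    using gauss_moment[OF assms, of "\<lambda>j. if j = k then p else 0" "\<lambda>j. if j = k then c else 1"] that nm(1)
    by (simp add: pow pc split: if_splits)
  show "has_bochner_integral lborel (\<lambda>x::real^'n. gauss_density \<sigma> x * x $ k) 0"
    using one[OF nm(2)] by simp
  show "has_bochner_integral lborel (\<lambda>x::real^'n. gauss_density \<sigma> x * (x $ k) ^ 4) (3 * \<sigma> ^ 4)"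
    using one[OF nm(4)] by simp
  show "has_bochner_integral lborel (\<lambda>x::real^'n. gauss_density \<sigma> x * (x $ k * x $ l)) (if k = l then \<sigma>\<^sup>2 else 0)"
  proof (cases "k = l")
    case True
    then show ?thesis using one[OF nm(3)] by (simp add: power2_eq_square)
  next
    case False
    have pow2: "(\<Prod>j\<in>UNIV. (y $ j) ^ (if j = k \<or> j = l then 1 else 0)) = y $ k * y $ l" for y :: "real^'n"
    proof -
      have "(\<Prod>j\<in>UNIV. (y $ j) ^ (if j = k \<or> j = l then 1 else 0))
          = (\<Prod>j\<in>UNIV. (y $ j) ^ (if j = k then 1 else 0) * (y $ j) ^ (if j = l then 1 else 0))"
        using False by (intro prod.cong) auto
      also have "\<dots> = y $ k * y $ l"
        by (simp add: prod.distrib pow)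
      finally show ?thesis .
    qed
    have "(\<Prod>j\<in>UNIV. if j = k \<or> j = l then (0::real) else 1) = 0"
      by (intro prod_zero) auto
    moreover have "has_bochner_integral lborel
        (\<lambda>x. normal_density 0 \<sigma> x * x ^ (if j = k \<or> j = l then 1 else 0)) (if j = k \<or> j = l then 0 else 1)" for j :: 'n
      using nm(1,2) by (cases "j = k \<or> j = l") simp_all
    note gauss_moment[where m="\<lambda>j. if j = k \<or> j = l then 1 else 0" and c="\<lambda>j. if j = k \<or> j = l then 0 else 1", OF assms this]
    ultimately show ?thesis
      unfolding pow2 by (simp only: False if_False)
  qed
qed

section \<open>Increments of Brownian motion\<close>

context standard_brownian_motion
begin

abbreviation F :: "real \<Rightarrow> 'a measure" where
  "F \<equiv> augmented_filtration M W"

lemma natural_subset: "sets (natural_filtration M W t) \<subseteq> sets M"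
  unfolding sets_natural_filtration
  by (rule sets.sigma_sets_subset) (auto intro: measurable_sets[OF measurable_W])

lemma augmented_subset: "sets (F t) \<subseteq> sets M"
  unfolding sets_augmented_filtration
  using natural_subset by (intro sets.sigma_sets_subset) auto

lemma measurable_F_M: "f \<in> borel_measurable (F t) \<Longrightarrow> f \<in> borel_measurable M"
  using augmented_subset by (auto simp: measurable_def)

lemma measurable_F_mono: "f \<in> borel_measurable (F s) \<Longrightarrow> s \<le> t \<Longrightarrow> f \<in> borel_measurable (F t)"
  using filtration.sets_F_mono[OF filtration_augmented, of s t] unfolding measurable_def by auto

lemma W_measurable_F: assumes "0 \<le> s" "s \<le> t" shows "W s \<in> borel_measurable (F t)"
proof (rule measurableI)
  fix A :: "(real^'n) set" assume "A \<in> sets borel"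
  then show "W s -` A \<inter> space (F t) \<in> sets (F t)"
    unfolding sets_augmented_filtration sets_natural_filtration using assms
    by (intro sigma_sets.Basic UnI1 sigma_sets.Basic) auto
qed simp

text \<open>Modification on a null set does not affect measurability for the augmented filtration.\<close>

lemma measurable_F_AE_eq:
  fixes f g :: "'a \<Rightarrow> 'b::topological_space"
  assumes f: "f \<in> borel_measurable M" and g: "g \<in> borel_measurable (F t)"
    and ae: "AE \<omega> in M. f \<omega> = g \<omega>"
  shows "f \<in> borel_measurable (F t)"
proof (rule measurableI)
  fix A :: "'b set" assume A: "A \<in> sets borel"
  have [measurable]: "g \<in> borel_measurable M" using g by (rule measurable_F_M)
  obtain N where N: "N \<in> null_sets M" "{\<omega>\<in>space M. f \<omega> \<noteq> g \<omega>} \<subseteq> N"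
    using ae by (auto elim!: AE_E)
  have "f -` A \<inter> space M = ((g -` A \<inter> space M) - N) \<union> (f -` A \<inter> space M \<inter> N)"
    using N by auto
  moreover have "g -` A \<inter> space M \<in> sets (F t)"
    using measurable_sets[OF g A] by simp
  moreover have "f -` A \<inter> space M \<inter> N \<in> null_sets M"
    using N measurable_sets[OF f A] by (intro null_set_Int1) auto
  moreover have "null_sets M \<subseteq> sets (F t)"
    unfolding sets_augmented_filtration by (auto intro: sigma_sets.Basic)
  ultimately show "f -` A \<inter> space (F t) \<in> sets (F t)"
    using N(1) by (metis sets.Un sets.Diff subsetD space_augmented_filtration)
qed simp

text \<open>
  The null sets that are added to the natural filtration do not change it up to almost sure equality,
  so the independence of increments extends to the augmented filtration.
\<close>

lemma augmented_set_AE_eq_natural: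
  assumes "A \<in> sets (F t)"
  shows "\<exists>B\<in>sets (natural_filtration M W t). AE \<omega> in M. \<omega> \<in> A \<longleftrightarrow> \<omega> \<in> B"
  using assms unfolding sets_augmented_filtration
proof (induction rule: sigma_sets.induct)
  case (Basic A)
  show ?case
  proof (cases "A \<in> null_sets M")
    case True
    then show ?thesis
      by (intro bexI[of _ "{}"]) (auto dest: AE_not_in)
  qed (use Basic in \<open>auto intro!: bexI[of _ A]\<close>)
next
  case (Compl A)
  then obtain B where B: "B \<in> sets (natural_filtration M W t)" "AE \<omega> in M. \<omega> \<in> A \<longleftrightarrow> \<omega> \<in> B" by auto
  have "space (natural_filtration M W t) = space M"
    unfolding natural_filtration_def by (rule space_measure_of) auto
  then have "space M - B \<in> sets (natural_filtration M W t)"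
    using B(1) by (metis sets.compl_sets)
  with B show ?case
    by (intro bexI[of _ "space M - B"]) (auto elim: AE_mp)
next
  case (Union A)
  then obtain B where B: "\<And>i. B i \<in> sets (natural_filtration M W t)"
    "\<And>i::nat. AE \<omega> in M. \<omega> \<in> A i \<longleftrightarrow> \<omega> \<in> B i" by metis
  have "AE \<omega> in M. \<forall>i. \<omega> \<in> A i \<longleftrightarrow> \<omega> \<in> B i"
    using B(2) by (simp add: AE_all_countable)
  then have "AE \<omega> in M. \<omega> \<in> (\<Union>i. A i) \<longleftrightarrow> \<omega> \<in> (\<Union>i. B i)"
    by eventually_elim auto
  with B(1) show ?case
    by (intro bexI[of _ "\<Union>i. B i"]) auto
qed auto

lemma increment_indep_augmented:
  assumes "0 \<le> s" "s < t"
    and Z: "Z \<in> borel_measurable (F s)" and g: "g \<in> borel_measurable borel"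
  shows "indep_var (borel :: real measure) Z (borel :: real measure) (\<lambda>\<omega>. g (W t \<omega> - W s \<omega>))"
  unfolding indep_var_eq
proof (intro conjI indep_set_sigma_sets)
  have [measurable]: "W t \<in> borel_measurable M" "W s \<in> borel_measurable M"
    using assms by (auto intro: measurable_W)
  note [measurable] = g
  show rv: "random_variable borel Z" "random_variable borel (\<lambda>\<omega>. g (W t \<omega> - W s \<omega>))"
    using measurable_F_M[OF Z] by auto
  show "indep_set {Z -` A \<inter> space M |A. A \<in> sets borel}
      {(\<lambda>\<omega>. g (W t \<omega> - W s \<omega>)) -` A \<inter> space M |A. A \<in> sets borel}"
  proof (rule indep_setI)
    show "{Z -` A \<inter> space M |A. A \<in> sets borel} \<subseteq> events"
      "{(\<lambda>\<omega>. g (W t \<omega> - W s \<omega>)) -` A \<inter> space M |A. A \<in> sets borel} \<subseteq> events"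
      using measurable_sets[OF rv(1)] measurable_sets[OF rv(2)] by auto
    fix a b assume "a \<in> {Z -` A \<inter> space M |A. A \<in> sets borel}"
      and "b \<in> {(\<lambda>\<omega>. g (W t \<omega> - W s \<omega>)) -` A \<inter> space M |A. A \<in> sets borel}"
    then obtain A B where AB: "A \<in> sets borel" "B \<in> sets borel" "a = Z -` A \<inter> space M"
      "b = (\<lambda>\<omega>. g (W t \<omega> - W s \<omega>)) -` B \<inter> space M" by auto
    have a: "a \<in> sets (F s)"
      using measurable_sets[OF Z AB(1)] AB(3) by simp
    have gB: "g -` B \<in> sets borel"
      using measurable_sets[OF g AB(2)] by simp
    have b: "b \<in> sets (vimage_algebra (space M) (\<lambda>\<omega>. W t \<omega> - W s \<omega>) borel)"
      using in_vimage_algebra[OF gB, of "\<lambda>\<omega>. W t \<omega> - W s \<omega>" "space M"] AB(4)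
      by (simp add: vimage_def)
    obtain a' where a': "a' \<in> sets (natural_filtration M W s)" "AE \<omega> in M. \<omega> \<in> a \<longleftrightarrow> \<omega> \<in> a'"
      using augmented_set_AE_eq_natural[OF a] by auto
    have ms [measurable]: "a \<in> events" "a' \<in> events" "b \<in> events"
      using a a' augmented_subset natural_subset measurable_sets[OF rv(2) AB(2)] AB(4) by auto
    have "prob (a \<inter> b) = prob (a' \<inter> b)" "prob a = prob a'"
      using a'(2) by (auto intro!: measure_eq_AE)
    then show "prob (a \<inter> b) = prob a * prob b"
      using indep_setD[OF increment_indep[OF assms(1,2)] a'(1) b] by simp
  qed
  have stable: "Int_stable {X -` A \<inter> space M |A. A \<in> sets borel}" for X :: "'a \<Rightarrow> real"
  proof (rule Int_stableI, safe)
    fix A B :: "real set" assume "A \<in> sets borel" "B \<in> sets borel"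
    then show "\<exists>C. X -` A \<inter> space M \<inter> (X -` B \<inter> space M) = X -` C \<inter> space M \<and> C \<in> sets borel"
      by (intro exI[of _ "A \<inter> B"]) auto
  qed
  show "Int_stable {Z -` A \<inter> space M |A. A \<in> sets borel}"
    "Int_stable {(\<lambda>\<omega>. g (W t \<omega> - W s \<omega>)) -` A \<inter> space M |A. A \<in> sets borel}"
    by (rule stable)+
qed

lemma increment_moments:
  assumes "0 \<le> s" "s \<le> t"
  shows "has_bochner_integral M (\<lambda>\<omega>. (W t \<omega> - W s \<omega>) $ k) 0"
    and "has_bochner_integral M (\<lambda>\<omega>. (W t \<omega> - W s \<omega>) $ k * (W t \<omega> - W s \<omega>) $ l) (if k = l then t - s else 0)"
    and "has_bochner_integral M (\<lambda>\<omega>. ((W t \<omega> - W s \<omega>) $ k) ^ 4) (3 * (t - s)\<^sup>2)"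
proof -
  have D: "has_bochner_integral M (\<lambda>\<omega>. g (W t \<omega> - W s \<omega>)) c"
    if "s < t" and [measurable]: "g \<in> borel_measurable borel" and g: "has_bochner_integral lborel (\<lambda>x. gauss_density (sqrt (t - s)) x * g x) c" for g :: "real^'n \<Rightarrow> real" and c
  proof -
    have d: "distributed M lborel (\<lambda>\<omega>. W t \<omega> - W s \<omega>) (\<lambda>x. ennreal (gauss_density (sqrt (t - s)) x))"
      using increment_distributed[OF assms(1) \<open>s < t\<close>] by (simp add: gauss_density_def)
    have "integrable M (\<lambda>\<omega>. g (W t \<omega> - W s \<omega>))"
      using g distributed_integrable[OF d, of g] by (simp add: has_bochner_integral_iff gauss_density_nonneg)
    moreover have "expectation (\<lambda>\<omega>. g (W t \<omega> - W s \<omega>)) = c"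
      using g distributed_integral[OF d, of g] by (simp add: has_bochner_integral_iff gauss_density_nonneg)
    ultimately show ?thesis by (simp add: has_bochner_integral_iff)
  qed
  show "has_bochner_integral M (\<lambda>\<omega>. (W t \<omega> - W s \<omega>) $ k) 0"
    using D[of "\<lambda>x. x $ k" 0] gauss_moments(1)[of "sqrt (t - s)" k] assms
    by (cases "s = t") (auto simp: has_bochner_integral_zero)
  show "has_bochner_integral M (\<lambda>\<omega>. (W t \<omega> - W s \<omega>) $ k * (W t \<omega> - W s \<omega>) $ l) (if k = l then t - s else 0)"
    using D[of "\<lambda>x. x $ k * x $ l"] gauss_moments(2)[of "sqrt (t - s)" k l] assms
    by (cases "s = t") (auto simp: has_bochner_integral_zero)
  have "sqrt (t - s) ^ 4 = (t - s)\<^sup>2"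
    using assms by (simp add: power4_eq_xxxx power2_eq_square)
  then show "has_bochner_integral M (\<lambda>\<omega>. ((W t \<omega> - W s \<omega>) $ k) ^ 4) (3 * (t - s)\<^sup>2)"
    using D[of "\<lambda>x. (x $ k) ^ 4"] gauss_moments(3)[of "sqrt (t - s)" k] assms
    by (cases "s = t") (auto simp: has_bochner_integral_zero)
qed

lemma past_times_function_of_increment:
  assumes "0 \<le> s" "s \<le> t" and Z: "Z \<in> borel_measurable (F s)" "integrable M Z"
    and g: "g \<in> borel_measurable borel" "has_bochner_integral M (\<lambda>\<omega>. g (W t \<omega> - W s \<omega>)) (c::real)"
  shows "has_bochner_integral M (\<lambda>\<omega>. Z \<omega> * g (W t \<omega> - W s \<omega>)) (expectation Z * c)"
proof (cases "s = t")
  case True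
  have "c = g 0"
    using has_bochner_integral_integral_eq[OF g(2)] True by (simp add: prob_space)
  then show ?thesis
    using True Z by (simp add: has_bochner_integral_iff)
next
  case False
  then have "indep_var borel Z borel (\<lambda>\<omega>. g (W t \<omega> - W s \<omega>))"
    using assms by (intro increment_indep_augmented) auto
  from indep_var_lebesgue_integral[OF this] indep_var_integrable[OF this]
  show ?thesis using Z g by (simp add: has_bochner_integral_iff)
qed

lemma past_times_increment:
  assumes "0 \<le> s" "s \<le> t" and Z: "Z \<in> borel_measurable (F s)" "integrable M Z"
  shows "has_bochner_integral M (\<lambda>\<omega>. Z \<omega> * (W t \<omega> - W s \<omega>) $ k) 0"
    and "has_bochner_integral M (\<lambda>\<omega>. Z \<omega> * ((W t \<omega> - W s \<omega>) $ k * (W t \<omega> - W s \<omega>) $ l))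
      (if k = l then expectation Z * (t - s) else 0)"
proof -
  note * = past_times_function_of_increment[OF assms]
  show "has_bochner_integral M (\<lambda>\<omega>. Z \<omega> * (W t \<omega> - W s \<omega>) $ k) 0"
    using *[of "\<lambda>x. x $ k" 0] increment_moments(1)[OF assms(1,2)] by simp
  show "has_bochner_integral M (\<lambda>\<omega>. Z \<omega> * ((W t \<omega> - W s \<omega>) $ k * (W t \<omega> - W s \<omega>) $ l))
      (if k = l then expectation Z * (t - s) else 0)"
    using *[of "\<lambda>x. x $ k * x $ l" "if k = l then t - s else 0"] increment_moments(2)[OF assms(1,2), of k l]
    by (simp add: if_distrib[of "(*) _"] del: vector_minus_component cong: if_cong)
qed

end

section \<open>Square integrals\<close>

text \<open>
  The square of the \<open>L\<^sup>2\<close> norm. It is used on \<open>\<Omega>\<close> for random variables and on \<open>\<real> \<times> \<Omega>\<close> for integrands;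
  values in \<open>ennreal\<close> avoid integrability conditions.
\<close>

definition sqnorm :: "'a measure \<Rightarrow> ('a \<Rightarrow> 'b::real_normed_vector) \<Rightarrow> ennreal" where
  "sqnorm N f = (\<integral>\<^sup>+x. ennreal ((norm (f x))\<^sup>2) \<partial>N)"

lemma sqnorm_mono: "(\<And>x. x \<in> space N \<Longrightarrow> norm (f x) \<le> norm (g x)) \<Longrightarrow> sqnorm N f \<le> sqnorm N g"
  unfolding sqnorm_def by (intro nn_integral_mono ennreal_leI power_mono) auto

lemma sqnorm_mono_AE: "(AE x in N. norm (f x) \<le> norm (g x)) \<Longrightarrow> sqnorm N f \<le> sqnorm N g"
  unfolding sqnorm_def by (intro nn_integral_mono_AE) (auto elim!: eventually_mono intro: ennreal_leI power_mono)

lemma sqnorm_minus_commute: "sqnorm N (\<lambda>x. f x - g x) = sqnorm N (\<lambda>x. g x - f x)"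
  by (simp add: sqnorm_def norm_minus_commute)

lemma norm_sq_add_le:
  fixes a b :: "'a::real_normed_vector"
  assumes "\<kappa> > 0"
  shows "(norm (a + b))\<^sup>2 \<le> (1 + \<kappa>) * (norm a)\<^sup>2 + (1 + 1 / \<kappa>) * (norm b)\<^sup>2"
proof -
  have "(norm (a + b))\<^sup>2 \<le> (norm a + norm b)\<^sup>2"
    by (intro power_mono norm_triangle_ineq) auto
  also have "\<dots> \<le> (1 + \<kappa>) * (norm a)\<^sup>2 + (1 + 1 / \<kappa>) * (norm b)\<^sup>2"
  proof -
    have "0 \<le> (sqrt \<kappa> * norm a - norm b / sqrt \<kappa>)\<^sup>2" by simp
    also have "\<dots> = \<kappa> * (norm a)\<^sup>2 + (norm b)\<^sup>2 / \<kappa> - 2 * norm a * norm b"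
      using assms by (simp add: power2_diff power_mult_distrib power_divide)
    finally show ?thesis by (simp add: power2_sum algebra_simps)
  qed
  finally show ?thesis .
qed

lemma sqnorm_add_le:
  fixes f g :: "'a \<Rightarrow> 'b::{real_normed_vector, second_countable_topology}"
  assumes "\<kappa> > 0" and [measurable]: "f \<in> borel_measurable N" "g \<in> borel_measurable N"
  shows "sqnorm N (\<lambda>x. f x + g x) \<le> ennreal (1 + \<kappa>) * sqnorm N f + ennreal (1 + 1 / \<kappa>) * sqnorm N g"
proof -
  have "sqnorm N (\<lambda>x. f x + g x)
      \<le> (\<integral>\<^sup>+x. ennreal (1 + \<kappa>) * ennreal ((norm (f x))\<^sup>2) + ennreal (1 + 1 / \<kappa>) * ennreal ((norm (g x))\<^sup>2) \<partial>N)"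
    unfolding sqnorm_def using assms(1) norm_sq_add_le[OF assms(1)]
    by (intro nn_integral_mono) (simp add: ennreal_mult[symmetric] ennreal_plus[symmetric] ennreal_leI del: ennreal_plus)
  also have "\<dots> = ennreal (1 + \<kappa>) * sqnorm N f + ennreal (1 + 1 / \<kappa>) * sqnorm N g"
    unfolding sqnorm_def by (subst nn_integral_add) (simp_all add: nn_integral_cmult)
  finally show ?thesis .
qed

lemma sqnorm_add_le2:
  fixes f g :: "'a \<Rightarrow> 'b::{real_normed_vector, second_countable_topology}"
  assumes [measurable]: "f \<in> borel_measurable N" "g \<in> borel_measurable N"
  shows "sqnorm N (\<lambda>x. f x + g x) \<le> 2 * sqnorm N f + 2 * sqnorm N g"
  using sqnorm_add_le[of 1 f N g] by simp

lemma sqnorm_scale_le: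
  fixes f :: "'a \<Rightarrow> 'b::{real_normed_vector, second_countable_topology}"
  assumes "f \<in> borel_measurable N" "0 \<le> c" "\<And>x. x \<in> space N \<Longrightarrow> norm (g x) \<le> c * norm (f x)"
  shows "sqnorm N g \<le> ennreal (c\<^sup>2) * sqnorm N f"
proof -
  have "sqnorm N g \<le> (\<integral>\<^sup>+x. ennreal (c\<^sup>2) * ennreal ((norm (f x))\<^sup>2) \<partial>N)"
    unfolding sqnorm_def using assms(2,3)
    by (intro nn_integral_mono)
      (auto simp: ennreal_mult[symmetric] power_mult_distrib[symmetric] intro!: ennreal_leI power_mono)
  then show ?thesis
    using assms(1) by (simp add: sqnorm_def nn_integral_cmult)
qed

lemma sqnorm_tendsto_add:
  fixes f g :: "nat \<Rightarrow> 'a \<Rightarrow> 'b::{real_normed_vector, second_countable_topology}"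
  assumes "\<And>n. f n \<in> borel_measurable N" "\<And>n. g n \<in> borel_measurable N"
    and "(\<lambda>n. sqnorm N (f n)) \<longlonglongrightarrow> 0" "(\<lambda>n. sqnorm N (g n)) \<longlonglongrightarrow> 0"
  shows "(\<lambda>n. sqnorm N (\<lambda>x. f n x + g n x)) \<longlonglongrightarrow> 0"
proof (rule tendsto_sandwich[OF _ _ tendsto_const])
  show "\<forall>\<^sub>F n in sequentially. sqnorm N (\<lambda>x. f n x + g n x) \<le> 2 * sqnorm N (f n) + 2 * sqnorm N (g n)"
    using assms(1,2) by (intro always_eventually allI sqnorm_add_le2)
  show "(\<lambda>n. 2 * sqnorm N (f n) + 2 * sqnorm N (g n)) \<longlonglongrightarrow> 0"
    using assms(3,4) by (auto intro!: tendsto_eq_intros ennreal_tendsto_cmult)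
qed simp

lemma sqnorm_tendsto_scale:
  fixes f :: "nat \<Rightarrow> 'a \<Rightarrow> 'b::{real_normed_vector, second_countable_topology}"
  assumes "\<And>n. f n \<in> borel_measurable N" "0 \<le> c" "\<And>n x. x \<in> space N \<Longrightarrow> norm (g n x) \<le> c * norm (f n x)"
    and "(\<lambda>n. sqnorm N (f n)) \<longlonglongrightarrow> 0"
  shows "(\<lambda>n. sqnorm N (g n)) \<longlonglongrightarrow> 0"
proof (rule tendsto_sandwich[OF _ _ tendsto_const])
  show "\<forall>\<^sub>F n in sequentially. sqnorm N (g n) \<le> ennreal (c\<^sup>2) * sqnorm N (f n)"
    using assms by (intro always_eventually allI sqnorm_scale_le)
  show "(\<lambda>n. ennreal (c\<^sup>2) * sqnorm N (f n)) \<longlonglongrightarrow> 0"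
    using assms(4) by (auto intro!: tendsto_eq_intros ennreal_tendsto_cmult)
qed simp

text \<open>
  Lower semicontinuity, in the form in which an isometry is carried from approximations to their limits;
  the two sides may live on different spaces.
\<close>

lemma sqnorm_limit_le:
  fixes f g :: "nat \<Rightarrow> _ \<Rightarrow> _::{real_normed_vector, second_countable_topology}"
  assumes fm [measurable]: "\<And>n. f n \<in> borel_measurable N" "F0 \<in> borel_measurable N"
    and gm [measurable]: "\<And>n. g n \<in> borel_measurable N'" "G0 \<in> borel_measurable N'"
    and f: "(\<lambda>n. sqnorm N (\<lambda>x. f n x - F0 x)) \<longlonglongrightarrow> 0"
    and g: "(\<lambda>n. sqnorm N' (\<lambda>x. g n x - G0 x)) \<longlonglongrightarrow> 0"
    and le: "\<And>n. sqnorm N (f n) \<le> sqnorm N' (g n)"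
  shows "sqnorm N F0 \<le> sqnorm N' G0"
proof -
  have *: "sqnorm N F0 \<le> ennreal (1 + \<kappa>) * (ennreal (1 + \<kappa>) * sqnorm N' G0)" if \<kappa>: "\<kappa> > 0" for \<kappa>
  proof (rule LIMSEQ_le_const)
    let ?a = "\<lambda>n. sqnorm N (\<lambda>x. f n x - F0 x)" and ?b = "\<lambda>n. sqnorm N' (\<lambda>x. g n x - G0 x)"
    show "(\<lambda>n. ennreal (1 + \<kappa>) * (ennreal (1 + \<kappa>) * sqnorm N' G0 + ennreal (1 + 1 / \<kappa>) * ?b n)
        + ennreal (1 + 1 / \<kappa>) * ?a n) \<longlonglongrightarrow> ennreal (1 + \<kappa>) * (ennreal (1 + \<kappa>) * sqnorm N' G0)"
      using f g by (auto intro!: tendsto_eq_intros ennreal_tendsto_cmult)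
    have "sqnorm N F0 \<le> ennreal (1 + \<kappa>) * (ennreal (1 + \<kappa>) * sqnorm N' G0 + ennreal (1 + 1 / \<kappa>) * ?b n)
        + ennreal (1 + 1 / \<kappa>) * ?a n" for n
    proof -
      have "sqnorm N F0 = sqnorm N (\<lambda>x. f n x + (F0 x - f n x))" by simp
      also have "\<dots> \<le> ennreal (1 + \<kappa>) * sqnorm N (f n) + ennreal (1 + 1 / \<kappa>) * ?a n"
        unfolding sqnorm_minus_commute[of N "f n"] by (intro sqnorm_add_le \<kappa>) auto
      also have "sqnorm N (f n) \<le> sqnorm N' (\<lambda>x. G0 x + (g n x - G0 x))"
        using le by simp
      also have "\<dots> \<le> ennreal (1 + \<kappa>) * sqnorm N' G0 + ennreal (1 + 1 / \<kappa>) * ?b n"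
        by (intro sqnorm_add_le \<kappa>) auto
      finally show ?thesis by (simp add: add_right_mono mult_left_mono)
    qed
    then show "\<exists>N0. \<forall>n\<ge>N0. sqnorm N F0 \<le> ennreal (1 + \<kappa>) * (ennreal (1 + \<kappa>) * sqnorm N' G0
        + ennreal (1 + 1 / \<kappa>) * ?b n) + ennreal (1 + 1 / \<kappa>) * ?a n" by blast
  qed
  have lim: "(\<lambda>n. ennreal (1 + 1 / Suc n)) \<longlonglongrightarrow> 1"
    unfolding ennreal_1[symmetric] by (intro tendsto_ennrealI) real_asymp
  show ?thesis
  proof (cases "sqnorm N' G0 = \<infinity>")
    case False
    then have "(\<lambda>n. ennreal (1 + 1 / Suc n) * (ennreal (1 + 1 / Suc n) * sqnorm N' G0)) \<longlonglongrightarrow> 1 * (1 * sqnorm N' G0)"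
      by (intro tendsto_mult_ennreal lim tendsto_const) auto
    then show ?thesis
      using * by (intro LIMSEQ_le_const[where a="sqnorm N F0"]) (auto simp del: of_nat_Suc)
  qed simp
qed

section \<open>Matrices acting on vectors\<close>

lemma borel_measurable_bounded_bilinear:
  assumes "bounded_bilinear (p :: 'a::{real_normed_vector,second_countable_topology} \<Rightarrow>
     'b::{real_normed_vector,second_countable_topology} \<Rightarrow> 'c::real_normed_vector)"
    and "f \<in> borel_measurable N" "g \<in> borel_measurable N"
  shows "(\<lambda>x. p (f x) (g x)) \<in> borel_measurable N"
  by (rule borel_measurable_continuous_Pair[OF assms(2,3), where H=p])
    (intro bounded_bilinear.continuous_on[OF assms(1)] continuous_on_fst continuous_on_snd continuous_on_id)

lemma bounded_bilinear_matrix_vector: "bounded_bilinear (\<lambda>(A::real^'n^'m) (x::real^'n). A *v x)"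
  unfolding bilinear_conv_bounded_bilinear[symmetric] bilinear_def
  by (auto intro!: linearI simp: matrix_vector_mult_add_rdistrib matrix_vector_right_distrib scaleR_matrix_vector_assoc)

lemma bounded_bilinear_matrix_matrix: "bounded_bilinear (\<lambda>(A::real^'m^'k) (B::real^'n^'m). A ** B)"
  unfolding bilinear_conv_bounded_bilinear[symmetric] bilinear_def
  by (auto intro!: linearI simp: matrix_matrix_mult_def vec_eq_iff algebra_simps sum.distrib sum_distrib_left)

lemmas borel_measurable_matrix_vector [measurable (raw)] =
  borel_measurable_bounded_bilinear[OF bounded_bilinear_matrix_vector]

lemmas borel_measurable_matrix_matrix [measurable (raw)] =
  borel_measurable_bounded_bilinear[OF bounded_bilinear_matrix_matrix]

lemma inner_matrix_vector:
  fixes A B :: "real^'n^'m"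
  shows "(A *v x) \<bullet> (B *v y) = (\<Sum>i\<in>UNIV. \<Sum>k\<in>UNIV. \<Sum>l\<in>UNIV. (A $ i $ k * B $ i $ l) * (x $ k * y $ l))"
  by (simp add: inner_vec_def matrix_vector_mult_def sum_product algebra_simps)

lemma vector_matrix_add_distribs:
  fixes A B :: "real^'n^'m"
  shows "(x + y) v* A = x v* A + y v* A" "x v* (A + B) = x v* A + x v* B"
    "(c *\<^sub>R x) v* A = c *\<^sub>R (x v* A)" "x v* (c *\<^sub>R A) = c *\<^sub>R (x v* A)"
  by (simp_all add: vector_matrix_mult_def vec_eq_iff algebra_simps sum.distrib sum_distrib_left)

lemma bounded_bilinear_vector_matrix: "bounded_bilinear (\<lambda>(x::real^'m) (A::real^'n^'m). x v* A)"
  unfolding bilinear_conv_bounded_bilinear[symmetric] bilinear_def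
  by (auto intro!: linearI simp: vector_matrix_add_distribs)

lemmas borel_measurable_vector_matrix [measurable (raw)] =
  borel_measurable_bounded_bilinear[OF bounded_bilinear_vector_matrix]

text \<open>
  A vector as a matrix with one row; it turns the inner product with a vector into a matrix product.
\<close>

definition row_matrix :: "'a^'m \<Rightarrow> 'a^'m^1" where
  "row_matrix u = (\<chi> i. u)"

lemma norm_singleton_vec: "norm (x :: 'a::real_normed_vector^1) = norm (x $ 1)"
  by (simp add: norm_vec_def UNIV_1)

lemma row_matrix_mult:
  fixes u x :: "real^'m" and A :: "real^'n^'m"
  shows "row_matrix u *v x = (\<chi> i. u \<bullet> x)" "row_matrix u ** A = row_matrix (u v* A)"
  by (simp_all add: row_matrix_def matrix_vector_mult_def matrix_matrix_mult_def vector_matrix_mult_def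
      inner_vec_def vec_eq_iff mult.commute)

lemma borel_measurable_row_matrix [measurable (raw)]:
  assumes "f \<in> borel_measurable N"
  shows "(\<lambda>x. row_matrix (f x :: real^'m)) \<in> borel_measurable N"
proof -
  have "linear (row_matrix :: real^'m \<Rightarrow> _)"
    by (auto intro!: linearI simp: row_matrix_def vec_eq_iff)
  then show ?thesis
    using assms by (intro measurable_compose[OF assms] borel_measurable_continuous_onI linear_continuous_on)
      (simp add: linear_conv_bounded_linear)
qed

lemma norm_matrix_vector_le: "norm (A *v x) \<le> norm A * norm x" for A :: "real^'n^'m"
proof -
  have "norm (A *v x) \<le> L2_set (\<lambda>i. norm (A $ i) * norm x) UNIV"
    unfolding norm_vec_def[of "A *v x"]
    by (intro L2_set_mono) (simp_all add: matrix_vector_mul_component Cauchy_Schwarz_ineq2)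
  also have "\<dots> = norm A * norm x"
    unfolding norm_vec_def[of A] by (rule L2_set_left_distrib[symmetric]) simp
  finally show ?thesis .
qed

lemma norm_vector_matrix_le: "norm (x v* A) \<le> norm x * norm A" for A :: "real^'n^'m"
proof -
  have "x v* A = (\<Sum>i\<in>UNIV. x $ i *\<^sub>R A $ i)"
    by (simp add: vector_matrix_mult_def vec_eq_iff mult.commute)
  also have "norm \<dots> \<le> (\<Sum>i\<in>UNIV. \<bar>x $ i\<bar> * \<bar>norm (A $ i)\<bar>)"
    by (rule order_trans[OF norm_sum]) simp
  also have "\<dots> \<le> L2_set (($) x) UNIV * L2_set (\<lambda>i. norm (A $ i)) UNIV"
    by (rule L2_set_mult_ineq)
  also have "\<dots> = norm x * norm A"
    by (simp add: norm_vec_def L2_set_def)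
  finally show ?thesis .
qed

section \<open>The isometry for simple processes\<close>

context standard_brownian_motion
begin

lemma bounded_measurable_integrable:
  fixes f :: "'a \<Rightarrow> 'b::{banach, second_countable_topology}"
  assumes "f \<in> borel_measurable M" "bounded (f ` space M)"
  shows "integrable M f"
proof -
  obtain B where "\<And>x. x \<in> space M \<Longrightarrow> norm (f x) \<le> B"
    using assms(2) unfolding bounded_iff by auto
  then show ?thesis
    using assms(1) by (intro integrable_const_bound[of _ B]) auto
qed

lemma bounded_entry:
  assumes "bounded (A ` S)" shows "bounded ((\<lambda>\<omega>. (A \<omega> :: real^'p^'q) $ i $ k) ` S)"
proof -
  obtain B where "\<And>x. x \<in> S \<Longrightarrow> norm (A x) \<le> B"
    using assms unfolding bounded_iff by auto
  then have "\<bar>A x $ i $ k\<bar> \<le> B" if "x \<in> S" for x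
    using that component_le_norm_cart[of "A x $ i" k] Finite_Cartesian_Product.norm_nth_le[of "A x" i]
    by (smt (verit) real_norm_def)
  then show ?thesis unfolding bounded_iff by auto
qed

lemma integrable_entry_product:
  fixes A B :: "'a \<Rightarrow> real^'p^'q"
  assumes "A \<in> borel_measurable M" "bounded (A ` space M)"
    and "B \<in> borel_measurable M" "bounded (B ` space M)"
  shows "integrable M (\<lambda>\<omega>. A \<omega> $ i $ k * B \<omega> $ j $ l)"
proof (rule bounded_measurable_integrable)
  show "(\<lambda>\<omega>. A \<omega> $ i $ k * B \<omega> $ j $ l) \<in> borel_measurable M"
    using assms by measurable
  obtain a b where "\<And>x. x \<in> space M \<Longrightarrow> \<bar>A x $ i $ k\<bar> \<le> a" "\<And>x. x \<in> space M \<Longrightarrow> \<bar>B x $ j $ l\<bar> \<le> b"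
    using bounded_entry[OF assms(2), of i k] bounded_entry[OF assms(4), of j l] unfolding bounded_iff by auto
  then have "\<bar>A x $ i $ k * B x $ j $ l\<bar> \<le> a * b" if "x \<in> space M" for x
    unfolding abs_mult using that by (intro mult_mono) (auto intro: order_trans[OF abs_ge_zero])
  then show "bounded ((\<lambda>\<omega>. A \<omega> $ i $ k * B \<omega> $ j $ l) ` space M)"
    unfolding bounded_iff by auto
qed

lemma isometry_same_interval_integrable:
  fixes A B :: "'a \<Rightarrow> real^'n^'m"
  assumes uv: "0 \<le> u" "u \<le> v"
    and A: "A \<in> borel_measurable (F u)" and B: "B \<in> borel_measurable (F u)"
    and int: "\<And>i k l. integrable M (\<lambda>\<omega>. A \<omega> $ i $ k * B \<omega> $ i $ l)"
  shows "has_bochner_integral M (\<lambda>\<omega>. (A \<omega> *v (W v \<omega> - W u \<omega>)) \<bullet> (B \<omega> *v (W v \<omega> - W u \<omega>)))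
    (expectation (\<lambda>\<omega>. A \<omega> \<bullet> B \<omega>) * (v - u))"
proof -
  have meas: "(\<lambda>\<omega>. A \<omega> $ i $ k * B \<omega> $ i $ l) \<in> borel_measurable (F u)" for i k l
    using A[measurable] B[measurable] by measurable
  have "has_bochner_integral M (\<lambda>\<omega>. (A \<omega> *v (W v \<omega> - W u \<omega>)) \<bullet> (B \<omega> *v (W v \<omega> - W u \<omega>)))
    (\<Sum>i\<in>UNIV. \<Sum>k\<in>UNIV. \<Sum>l\<in>UNIV. if k = l then expectation (\<lambda>\<omega>. A \<omega> $ i $ k * B \<omega> $ i $ l) * (v - u) else 0)"
    unfolding inner_matrix_vector
    by (intro has_bochner_integral_sum past_times_increment uv int meas)
  also have "(\<Sum>i\<in>UNIV. \<Sum>k\<in>UNIV. \<Sum>l\<in>UNIV. if k = l then expectation (\<lambda>\<omega>. A \<omega> $ i $ k * B \<omega> $ i $ l) * (v - u) else 0)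
      = expectation (\<lambda>\<omega>. A \<omega> \<bullet> B \<omega>) * (v - u)"
    by (simp add: inner_vec_def sum_distrib_right int)
  finally show ?thesis .
qed

lemma isometry_same_interval:
  fixes A B :: "'a \<Rightarrow> real^'n^'m"
  assumes "0 \<le> u" "u \<le> v"
    and A: "A \<in> borel_measurable (F u)" "bounded (A ` space M)"
    and B: "B \<in> borel_measurable (F u)" "bounded (B ` space M)"
  shows "has_bochner_integral M (\<lambda>\<omega>. (A \<omega> *v (W v \<omega> - W u \<omega>)) \<bullet> (B \<omega> *v (W v \<omega> - W u \<omega>)))
    (expectation (\<lambda>\<omega>. A \<omega> \<bullet> B \<omega>) * (v - u))"
  by (rule isometry_same_interval_integrable[OF assms(1,2) A(1) B(1)])
    (rule integrable_entry_product[OF measurable_F_M[OF A(1)] A(2) measurable_F_M[OF B(1)] B(2)])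

lemma past_orthogonal_increment:
  fixes X :: "'a \<Rightarrow> real^'m" and B :: "'a \<Rightarrow> real^'n^'m"
  assumes uv: "0 \<le> u" "u \<le> v"
    and X: "X \<in> borel_measurable (F u)" and B: "B \<in> borel_measurable (F u)"
    and int: "\<And>i k. integrable M (\<lambda>\<omega>. X \<omega> $ i * B \<omega> $ i $ k)"
  shows "has_bochner_integral M (\<lambda>\<omega>. X \<omega> \<bullet> (B \<omega> *v (W v \<omega> - W u \<omega>))) 0"
proof -
  have eq: "X \<omega> \<bullet> (B \<omega> *v (W v \<omega> - W u \<omega>))
      = (\<Sum>i\<in>UNIV. \<Sum>k\<in>UNIV. (X \<omega> $ i * B \<omega> $ i $ k) * (W v \<omega> - W u \<omega>) $ k)" for \<omega>
    by (simp add: inner_vec_def matrix_vector_mult_def sum_distrib_left mult.assoc)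
  have meas: "(\<lambda>\<omega>. X \<omega> $ i * B \<omega> $ i $ k) \<in> borel_measurable (F u)" for i k
    using X[measurable] B[measurable] by measurable
  have "has_bochner_integral M (\<lambda>\<omega>. X \<omega> \<bullet> (B \<omega> *v (W v \<omega> - W u \<omega>)))
    (\<Sum>i\<in>(UNIV::'m set). \<Sum>k\<in>(UNIV::'n set). 0)"
    unfolding eq by (intro has_bochner_integral_sum past_times_increment uv int meas)
  then show ?thesis by simp
qed

lemma isometry_orthogonal:
  fixes A B :: "'a \<Rightarrow> real^'n^'m"
  assumes uv: "0 \<le> a" "a \<le> u" "u \<le> c" "c \<le> v"
    and A: "A \<in> borel_measurable (F a)" "bounded (A ` space M)"
    and B: "B \<in> borel_measurable (F c)" "bounded (B ` space M)"
  shows "has_bochner_integral M (\<lambda>\<omega>. (A \<omega> *v (W u \<omega> - W a \<omega>)) \<bullet> (B \<omega> *v (W v \<omega> - W c \<omega>))) 0"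
proof (rule past_orthogonal_increment)
  have [measurable]: "W u \<in> borel_measurable (F c)" "W a \<in> borel_measurable (F c)" "A \<in> borel_measurable (F c)"
    using uv W_measurable_F measurable_F_mono[OF A(1)] by auto
  show "(\<lambda>\<omega>. A \<omega> *v (W u \<omega> - W a \<omega>)) \<in> borel_measurable (F c)" by measurable
  fix i k
  obtain b where b: "\<And>x. x \<in> space M \<Longrightarrow> \<bar>B x $ i $ k\<bar> \<le> b"
    using bounded_entry[OF B(2), of i k] unfolding bounded_iff by auto
  have [measurable]: "B \<in> borel_measurable M" by (rule measurable_F_M[OF B(1)])
  have "integrable M (\<lambda>\<omega>. A \<omega> $ i $ l * (W u \<omega> - W a \<omega>) $ l)" for l
  proof -
    have "integrable M (\<lambda>\<omega>. A \<omega> $ i $ l)"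
      using measurable_F_M[OF A(1)] by (intro bounded_measurable_integrable bounded_entry[OF A(2)]) simp
    then have "has_bochner_integral M (\<lambda>\<omega>. A \<omega> $ i $ l * (W u \<omega> - W a \<omega>) $ l) 0"
      using uv measurable_F_mono[OF A(1), of a] by (intro past_times_increment) auto
    then show ?thesis by (auto simp: has_bochner_integral_iff)
  qed
  then have "integrable M (\<lambda>\<omega>. (A \<omega> *v (W u \<omega> - W a \<omega>)) $ i)"
    by (simp add: matrix_vector_mult_def)
  then have "integrable M (\<lambda>\<omega>. b * (A \<omega> *v (W u \<omega> - W a \<omega>)) $ i)"
    by simp
  moreover have "(\<lambda>\<omega>. (A \<omega> *v (W u \<omega> - W a \<omega>)) $ i * B \<omega> $ i $ k) \<in> borel_measurable M"
    by (rule measurable_F_M[of _ c]) (use B(1) in measurable)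
  ultimately show "integrable M (\<lambda>\<omega>. (A \<omega> *v (W u \<omega> - W a \<omega>)) $ i * B \<omega> $ i $ k)"
  proof (rule Bochner_Integration.integrable_bound)
    show "AE \<omega> in M. norm ((A \<omega> *v (W u \<omega> - W a \<omega>)) $ i * B \<omega> $ i $ k) \<le> norm (b * (A \<omega> *v (W u \<omega> - W a \<omega>)) $ i)"
    proof (rule AE_I2)
      fix \<omega> assume "\<omega> \<in> space M"
      from b[OF this] show "norm ((A \<omega> *v (W u \<omega> - W a \<omega>)) $ i * B \<omega> $ i $ k) \<le> norm (b * (A \<omega> *v (W u \<omega> - W a \<omega>)) $ i)"
        by (simp only: real_norm_def abs_mult) (subst mult.commute, intro mult_right_mono, auto)
    qed
  qed
qed (use uv B in auto)

text \<open>
  For two increments that start at the same time \<open>c\<close>, the part of the longer one beyond the end of the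
  shorter one is orthogonal to the latter.
\<close>

lemma isometry_same_start:
  fixes A B :: "'a \<Rightarrow> real^'n^'m"
  assumes uv: "0 \<le> c" "c \<le> d" "c \<le> d'"
    and A: "A \<in> borel_measurable (F c)" "bounded (A ` space M)"
    and B: "B \<in> borel_measurable (F c)" "bounded (B ` space M)"
  shows "has_bochner_integral M (\<lambda>\<omega>. (A \<omega> *v (W d \<omega> - W c \<omega>)) \<bullet> (B \<omega> *v (W d' \<omega> - W c \<omega>)))
    (expectation (\<lambda>\<omega>. A \<omega> \<bullet> B \<omega>) * (min d d' - c))"
  using uv A B
proof (induction d d' arbitrary: A B rule: linorder_wlog)
  case (le d d')
  have "has_bochner_integral M
      (\<lambda>\<omega>. (A \<omega> *v (W d \<omega> - W c \<omega>)) \<bullet> (B \<omega> *v (W d \<omega> - W c \<omega>)) + (A \<omega> *v (W d \<omega> - W c \<omega>)) \<bullet> (B \<omega> *v (W d' \<omega> - W d \<omega>)))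
      (expectation (\<lambda>\<omega>. A \<omega> \<bullet> B \<omega>) * (d - c) + 0)"
  proof (rule has_bochner_integral_add)
    show "has_bochner_integral M (\<lambda>\<omega>. (A \<omega> *v (W d \<omega> - W c \<omega>)) \<bullet> (B \<omega> *v (W d \<omega> - W c \<omega>)))
        (expectation (\<lambda>\<omega>. A \<omega> \<bullet> B \<omega>) * (d - c))"
      by (rule isometry_same_interval) (use le in auto)
    show "has_bochner_integral M (\<lambda>\<omega>. (A \<omega> *v (W d \<omega> - W c \<omega>)) \<bullet> (B \<omega> *v (W d' \<omega> - W d \<omega>))) 0"
      by (rule isometry_orthogonal[OF _ _ _ _ _ _ measurable_F_mono]) (use le in simp_all)
  qed
  moreover have "(A \<omega> *v (W d \<omega> - W c \<omega>)) \<bullet> (B \<omega> *v (W d \<omega> - W c \<omega>)) + (A \<omega> *v (W d \<omega> - W c \<omega>)) \<bullet> (B \<omega> *v (W d' \<omega> - W d \<omega>))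
      = (A \<omega> *v (W d \<omega> - W c \<omega>)) \<bullet> (B \<omega> *v (W d' \<omega> - W c \<omega>))" for \<omega>
    by (simp add: inner_add_right[symmetric] matrix_vector_right_distrib[symmetric])
  ultimately show ?case using le(1) by simp
next
  case (sym d d')
  from sym(1)[of B A] sym(2-) show ?case
    by (simp add: inner_commute min.commute)
qed

lemma isometry_pair_le:
  fixes A B :: "'a \<Rightarrow> real^'n^'m"
  assumes le: "a \<le> c" "0 \<le> a" "a \<le> b" "c \<le> b'"
    and "A \<in> borel_measurable (F a)" "bounded (A ` space M)"
    and "B \<in> borel_measurable (F c)" "bounded (B ` space M)"
  shows "has_bochner_integral M (\<lambda>\<omega>. (A \<omega> *v (W b \<omega> - W a \<omega>)) \<bullet> (B \<omega> *v (W b' \<omega> - W c \<omega>)))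
    (expectation (\<lambda>\<omega>. A \<omega> \<bullet> B \<omega>) * max 0 (min b b' - max a c))"
proof -
  have "has_bochner_integral M
      (\<lambda>\<omega>. (A \<omega> *v (W (min b c) \<omega> - W a \<omega>)) \<bullet> (B \<omega> *v (W b' \<omega> - W c \<omega>))
        + (A \<omega> *v (W (max b c) \<omega> - W c \<omega>)) \<bullet> (B \<omega> *v (W b' \<omega> - W c \<omega>)))
      (0 + expectation (\<lambda>\<omega>. A \<omega> \<bullet> B \<omega>) * (min (max b c) b' - c))"
  proof (rule has_bochner_integral_add)
    show "has_bochner_integral M (\<lambda>\<omega>. (A \<omega> *v (W (min b c) \<omega> - W a \<omega>)) \<bullet> (B \<omega> *v (W b' \<omega> - W c \<omega>))) 0"
      by (rule isometry_orthogonal) (use assms in simp_all)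
    show "has_bochner_integral M (\<lambda>\<omega>. (A \<omega> *v (W (max b c) \<omega> - W c \<omega>)) \<bullet> (B \<omega> *v (W b' \<omega> - W c \<omega>)))
        (expectation (\<lambda>\<omega>. A \<omega> \<bullet> B \<omega>) * (min (max b c) b' - c))"
      by (rule isometry_same_start[OF _ _ _ measurable_F_mono]) (use assms in simp_all)
  qed
  moreover have "(A \<omega> *v (W (min b c) \<omega> - W a \<omega>)) \<bullet> (B \<omega> *v (W b' \<omega> - W c \<omega>))
        + (A \<omega> *v (W (max b c) \<omega> - W c \<omega>)) \<bullet> (B \<omega> *v (W b' \<omega> - W c \<omega>))
      = (A \<omega> *v (W b \<omega> - W a \<omega>)) \<bullet> (B \<omega> *v (W b' \<omega> - W c \<omega>))" for \<omega>
    by (simp add: inner_add_left[symmetric] matrix_vector_right_distrib[symmetric] min_def max_def)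
  moreover have "min (max b c) b' - c = max 0 (min b b' - max a c)"
    using le by (auto simp: min_def max_def)
  ultimately show ?thesis by simp
qed

lemma isometry_pair:
  fixes A B :: "'a \<Rightarrow> real^'n^'m"
  assumes "0 \<le> a" "a \<le> b" "0 \<le> a'" "a' \<le> b'"
    and "A \<in> borel_measurable (F a)" "bounded (A ` space M)"
    and "B \<in> borel_measurable (F a')" "bounded (B ` space M)"
  shows "has_bochner_integral M (\<lambda>\<omega>. (A \<omega> *v (W b \<omega> - W a \<omega>)) \<bullet> (B \<omega> *v (W b' \<omega> - W a' \<omega>)))
    (expectation (\<lambda>\<omega>. A \<omega> \<bullet> B \<omega>) * max 0 (min b b' - max a a'))"
proof (cases "a \<le> a'")
  case True
  then show ?thesis using assms by (intro isometry_pair_le)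
next
  case False
  then have "has_bochner_integral M (\<lambda>\<omega>. (B \<omega> *v (W b' \<omega> - W a' \<omega>)) \<bullet> (A \<omega> *v (W b \<omega> - W a \<omega>)))
    (expectation (\<lambda>\<omega>. B \<omega> \<bullet> A \<omega>) * max 0 (min b' b - max a' a))"
    using assms by (intro isometry_pair_le) auto
  then show ?thesis by (simp add: inner_commute min.commute max.commute)
qed

interpretation LM: pair_sigma_finite lborel M ..

lemma isometry_pair_time:
  fixes A B :: "'a \<Rightarrow> real^'n^'m"
  assumes [measurable]: "A \<in> borel_measurable M" "B \<in> borel_measurable M"
    and bd: "bounded (A ` space M)" "bounded (B ` space M)"
  shows "has_bochner_integral (lborel \<Otimes>\<^sub>M M)
    (\<lambda>p. (indicator {a<..b} (fst p) *\<^sub>R A (snd p)) \<bullet> (indicator {a'<..b'} (fst p) *\<^sub>R B (snd p)))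
    (expectation (\<lambda>\<omega>. A \<omega> \<bullet> B \<omega>) * max 0 (min b b' - max a a'))"
proof -
  let ?I = "indicator ({a<..b} \<inter> {a'<..b'}) :: real \<Rightarrow> real"
  have int: "integrable M (\<lambda>\<omega>. A \<omega> \<bullet> B \<omega>)"
    using integrable_entry_product[OF assms(1) bd(1) assms(2) bd(2)] by (simp add: inner_vec_def)
  have Ieq: "{a<..b} \<inter> {a'<..b'} = {max a a'<..min b b'}" by auto
  have I: "integrable lborel ?I" "integral\<^sup>L lborel ?I = max 0 (min b b' - max a a')"
    unfolding Ieq by (cases "max a a' \<le> min b b'"; auto)+
  have eq: "(indicator {a<..b} r *\<^sub>R A \<omega>) \<bullet> (indicator {a'<..b'} r *\<^sub>R B \<omega>) = ?I r * (A \<omega> \<bullet> B \<omega>)" for r \<omega>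
    by (auto simp: indicator_def)
  have "integrable (lborel \<Otimes>\<^sub>M M) (\<lambda>p. ?I (fst p) * (A (snd p) \<bullet> B (snd p)))"
    using I int by (intro LM.Fubini_integrable) (auto simp: abs_mult)
  moreover have "(\<integral>p. ?I (fst p) * (A (snd p) \<bullet> B (snd p)) \<partial>(lborel \<Otimes>\<^sub>M M)) = expectation (\<lambda>\<omega>. A \<omega> \<bullet> B \<omega>) * max 0 (min b b' - max a a')"
    unfolding LM.integral_fst'[OF calculation, symmetric] fst_conv snd_conv integral_mult_right_zero integral_mult_left_zero I(2)
    by (rule mult.commute)
  ultimately show ?thesis unfolding eq has_bochner_integral_iff by blast
qed

lemma simple_process_M:
  assumes "simple_process F T S" "(a, b, \<xi>) \<in> set S"
  shows "0 \<le> a" "a \<le> b" "b \<le> T" "\<xi> \<in> borel_measurable (F a)" "\<xi> \<in> borel_measurable M" "bounded (\<xi> ` space M)"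
  using assms measurable_F_M unfolding simple_process_def by (auto, blast+)

lemma measurable_simple_integral:
  assumes "simple_process F T S" "T \<le> T'"
  shows "simple_integral W S \<in> borel_measurable (F T')"
  using assms(1)
proof (induction S)
  case Nil
  then show ?case by (simp add: simple_integral_def[abs_def])
next
  case (Cons p S)
  obtain a b \<xi> where p: "p = (a, b, \<xi>)" by (cases p) auto
  have "(a, b, \<xi>) \<in> set (p # S)" using p by simp
  note s = simple_process_M[OF Cons.prems this]
  have [measurable]: "W a \<in> borel_measurable (F T')" "W b \<in> borel_measurable (F T')"
    using s(1-3) assms(2) by (auto intro!: W_measurable_F)
  have [measurable]: "\<xi> \<in> borel_measurable (F T')"
    by (rule measurable_F_mono[OF s(4)]) (use s(1-3) assms(2) in simp)
  have [measurable]: "simple_integral W S \<in> borel_measurable (F T')"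
    using Cons by (auto simp: simple_process_def)
  have "(\<lambda>\<omega>. \<xi> \<omega> *v (W b \<omega> - W a \<omega>) + simple_integral W S \<omega>) \<in> borel_measurable (F T')"
    by measurable
  then show ?case by (simp add: p simple_integral_def[abs_def])
qed

lemma measurable_simple_value:
  assumes "simple_process F T S"
  shows "(\<lambda>p. simple_value S (fst p) (snd p)) \<in> borel_measurable (lborel \<Otimes>\<^sub>M M)"
  using assms
proof (induction S)
  case Nil
  then show ?case by (simp add: simple_value_def[abs_def])
next
  case (Cons p S)
  obtain a b \<xi> where p: "p = (a, b, \<xi>)" by (cases p) auto
  have [measurable]: "\<xi> \<in> borel_measurable M"
    using simple_process_M(5)[OF Cons.prems, of a b \<xi>] p by simp
  have [measurable]: "(\<lambda>p. simple_value S (fst p) (snd p)) \<in> borel_measurable (lborel \<Otimes>\<^sub>M M)"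
    using Cons by (auto simp: simple_process_def)
  have "(\<lambda>p. indicator {a<..b} (fst p) *\<^sub>R \<xi> (snd p) + simple_value S (fst p) (snd p)) \<in> borel_measurable (lborel \<Otimes>\<^sub>M M)"
    by measurable
  then show ?case by (simp add: p simple_value_def[abs_def])
qed

text \<open>
  Since the intervals of a simple process may overlap, the square is expanded into pairs of intervals, and
  each pair contributes the length of the intersection.
\<close>

theorem simple_isometry:
  assumes S: "simple_process F T S"
  shows "sqnorm M (simple_integral W S) = sqnorm (lborel \<Otimes>\<^sub>M M) (\<lambda>p. simple_value S (fst p) (snd p))"
    and "sqnorm M (simple_integral W S) < \<infinity>"
proof -
  define c where "c i j = (case (S ! i, S ! j) of ((a, b, \<xi>), (a', b', \<xi>')) \<Rightarrow>
    expectation (\<lambda>\<omega>. \<xi> \<omega> \<bullet> \<xi>' \<omega>) * max 0 (min b b' - max a a'))" for i j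
  define X where "X i \<omega> = (case S ! i of (a, b, \<xi>) \<Rightarrow> \<xi> \<omega> *v (W b \<omega> - W a \<omega>))" for i \<omega>
  define V where "V i p = (case S ! i of (a, b, \<xi>) \<Rightarrow> indicator {a<..b} (fst p) *\<^sub>R \<xi> (snd p))" for i and p :: "real \<times> 'a"
  have X: "simple_integral W S \<omega> = (\<Sum>i<length S. X i \<omega>)" for \<omega>
    by (simp add: simple_integral_def sum_list_sum_nth X_def atLeast0LessThan)
  have V: "simple_value S (fst p) (snd p) = (\<Sum>i<length S. V i p)" for p
    by (simp add: simple_value_def sum_list_sum_nth V_def atLeast0LessThan)
  have c: "has_bochner_integral M (\<lambda>\<omega>. X i \<omega> \<bullet> X j \<omega>) (c i j)"
      "has_bochner_integral (lborel \<Otimes>\<^sub>M M) (\<lambda>p. V i p \<bullet> V j p) (c i j)"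
    if "i < length S" "j < length S" for i j
  proof -
    obtain a b \<xi> a' b' \<xi>' where ij: "S ! i = (a, b, \<xi>)" "S ! j = (a', b', \<xi>')"
      by (cases "S ! i", cases "S ! j") auto
    have "(a, b, \<xi>) \<in> set S" "(a', b', \<xi>') \<in> set S"
      using that ij by (metis nth_mem)+
    note s = simple_process_M[OF S this(1)] simple_process_M[OF S this(2)]
    show "has_bochner_integral M (\<lambda>\<omega>. X i \<omega> \<bullet> X j \<omega>) (c i j)"
      unfolding X_def c_def ij prod.case using s by (intro isometry_pair) auto
    show "has_bochner_integral (lborel \<Otimes>\<^sub>M M) (\<lambda>p. V i p \<bullet> V j p) (c i j)"
      unfolding V_def c_def ij prod.case using s by (intro isometry_pair_time) auto
  qed
  let ?c = "\<Sum>i<length S. \<Sum>j<length S. c j i"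
  have "has_bochner_integral M (\<lambda>\<omega>. (norm (simple_integral W S \<omega>))\<^sup>2) ?c"
    unfolding X power2_norm_eq_inner inner_sum_left inner_sum_right
    by (intro has_bochner_integral_sum c) auto
  moreover have "has_bochner_integral (lborel \<Otimes>\<^sub>M M) (\<lambda>p. (norm (simple_value S (fst p) (snd p)))\<^sup>2) ?c"
    unfolding V power2_norm_eq_inner inner_sum_left inner_sum_right
    by (intro has_bochner_integral_sum c) auto
  ultimately have "sqnorm M (simple_integral W S) = ennreal ?c"
    "sqnorm (lborel \<Otimes>\<^sub>M M) (\<lambda>p. simple_value S (fst p) (snd p)) = ennreal ?c"
    unfolding sqnorm_def by (auto simp: nn_integral_eq_integral has_bochner_integral_iff)
  then show "sqnorm M (simple_integral W S) = sqnorm (lborel \<Otimes>\<^sub>M M) (\<lambda>p. simple_value S (fst p) (snd p))"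
    "sqnorm M (simple_integral W S) < \<infinity>" by auto
qed

lemma simple_integral_mean_zero:
  assumes "simple_process F T S"
  shows "has_bochner_integral M (simple_integral W S) 0"
  using assms
proof (induction S)
  case Nil
  then show ?case by (simp add: simple_integral_def[abs_def] has_bochner_integral_zero)
next
  case (Cons p S)
  obtain a b \<xi> where p: "p = (a, b, \<xi>)" by (cases p) auto
  have "(a, b, \<xi>) \<in> set (p # S)" using p by simp
  note s = simple_process_M[OF Cons.prems this]
  have "has_bochner_integral M (\<lambda>\<omega>. \<xi> \<omega> *v (W b \<omega> - W a \<omega>)) 0"
  proof -
    have "has_bochner_integral M (\<lambda>\<omega>. axis i 1 \<bullet> (\<xi> \<omega> *v (W b \<omega> - W a \<omega>))) 0" for i :: 'b
    proof (rule past_orthogonal_increment)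
      show "integrable M (\<lambda>\<omega>. axis i 1 $ ia * \<xi> \<omega> $ ia $ k)" for ia k
        using s(5) by (intro integrable_mult_right bounded_measurable_integrable bounded_entry s(6)) measurable
    qed (use s in auto)
    then have "has_bochner_integral M (\<lambda>\<omega>. \<Sum>i\<in>UNIV. (axis i 1 \<bullet> (\<xi> \<omega> *v (W b \<omega> - W a \<omega>))) *\<^sub>R axis i (1::real))
        (\<Sum>i\<in>(UNIV::'b set). 0 *\<^sub>R axis i (1::real))"
      by (intro has_bochner_integral_sum has_bochner_integral_scaleR_left)
    moreover have "(\<Sum>i\<in>UNIV. (axis i 1 \<bullet> x) *\<^sub>R axis i (1::real)) = x" for x :: "real^'b"
      using basis_expansion[of x] by (simp add: inner_axis' scalar_mult_eq_scaleR)
    ultimately show ?thesis by simp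
  qed
  moreover have "has_bochner_integral M (simple_integral W S) 0"
    using Cons by (auto simp: simple_process_def)
  ultimately have "has_bochner_integral M (\<lambda>\<omega>. \<xi> \<omega> *v (W b \<omega> - W a \<omega>) + simple_integral W S \<omega>) (0 + 0)"
    by (rule has_bochner_integral_add)
  then show ?case by (simp add: p simple_integral_def[abs_def])
qed

end

section \<open>Limits of simple integrals\<close>

text \<open>
  Integrands are jointly measurable on \<open>[0, T] \<times> \<Omega>\<close> only; extended by zero they become measurable on \<open>\<real> \<times> \<Omega>\<close>.
\<close>

lemma borel_measurable_indicator_extension:
  assumes "(\<lambda>(r, \<omega>). H r \<omega>) \<in> borel_measurable (restrict_space lborel {0..T::real} \<Otimes>\<^sub>M M)"
    and "0 \<le> u" "v \<le> T"
  shows "(\<lambda>p. indicator {u<..v} (fst p) *\<^sub>R (H (fst p) (snd p) :: 'b::{real_normed_vector,second_countable_topology}))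
    \<in> borel_measurable (lborel \<Otimes>\<^sub>M M)"
proof -
  let ?R = "restrict_space (lborel \<Otimes>\<^sub>M M) ({0..T} \<times> space M)"
  have R: "{0..T} \<times> space M \<inter> space (lborel \<Otimes>\<^sub>M M) \<in> sets (lborel \<Otimes>\<^sub>M M)"
    by (simp add: space_pair_measure Times_Int_Times)
  have "(\<lambda>p. (fst p, snd p)) \<in> ?R \<rightarrow>\<^sub>M restrict_space lborel {0..T} \<Otimes>\<^sub>M M"
  proof (rule measurable_Pair)
    show "fst \<in> ?R \<rightarrow>\<^sub>M restrict_space lborel {0..T}"
      by (rule measurable_restrict_space2) (auto simp: space_restrict_space intro!: measurable_restrict_space1)
    show "snd \<in> ?R \<rightarrow>\<^sub>M M"
      by (intro measurable_restrict_space1 measurable_snd)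
  qed
  from measurable_compose[OF this assms(1)]
  have "(\<lambda>p. H (fst p) (snd p)) \<in> borel_measurable ?R" by (simp add: case_prod_beta')
  then have [measurable]: "(\<lambda>p. indicator ({0..T} \<times> space M) p *\<^sub>R H (fst p) (snd p)) \<in> borel_measurable (lborel \<Otimes>\<^sub>M M)"
    by (subst (asm) borel_measurable_restrict_space_iff[OF R])
  have "(\<lambda>p. indicator {u<..v} (fst p) *\<^sub>R (indicator ({0..T} \<times> space M) p *\<^sub>R H (fst p) (snd p))) \<in> borel_measurable (lborel \<Otimes>\<^sub>M M)"
    by measurable
  also have "(\<lambda>p. indicator {u<..v} (fst p) *\<^sub>R (indicator ({0..T} \<times> space M) p *\<^sub>R H (fst p) (snd p))) \<in> borel_measurable (lborel \<Otimes>\<^sub>M M)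
     \<longleftrightarrow> (\<lambda>p. indicator {u<..v} (fst p) *\<^sub>R H (fst p) (snd p)) \<in> borel_measurable (lborel \<Otimes>\<^sub>M M)"
    using assms(2,3) by (intro measurable_cong) (auto simp: indicator_def space_pair_measure)
  finally show ?thesis .
qed

context standard_brownian_motion
begin

interpretation LM: pair_sigma_finite lborel M ..

text \<open>The second moment controls the first one.\<close>

lemma L1_le_L2:
  fixes f :: "'a \<Rightarrow> 'b::{banach, second_countable_topology}"
  assumes [measurable]: "f \<in> borel_measurable M" and f: "sqnorm M f \<le> ennreal (c\<^sup>2)" and "0 \<le> c"
  shows "integrable M f" "integrable M (\<lambda>\<omega>. (norm (f \<omega>))\<^sup>2)" "expectation (\<lambda>\<omega>. (norm (f \<omega>))\<^sup>2) \<le> c\<^sup>2"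
    "expectation (\<lambda>\<omega>. norm (f \<omega>)) \<le> c"
proof -
  show sq: "integrable M (\<lambda>\<omega>. (norm (f \<omega>))\<^sup>2)"
    using f by (intro integrableI_bounded) (auto simp: sqnorm_def elim: order_le_less_trans)
  then have "ennreal (expectation (\<lambda>\<omega>. (norm (f \<omega>))\<^sup>2)) \<le> ennreal (c\<^sup>2)"
    using f by (simp add: sqnorm_def nn_integral_eq_integral)
  then show E2: "expectation (\<lambda>\<omega>. (norm (f \<omega>))\<^sup>2) \<le> c\<^sup>2"
    by (simp add: ennreal_le_iff)
  have ineq: "norm (f \<omega>) \<le> (d + (norm (f \<omega>))\<^sup>2 / d) / 2" if "d > 0" for d \<omega>
  proof -
    have "0 \<le> (norm (f \<omega>) - d)\<^sup>2" by simp
    then show ?thesis using that by (simp add: power2_diff field_simps power2_eq_square)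
  qed
  show "integrable M f"
  proof (rule Bochner_Integration.integrable_bound)
    show "integrable M (\<lambda>\<omega>. (1 + (norm (f \<omega>))\<^sup>2 / 1) / 2)" using sq by simp
    show "AE \<omega> in M. norm (f \<omega>) \<le> norm ((1 + (norm (f \<omega>))\<^sup>2 / 1) / 2)"
      using ineq[of 1] by (simp add: abs_of_nonneg add_nonneg_nonneg)
  qed simp
  then have int: "integrable M (\<lambda>\<omega>. norm (f \<omega>))" by simp
  show "expectation (\<lambda>\<omega>. norm (f \<omega>)) \<le> c"
  proof (rule dense_ge)
    fix d assume "c < d"
    then have "d > 0" using assms(3) by simp
    have "expectation (\<lambda>\<omega>. norm (f \<omega>)) \<le> expectation (\<lambda>\<omega>. (d + (norm (f \<omega>))\<^sup>2 / d) / 2)"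
      using int sq ineq[OF \<open>d > 0\<close>] by (intro integral_mono) auto
    also have "\<dots> = (d + expectation (\<lambda>\<omega>. (norm (f \<omega>))\<^sup>2) / d) / 2"
      using sq by (simp add: prob_space)
    also have "\<dots> \<le> (d + d\<^sup>2 / d) / 2"
      using E2 \<open>c < d\<close> \<open>0 \<le> c\<close> by (intro divide_right_mono add_left_mono) (auto intro: order_trans power_mono)
    finally show "expectation (\<lambda>\<omega>. norm (f \<omega>)) \<le> d"
      using \<open>d > 0\<close> by (simp add: power2_eq_square)
  qed
qed

lemma sqnorm_tendsto_L1:
  fixes f :: "nat \<Rightarrow> 'a \<Rightarrow> 'b::{banach, second_countable_topology}"
  assumes fm [measurable]: "\<And>n. f n \<in> borel_measurable M" and f: "(\<lambda>n. sqnorm M (f n)) \<longlonglongrightarrow> 0"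
  shows "(\<lambda>n. expectation (\<lambda>\<omega>. norm (f n \<omega>))) \<longlonglongrightarrow> 0"
proof (rule LIMSEQ_I)
  fix e :: real assume "e > 0"
  then have "\<forall>\<^sub>F n in sequentially. sqnorm M (f n) < ennreal ((e / 2)\<^sup>2)"
    by (intro order_tendstoD(2)[OF f]) simp
  then obtain n0 where n0: "\<And>n. n \<ge> n0 \<Longrightarrow> sqnorm M (f n) \<le> ennreal ((e / 2)\<^sup>2)"
    unfolding eventually_sequentially by (meson less_imp_le)
  have "norm (expectation (\<lambda>\<omega>. norm (f n \<omega>)) - 0) < e" if "n \<ge> n0" for n
    using L1_le_L2(4)[OF fm n0[OF that]] \<open>e > 0\<close> by (simp add: abs_of_nonneg)
  then show "\<exists>n0. \<forall>n\<ge>n0. norm (expectation (\<lambda>\<omega>. norm (f n \<omega>)) - 0) < e" by blast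
qed

text \<open>
  \<open>ito_limit s T h X\<close> means that \<open>X\<close> is a version of \<open>\<integral>\<^sub>s\<^sup>T h dW\<close>. The integrand is a function on
  the product space; it is the limit in \<open>L\<^sup>2(\<real> \<times> \<Omega>)\<close> of simple processes living on \<open>(s, T]\<close>, so that
  it vanishes almost everywhere outside that interval.
\<close>

definition ito_limit :: "real \<Rightarrow> real \<Rightarrow> (real \<times> 'a \<Rightarrow> real^'n^'m) \<Rightarrow> ('a \<Rightarrow> real^'m) \<Rightarrow> bool" where
  "ito_limit s T h X \<longleftrightarrow> X \<in> borel_measurable M \<and> h \<in> borel_measurable (lborel \<Otimes>\<^sub>M M) \<and>
    (\<exists>P. (\<forall>n. simple_process F T (P n) \<and> (\<forall>(a, b, \<xi>)\<in>set (P n). s \<le> a)) \<and>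
      (\<lambda>n. sqnorm (lborel \<Otimes>\<^sub>M M) (\<lambda>p. simple_value (P n) (fst p) (snd p) - h p)) \<longlonglongrightarrow> 0 \<and>
      (\<lambda>n. sqnorm M (\<lambda>\<omega>. simple_integral W (P n) \<omega> - X \<omega>)) \<longlonglongrightarrow> 0)"

lemma measurable_simple_integral_M: "simple_process F T S \<Longrightarrow> simple_integral W S \<in> borel_measurable M"
  using measurable_simple_integral[of T S T] by (intro measurable_F_M) auto

context
  fixes s T :: real and h :: "real \<times> 'a \<Rightarrow> real^'n^'m" and X :: "'a \<Rightarrow> real^'m"
  assumes lim: "ito_limit s T h X"
begin

lemma ito_limit_measurable: "X \<in> borel_measurable M" "h \<in> borel_measurable (lborel \<Otimes>\<^sub>M M)"
  using lim by (auto simp: ito_limit_def)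

lemma ito_limit_sqnorm_le: "sqnorm M X \<le> sqnorm (lborel \<Otimes>\<^sub>M M) h"
proof -
  obtain P where P: "\<And>n. simple_process F T (P n)"
      "(\<lambda>n. sqnorm (lborel \<Otimes>\<^sub>M M) (\<lambda>p. simple_value (P n) (fst p) (snd p) - h p)) \<longlonglongrightarrow> 0"
      "(\<lambda>n. sqnorm M (\<lambda>\<omega>. simple_integral W (P n) \<omega> - X \<omega>)) \<longlonglongrightarrow> 0"
    using lim unfolding ito_limit_def by blast
  note ito_limit_measurable [measurable]
  show ?thesis
    by (rule sqnorm_limit_le[OF _ _ _ _ P(3,2)])
      (auto intro: measurable_simple_integral_M measurable_simple_value P(1) simp: simple_isometry(1)[OF P(1)] ito_limit_measurable)
qed

lemma ito_limit_sqnorm_finite: "sqnorm M X < \<infinity>"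
proof -
  obtain P where P: "\<And>n. simple_process F T (P n)"
      "(\<lambda>n. sqnorm M (\<lambda>\<omega>. simple_integral W (P n) \<omega> - X \<omega>)) \<longlonglongrightarrow> 0"
    using lim unfolding ito_limit_def by blast
  have "\<forall>\<^sub>F n in sequentially. sqnorm M (\<lambda>\<omega>. simple_integral W (P n) \<omega> - X \<omega>) < 1"
    by (intro order_tendstoD(2)[OF P(2)]) simp
  then obtain n where n: "sqnorm M (\<lambda>\<omega>. simple_integral W (P n) \<omega> - X \<omega>) < 1"
    by (auto simp: eventually_sequentially)
  have [measurable]: "simple_integral W (P n) \<in> borel_measurable M" "X \<in> borel_measurable M"
    using P(1) ito_limit_measurable measurable_simple_integral_M by auto
  have "sqnorm M X = sqnorm M (\<lambda>\<omega>. simple_integral W (P n) \<omega> + (X \<omega> - simple_integral W (P n) \<omega>))" by simp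
  also have "\<dots> \<le> 2 * sqnorm M (simple_integral W (P n)) + 2 * sqnorm M (\<lambda>\<omega>. X \<omega> - simple_integral W (P n) \<omega>)"
    by (intro sqnorm_add_le2) auto
  also have "\<dots> < \<infinity>"
    using order_less_trans[OF n, of \<infinity>] simple_isometry(2)[OF P(1)[of n]]
    by (simp add: ennreal_mult_less_top sqnorm_minus_commute[of M X])
  finally show ?thesis .
qed

lemma ito_limit_square_integrable:
  "integrable M X" "integrable M (\<lambda>\<omega>. (norm (X \<omega>))\<^sup>2)"
proof -
  obtain c where c: "sqnorm M X = ennreal c" "0 \<le> c"
    using ito_limit_sqnorm_finite by (cases "sqnorm M X") auto
  then have "sqnorm M X \<le> ennreal ((sqrt c)\<^sup>2)" by simp
  from L1_le_L2(1,2)[OF ito_limit_measurable(1) this] c(2)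
  show "integrable M X" "integrable M (\<lambda>\<omega>. (norm (X \<omega>))\<^sup>2)" by auto
qed

lemma ito_limit_mean_zero: "expectation X = 0"
proof -
  obtain P where P: "\<And>n. simple_process F T (P n)"
      "(\<lambda>n. sqnorm M (\<lambda>\<omega>. simple_integral W (P n) \<omega> - X \<omega>)) \<longlonglongrightarrow> 0"
    using lim unfolding ito_limit_def by blast
  note m = measurable_simple_integral_M[OF P(1)] ito_limit_measurable(1)
  have le: "norm (expectation X) \<le> expectation (\<lambda>\<omega>. norm (simple_integral W (P n) \<omega> - X \<omega>))" for n
  proof -
    note z = simple_integral_mean_zero[OF P(1)[of n]]
    have "expectation X = - expectation (\<lambda>\<omega>. simple_integral W (P n) \<omega> - X \<omega>)"
      using z ito_limit_square_integrable(1) by (simp add: has_bochner_integral_iff)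
    then show ?thesis
      using integral_norm_bound[of M "\<lambda>\<omega>. simple_integral W (P n) \<omega> - X \<omega>"] by simp
  qed
  have "(\<lambda>n. expectation (\<lambda>\<omega>. norm (simple_integral W (P n) \<omega> - X \<omega>))) \<longlonglongrightarrow> 0"
    using m by (intro sqnorm_tendsto_L1 P(2)) auto
  then have "norm (expectation X) \<le> 0"
    by (rule LIMSEQ_le_const) (use le in auto)
  then show ?thesis by simp
qed

text \<open>
  A subsequence of the adapted simple integrals converges almost surely, and null sets belong to the
  filtration.
\<close>

lemma ito_limit_adapted: "X \<in> borel_measurable (F T)"
proof -
  obtain P where P: "\<And>n. simple_process F T (P n)"
      "(\<lambda>n. sqnorm M (\<lambda>\<omega>. simple_integral W (P n) \<omega> - X \<omega>)) \<longlonglongrightarrow> 0"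
    using lim unfolding ito_limit_def by blast
  note m = measurable_simple_integral_M[OF P(1)] ito_limit_measurable(1)
  have "\<exists>r::nat\<Rightarrow>nat. strict_mono r \<and> (AE \<omega> in M. (\<lambda>n. simple_integral W (P (r n)) \<omega> - X \<omega>) \<longlonglongrightarrow> 0)"
  proof (rule tendsto_L1_AE_subseq)
    show "integrable M (\<lambda>\<omega>. simple_integral W (P n) \<omega> - X \<omega>)" for n
      using simple_integral_mean_zero[OF P(1)[of n]] ito_limit_square_integrable(1)
      by (auto simp: has_bochner_integral_iff)
    show "(\<lambda>n. expectation (\<lambda>\<omega>. norm (simple_integral W (P n) \<omega> - X \<omega>))) \<longlonglongrightarrow> 0"
      using m by (intro sqnorm_tendsto_L1 P(2)) auto
  qed
  then obtain r where r: "AE \<omega> in M. (\<lambda>n. simple_integral W (P (r n)) \<omega> - X \<omega>) \<longlonglongrightarrow> 0" by blast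
  show ?thesis
  proof (rule measurable_F_AE_eq)
    show "(\<lambda>\<omega>. lim (\<lambda>n. simple_integral W (P (r n)) \<omega>)) \<in> borel_measurable (F T)"
      by (rule borel_measurable_lim_metric) (rule measurable_simple_integral[OF P(1) order_refl])
    show "AE \<omega> in M. X \<omega> = lim (\<lambda>n. simple_integral W (P (r n)) \<omega>)"
      using r by eventually_elim (auto simp: LIM_zero_iff limI)
  qed (rule m(2))
qed

lemma ito_limit_mult:
  assumes K: "K \<in> borel_measurable (F s)" "bounded (K ` space M)"
  shows "ito_limit s T (\<lambda>p. K (snd p) ** h p :: real^'n^'k) (\<lambda>\<omega>. K \<omega> *v X \<omega>)"
proof -
  obtain P where P: "\<And>n. simple_process F T (P n)" "\<And>n a b \<xi>. (a, b, \<xi>) \<in> set (P n) \<Longrightarrow> s \<le> a"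
      "(\<lambda>n. sqnorm (lborel \<Otimes>\<^sub>M M) (\<lambda>p. simple_value (P n) (fst p) (snd p) - h p)) \<longlonglongrightarrow> 0"
      "(\<lambda>n. sqnorm M (\<lambda>\<omega>. simple_integral W (P n) \<omega> - X \<omega>)) \<longlonglongrightarrow> 0"
    using lim unfolding ito_limit_def by blast
  define Q where "Q n = map (\<lambda>(a, b, \<xi>). (a, b, \<lambda>\<omega>. K \<omega> ** \<xi> \<omega>)) (P n)" for n
  obtain c where c: "\<And>x. x \<in> space M \<Longrightarrow> norm (K x) \<le> c" "0 \<le> c"
    using K(2) unfolding bounded_iff by (metis imageI norm_ge_zero order_trans linear)
  interpret mm: bounded_bilinear "\<lambda>(A::real^'m^'k) (B::real^'n^'m). A ** B" by (rule bounded_bilinear_matrix_matrix)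
  interpret mv: bounded_bilinear "\<lambda>(A::real^'m^'k) (x::real^'m). A *v x" by (rule bounded_bilinear_matrix_vector)
  obtain d where d: "0 \<le> d" "\<And>A B. norm ((A::real^'m^'k) ** (B::real^'n^'m)) \<le> norm A * norm B * d"
    using mm.nonneg_bounded by blast
  obtain e where e: "0 \<le> e" "\<And>A B. norm ((A::real^'m^'k) *v B) \<le> norm A * norm B * e"
    using mv.nonneg_bounded by blast
  have dK: "norm (K x ** B) \<le> (c * d) * norm B" if "x \<in> space M" for x and B :: "real^'n^'m"
  proof -
    have "norm (K x) * norm B * d \<le> c * norm B * d"
      using c that d(1) by (intro mult_right_mono) auto
    then show ?thesis using d(2)[of "K x" B] by (simp add: mult_ac)
  qed
  have eK: "norm (K x *v y) \<le> (c * e) * norm y" if "x \<in> space M" for x and y :: "real^'m"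
  proof -
    have "norm (K x) * norm y * e \<le> c * norm y * e"
      using c that e(1) by (intro mult_right_mono) auto
    then show ?thesis using e(2)[of "K x" y] by (simp add: mult_ac)
  qed
  have [measurable]: "K \<in> borel_measurable M" "X \<in> borel_measurable M" "h \<in> borel_measurable (lborel \<Otimes>\<^sub>M M)"
    using ito_limit_measurable measurable_F_M[OF K(1)] by auto
  have "simple_value (map (\<lambda>(a, b, \<xi>). (a, b, \<lambda>\<omega>. K \<omega> ** \<xi> \<omega>)) S) r \<omega> = K \<omega> ** simple_value S r \<omega>" for S :: "('a, 'n, 'm) simple_process" and r \<omega>
    by (induction S) (auto simp: simple_value_def mm.zero_right mm.add_right mm.scaleR_right)
  then have val: "simple_value (Q n) r \<omega> = K \<omega> ** simple_value (P n) r \<omega>" for n r \<omega>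
    by (simp add: Q_def)
  have "simple_integral W (map (\<lambda>(a, b, \<xi>). (a, b, \<lambda>\<omega>. K \<omega> ** \<xi> \<omega>)) S) \<omega> = K \<omega> *v simple_integral W S \<omega>" for S :: "('a, 'n, 'm) simple_process" and \<omega>
    by (induction S) (auto simp: simple_integral_def matrix_vector_right_distrib matrix_vector_mul_assoc)
  then have intg: "simple_integral W (Q n) \<omega> = K \<omega> *v simple_integral W (P n) \<omega>" for n \<omega>
    by (simp add: Q_def)
  show ?thesis
    unfolding ito_limit_def
  proof (intro conjI exI[of _ Q] allI)
    show "simple_process F T (Q n)" for n
      unfolding simple_process_def
    proof (safe)
      fix a b \<xi>' assume "(a, b, \<xi>') \<in> set (Q n)"
      then obtain \<xi> where \<xi>: "(a, b, \<xi>) \<in> set (P n)" "\<xi>' = (\<lambda>\<omega>. K \<omega> ** \<xi> \<omega>)"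
        by (auto simp: Q_def)
      note q = simple_process_M[OF P(1) \<xi>(1)]
      show "0 \<le> a" "a \<le> b" "b \<le> T" using q by auto
      show "\<xi>' \<in> borel_measurable (F a)"
        unfolding \<xi>(2) using q(4)[measurable] measurable_F_mono[OF K(1) P(2)[OF \<xi>(1)], measurable] by measurable
      obtain C where C: "\<And>x. x \<in> space M \<Longrightarrow> norm (\<xi> x) \<le> C"
        using q(6) unfolding bounded_iff by auto
      have "norm (\<xi>' x) \<le> c * d * C" if "x \<in> space M" for x
        unfolding \<xi>(2) using dK[OF that, of "\<xi> x"] mult_left_mono[OF C[OF that], of "c * d"] c(2) d(1) by auto
      then show "bounded (\<xi>' ` space (F a))" unfolding bounded_iff by auto
    qed
    show "\<forall>(a, b, \<xi>)\<in>set (Q n). s \<le> a" for n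
      using P(2) by (fastforce simp: Q_def)
    show "(\<lambda>n. sqnorm (lborel \<Otimes>\<^sub>M M) (\<lambda>p. simple_value (Q n) (fst p) (snd p) - K (snd p) ** h p)) \<longlonglongrightarrow> 0"
    proof (rule sqnorm_tendsto_scale[OF _ _ _ P(3)])
      show "(\<lambda>p. simple_value (P n) (fst p) (snd p) - h p) \<in> borel_measurable (lborel \<Otimes>\<^sub>M M)" for n
        using measurable_simple_value[OF P(1), measurable] by measurable
      show "norm (simple_value (Q n) (fst p) (snd p) - K (snd p) ** h p) \<le> (c * d) * norm (simple_value (P n) (fst p) (snd p) - h p)"
        if "p \<in> space (lborel \<Otimes>\<^sub>M M)" for n p
        using dK[of "snd p"] that unfolding val by (simp add: mm.diff_right[symmetric] space_pair_measure mem_Times_iff)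
    qed (use c d in auto)
    show "(\<lambda>n. sqnorm M (\<lambda>\<omega>. simple_integral W (Q n) \<omega> - K \<omega> *v X \<omega>)) \<longlonglongrightarrow> 0"
    proof (rule sqnorm_tendsto_scale[OF _ _ _ P(4)])
      show "(\<lambda>\<omega>. simple_integral W (P n) \<omega> - X \<omega>) \<in> borel_measurable M" for n
        using measurable_simple_integral_M[OF P(1), measurable] by measurable
      show "norm (simple_integral W (Q n) \<omega> - K \<omega> *v X \<omega>) \<le> (c * e) * norm (simple_integral W (P n) \<omega> - X \<omega>)"
        if "\<omega> \<in> space M" for n \<omega>
        using eK[OF that] unfolding intg by (simp add: matrix_vector_mult_diff_distrib[symmetric])
    qed (use c e in auto)
  qed measurable
qed

text \<open>The same with an unbounded factor \<open>U\<close>, by truncation.\<close>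

lemma ito_limit_inner:
  assumes U [measurable]: "U \<in> borel_measurable (F s)"
  shows "sqnorm M (\<lambda>\<omega>. U \<omega> \<bullet> X \<omega>) \<le> sqnorm (lborel \<Otimes>\<^sub>M M) (\<lambda>p. U (snd p) v* h p)"
    and "integrable M (\<lambda>\<omega>. U \<omega> \<bullet> X \<omega>) \<Longrightarrow> expectation (\<lambda>\<omega>. U \<omega> \<bullet> X \<omega>) = 0"
proof -
  \<comment> \<open>The truncations of \<open>U\<close> are bounded and known at time \<open>s\<close>, so that they may be moved into the integral.\<close>
  define V where "V n \<omega> = (if norm (U \<omega>) \<le> real n then U \<omega> else 0)" for n \<omega>
  have [measurable]: "V n \<in> borel_measurable (F s)" for n
    unfolding V_def by measurable
  have [measurable]: "U \<in> borel_measurable M" "V n \<in> borel_measurable M" "X \<in> borel_measurable M"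
    "h \<in> borel_measurable (lborel \<Otimes>\<^sub>M M)" for n
    using ito_limit_measurable measurable_F_M[OF U] measurable_F_M[of "V n" s] by auto
  have lim: "ito_limit s T (\<lambda>p. row_matrix (V n (snd p) v* h p)) (\<lambda>\<omega>. \<chi> i. V n \<omega> \<bullet> X \<omega>)" for n
  proof -
    have "norm (row_matrix (V n \<omega>)) \<le> real n" for \<omega>
      by (simp add: norm_singleton_vec row_matrix_def V_def)
    then have "bounded ((\<lambda>\<omega>. row_matrix (V n \<omega>)) ` space M)"
      unfolding bounded_iff by auto
    then show ?thesis
      using ito_limit_mult[of "\<lambda>\<omega>. row_matrix (V n \<omega>)"] by (simp add: row_matrix_mult)
  qed
  have Vlim: "(\<lambda>n. V n \<omega>) \<longlonglongrightarrow> U \<omega>" for \<omega>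
  proof (rule tendsto_eventually)
    show "\<forall>\<^sub>F n in sequentially. V n \<omega> = U \<omega>"
      unfolding V_def using eventually_ge_at_top[of "nat \<lceil>norm (U \<omega>)\<rceil>"] by eventually_elim (auto simp: nat_le_iff ceiling_le_iff)
  qed
  have le: "sqnorm M (\<lambda>\<omega>. V n \<omega> \<bullet> X \<omega>) \<le> sqnorm (lborel \<Otimes>\<^sub>M M) (\<lambda>p. U (snd p) v* h p)" for n
  proof -
    have "sqnorm M (\<lambda>\<omega>. V n \<omega> \<bullet> X \<omega>) = sqnorm M (\<lambda>\<omega>. \<chi> i::1. V n \<omega> \<bullet> X \<omega>)"
      by (simp add: sqnorm_def norm_singleton_vec)
    also have "\<dots> \<le> sqnorm (lborel \<Otimes>\<^sub>M M) (\<lambda>p. row_matrix (V n (snd p) v* h p))"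
      by (rule standard_brownian_motion.ito_limit_sqnorm_le[OF standard_brownian_motion_axioms lim])
    also have "\<dots> \<le> sqnorm (lborel \<Otimes>\<^sub>M M) (\<lambda>p. U (snd p) v* h p)"
      by (intro sqnorm_mono) (auto simp: norm_singleton_vec row_matrix_def V_def)
    finally show ?thesis .
  qed
  show "sqnorm M (\<lambda>\<omega>. U \<omega> \<bullet> X \<omega>) \<le> sqnorm (lborel \<Otimes>\<^sub>M M) (\<lambda>p. U (snd p) v* h p)"
  proof (rule LIMSEQ_le_const2)
    show "(\<lambda>n. sqnorm M (\<lambda>\<omega>. V n \<omega> \<bullet> X \<omega>)) \<longlonglongrightarrow> sqnorm M (\<lambda>\<omega>. U \<omega> \<bullet> X \<omega>)"
      unfolding sqnorm_def
    proof (rule nn_integral_LIMSEQ)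
      show "incseq (\<lambda>n \<omega>. ennreal ((norm (V n \<omega> \<bullet> X \<omega>))\<^sup>2))"
        by (auto simp: incseq_def le_fun_def V_def)
      show "(\<lambda>n. ennreal ((norm (V n \<omega> \<bullet> X \<omega>))\<^sup>2)) \<longlonglongrightarrow> ennreal ((norm (U \<omega> \<bullet> X \<omega>))\<^sup>2)" for \<omega>
        by (intro tendsto_ennrealI tendsto_power tendsto_norm tendsto_inner Vlim tendsto_const)
    qed measurable
  qed (use le in auto)
  assume int: "integrable M (\<lambda>\<omega>. U \<omega> \<bullet> X \<omega>)"
  have "(\<lambda>n. expectation (\<lambda>\<omega>. V n \<omega> \<bullet> X \<omega>)) \<longlonglongrightarrow> expectation (\<lambda>\<omega>. U \<omega> \<bullet> X \<omega>)"
  proof (rule integral_dominated_convergence)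
    show "integrable M (\<lambda>\<omega>. \<bar>U \<omega> \<bullet> X \<omega>\<bar>)" using int by simp
    show "AE \<omega> in M. norm (V n \<omega> \<bullet> X \<omega>) \<le> \<bar>U \<omega> \<bullet> X \<omega>\<bar>" for n
      by (auto simp: V_def)
    show "AE \<omega> in M. (\<lambda>n. V n \<omega> \<bullet> X \<omega>) \<longlonglongrightarrow> U \<omega> \<bullet> X \<omega>"
      by (intro AE_I2 tendsto_inner Vlim tendsto_const)
  qed measurable
  moreover have "expectation (\<lambda>\<omega>. V n \<omega> \<bullet> X \<omega>) = 0" for n
  proof -
    note L = standard_brownian_motion.ito_limit_mean_zero[OF standard_brownian_motion_axioms lim[of n]]
      standard_brownian_motion.ito_limit_square_integrable(1)[OF standard_brownian_motion_axioms lim[of n]]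
    have "expectation (\<lambda>\<omega>. (\<chi> i::1. V n \<omega> \<bullet> X \<omega>) $ 1) = expectation (\<lambda>\<omega>. (\<chi> i::1. V n \<omega> \<bullet> X \<omega>)) $ 1"
      by (intro integral_bounded_linear L(2) bounded_linear_vec_nth)
    then show ?thesis using L(1) by simp
  qed
  ultimately show "expectation (\<lambda>\<omega>. U \<omega> \<bullet> X \<omega>) = 0"
    by (simp add: LIMSEQ_const_iff)
qed

end

lemma simple_value_append: "simple_value (P @ Q) r \<omega> = simple_value P r \<omega> + simple_value Q r \<omega>"
  by (simp add: simple_value_def)

lemma simple_integral_append: "simple_integral W (P @ Q) \<omega> = simple_integral W P \<omega> + simple_integral W Q \<omega>"
  by (simp add: simple_integral_def)

lemma ito_limit_add:
  assumes "ito_limit s T h X" "ito_limit s T k Y"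
  shows "ito_limit s T (\<lambda>p. h p + k p) (\<lambda>\<omega>. X \<omega> + Y \<omega>)"
proof -
  obtain P where P: "\<And>n. simple_process F T (P n)" "\<And>n a b \<xi>. (a, b, \<xi>) \<in> set (P n) \<Longrightarrow> s \<le> a"
      "(\<lambda>n. sqnorm (lborel \<Otimes>\<^sub>M M) (\<lambda>p. simple_value (P n) (fst p) (snd p) - h p)) \<longlonglongrightarrow> 0"
      "(\<lambda>n. sqnorm M (\<lambda>\<omega>. simple_integral W (P n) \<omega> - X \<omega>)) \<longlonglongrightarrow> 0"
    using assms(1) unfolding ito_limit_def by blast
  obtain Q where Q: "\<And>n. simple_process F T (Q n)" "\<And>n a b \<xi>. (a, b, \<xi>) \<in> set (Q n) \<Longrightarrow> s \<le> a"
      "(\<lambda>n. sqnorm (lborel \<Otimes>\<^sub>M M) (\<lambda>p. simple_value (Q n) (fst p) (snd p) - k p)) \<longlonglongrightarrow> 0"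
      "(\<lambda>n. sqnorm M (\<lambda>\<omega>. simple_integral W (Q n) \<omega> - Y \<omega>)) \<longlonglongrightarrow> 0"
    using assms(2) unfolding ito_limit_def by blast
  note [measurable] = ito_limit_measurable[OF assms(1)] ito_limit_measurable[OF assms(2)]
    measurable_simple_value[OF P(1)] measurable_simple_value[OF Q(1)]
    measurable_simple_integral_M[OF P(1)] measurable_simple_integral_M[OF Q(1)]
  show ?thesis
    unfolding ito_limit_def
  proof (intro conjI exI[of _ "\<lambda>n. P n @ Q n"] allI)
    show "simple_process F T (P n @ Q n)" for n
      using P(1)[of n] Q(1)[of n] by (auto simp: simple_process_def)
    show "\<forall>(a, b, \<xi>)\<in>set (P n @ Q n). s \<le> a" for n
      using P(2) Q(2) by fastforce
    show "(\<lambda>n. sqnorm (lborel \<Otimes>\<^sub>M M) (\<lambda>p. simple_value (P n @ Q n) (fst p) (snd p) - (h p + k p))) \<longlonglongrightarrow> 0"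
      unfolding simple_value_append add_diff_add
      by (rule sqnorm_tendsto_add[OF _ _ P(3) Q(3)]) measurable
    show "(\<lambda>n. sqnorm M (\<lambda>\<omega>. simple_integral W (P n @ Q n) \<omega> - (X \<omega> + Y \<omega>))) \<longlonglongrightarrow> 0"
      unfolding simple_integral_append add_diff_add
      by (rule sqnorm_tendsto_add[OF _ _ P(4) Q(4)]) measurable
  qed measurable
qed

lemma ito_limit_scaleR:
  assumes "ito_limit s T h X"
  shows "ito_limit s T (\<lambda>p. c *\<^sub>R h p) (\<lambda>\<omega>. c *\<^sub>R X \<omega>)"
proof -
  have "ito_limit s T (\<lambda>p. (mat c :: real^'b^'b) ** h p) (\<lambda>\<omega>. mat c *v X \<omega>)"
    by (rule ito_limit_mult[OF assms]) (auto intro: bounded_subset[of "{mat c}"])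
  moreover have "(mat c :: real^'b^'b) ** A = c *\<^sub>R A" for A :: "real^'n^'b"
    by (simp add: mat_def matrix_matrix_mult_def vec_eq_iff if_distrib[of "\<lambda>x. x * _"] cong: if_cong)
  moreover have "(mat c :: real^'b^'b) *v x = c *\<^sub>R x" for x
    by (simp add: mat_def matrix_vector_mult_def vec_eq_iff if_distrib[of "\<lambda>x. x * _"] cong: if_cong)
  ultimately show ?thesis by simp
qed

lemma ito_limit_elementary:
  assumes "0 \<le> s" "s \<le> T" "\<xi> \<in> borel_measurable (F s)" "bounded (\<xi> ` space M)"
  shows "ito_limit s T (\<lambda>p. indicator {s<..T} (fst p) *\<^sub>R \<xi> (snd p)) (\<lambda>\<omega>. \<xi> \<omega> *v (W T \<omega> - W s \<omega>))"
proof -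
  have [measurable]: "W T \<in> borel_measurable M" "W s \<in> borel_measurable M" "\<xi> \<in> borel_measurable M"
    using assms measurable_F_M by (auto intro: measurable_W)
  show ?thesis
    unfolding ito_limit_def
    by (intro conjI exI[of _ "\<lambda>_. [(s, T, \<xi>)]"])
      (use assms in \<open>auto simp: simple_process_def simple_value_def simple_integral_def sqnorm_def\<close>)
qed

lemma sqnorm_snd:
  fixes g :: "real \<times> 'a \<Rightarrow> 'b::{real_normed_vector, second_countable_topology}"
  assumes [measurable]: "g \<in> borel_measurable (lborel \<Otimes>\<^sub>M M)"
  shows "sqnorm (lborel \<Otimes>\<^sub>M M) g = (\<integral>\<^sup>+\<omega>. \<integral>\<^sup>+r. ennreal ((norm (g (r, \<omega>)))\<^sup>2) \<partial>lborel \<partial>M)"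
  unfolding sqnorm_def by (rule LM.nn_integral_snd[symmetric]) measurable

text \<open>
  A bound on the second moment at each time of \<open>(s, T]\<close> gives a bound on the time integral.
\<close>

lemma sqnorm_time_le:
  fixes g :: "real \<times> 'a \<Rightarrow> 'b::{real_normed_vector, second_countable_topology}"
  assumes [measurable]: "g \<in> borel_measurable (lborel \<Otimes>\<^sub>M M)"
    and le: "\<And>r. s < r \<Longrightarrow> r \<le> T \<Longrightarrow> sqnorm M (\<lambda>\<omega>. g (r, \<omega>)) \<le> ennreal c"
    and zero: "\<And>r \<omega>. \<not> (s < r \<and> r \<le> T) \<Longrightarrow> g (r, \<omega>) = 0" and "s \<le> T" "0 \<le> c"
  shows "sqnorm (lborel \<Otimes>\<^sub>M M) g \<le> ennreal (c * (T - s))"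
proof -
  have "sqnorm (lborel \<Otimes>\<^sub>M M) g = (\<integral>\<^sup>+r. sqnorm M (\<lambda>\<omega>. g (r, \<omega>)) \<partial>lborel)"
    unfolding sqnorm_def by (rule nn_integral_fst[symmetric]) measurable
  also have "\<dots> \<le> (\<integral>\<^sup>+r. ennreal c * indicator {s<..T} r \<partial>lborel)"
  proof (rule nn_integral_mono)
    fix r
    show "sqnorm M (\<lambda>\<omega>. g (r, \<omega>)) \<le> ennreal c * indicator {s<..T} r"
      using le[of r] zero[of r] by (cases "s < r \<and> r \<le> T") (auto simp: sqnorm_def)
  qed
  also have "\<dots> = ennreal (c * (T - s))"
    using assms(4,5) by (simp add: nn_integral_cmult ennreal_mult)
  finally show ?thesis .
qed

text \<open>Integrals over \<open>(s, T]\<close> are differences of integrals from \<open>0\<close>.\<close>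

lemma ito_limit_increment:
  assumes HT: "has_ito_integral M F W T H I" and Hs: "has_ito_integral M F W s H J" and sT: "0 \<le> s" "s \<le> T"
  shows "ito_limit s T (\<lambda>p. indicator {s<..T} (fst p) *\<^sub>R H (fst p) (snd p)) (\<lambda>\<omega>. I \<omega> - J \<omega> :: real^'m)"
proof -
  have Hm: "(\<lambda>p. indicator {u<..v} (fst p) *\<^sub>R H (fst p) (snd p)) \<in> borel_measurable (lborel \<Otimes>\<^sub>M M)"
    if "0 \<le> u" "v \<le> T" for u v
    using HT that by (intro borel_measurable_indicator_extension) (auto simp: has_ito_integral_def)
  have conv: "(\<lambda>n. sqnorm (lborel \<Otimes>\<^sub>M M) (\<lambda>p. indicator {u<..v} (fst p) *\<^sub>R (simple_value (P n) (fst p) (snd p) - H (fst p) (snd p)))) \<longlonglongrightarrow> 0"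
    if P: "\<And>n. simple_process F T' (P n)"
      "(\<lambda>n. \<integral>\<^sup>+\<omega>. (\<integral>\<^sup>+r\<in>{0..T'}. ennreal ((norm (simple_value (P n) r \<omega> - H r \<omega>))\<^sup>2) \<partial>lborel) \<partial>M) \<longlonglongrightarrow> 0"
      and uv: "0 \<le> u" "v \<le> T'" "T' \<le> T" for u v T' and P :: "nat \<Rightarrow> ('a, 'n, 'm) simple_process"
  proof (rule tendsto_sandwich[OF _ _ tendsto_const P(2)])
    show "\<forall>\<^sub>F n in sequentially. sqnorm (lborel \<Otimes>\<^sub>M M) (\<lambda>p. indicator {u<..v} (fst p) *\<^sub>R (simple_value (P n) (fst p) (snd p) - H (fst p) (snd p)))
      \<le> (\<integral>\<^sup>+\<omega>. (\<integral>\<^sup>+r\<in>{0..T'}. ennreal ((norm (simple_value (P n) r \<omega> - H r \<omega>))\<^sup>2) \<partial>lborel) \<partial>M)"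
    proof (intro always_eventually allI)
      fix n
      have [measurable]: "(\<lambda>p. indicator {u<..v} (fst p) *\<^sub>R (simple_value (P n) (fst p) (snd p) - H (fst p) (snd p))) \<in> borel_measurable (lborel \<Otimes>\<^sub>M M)"
        unfolding scaleR_diff_right using measurable_simple_value[OF P(1), measurable] Hm[OF uv(1) order_trans[OF uv(2,3)], measurable] by measurable
      have "sqnorm (lborel \<Otimes>\<^sub>M M) (\<lambda>p. indicator {u<..v} (fst p) *\<^sub>R (simple_value (P n) (fst p) (snd p) - H (fst p) (snd p)))
          = (\<integral>\<^sup>+\<omega>. \<integral>\<^sup>+r. ennreal ((norm (indicator {u<..v} r *\<^sub>R (simple_value (P n) r \<omega> - H r \<omega>)))\<^sup>2) \<partial>lborel \<partial>M)"
        by (subst sqnorm_snd) simp_all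
      also have "\<dots> \<le> (\<integral>\<^sup>+\<omega>. (\<integral>\<^sup>+r\<in>{0..T'}. ennreal ((norm (simple_value (P n) r \<omega> - H r \<omega>))\<^sup>2) \<partial>lborel) \<partial>M)"
        using uv by (intro nn_integral_mono) (auto simp: indicator_def)
      finally show "sqnorm (lborel \<Otimes>\<^sub>M M) (\<lambda>p. indicator {u<..v} (fst p) *\<^sub>R (simple_value (P n) (fst p) (snd p) - H (fst p) (snd p)))
          \<le> (\<integral>\<^sup>+\<omega>. (\<integral>\<^sup>+r\<in>{0..T'}. ennreal ((norm (simple_value (P n) r \<omega> - H r \<omega>))\<^sup>2) \<partial>lborel) \<partial>M)" .
    qed
  qed simp
  obtain P where P: "\<And>n. simple_process F T (P n)"
      "(\<lambda>n. \<integral>\<^sup>+\<omega>. (\<integral>\<^sup>+r\<in>{0..T}. ennreal ((norm (simple_value (P n) r \<omega> - H r \<omega>))\<^sup>2) \<partial>lborel) \<partial>M) \<longlonglongrightarrow> 0"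
      "(\<lambda>n. sqnorm M (\<lambda>\<omega>. simple_integral W (P n) \<omega> - I \<omega>)) \<longlonglongrightarrow> 0"
    using HT unfolding has_ito_integral_def sqnorm_def by blast
  obtain Q where Q: "\<And>n. simple_process F s (Q n)"
      "(\<lambda>n. \<integral>\<^sup>+\<omega>. (\<integral>\<^sup>+r\<in>{0..s}. ennreal ((norm (simple_value (Q n) r \<omega> - H r \<omega>))\<^sup>2) \<partial>lborel) \<partial>M) \<longlonglongrightarrow> 0"
      "(\<lambda>n. sqnorm M (\<lambda>\<omega>. simple_integral W (Q n) \<omega> - J \<omega>)) \<longlonglongrightarrow> 0"
    using Hs unfolding has_ito_integral_def sqnorm_def by blast
  \<comment> \<open>\<open>cut\<close> restricts a simple process to \<open>(s, T]\<close>. The process \<open>R = cut P - P + Q\<close> vanishes there and is \<open>Q - P\<close> on \<open>(0, s]\<close>.\<close>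
  define cut :: "('a, 'n, 'm) simple_process \<Rightarrow> ('a, 'n, 'm) simple_process"
    where "cut = map (\<lambda>(a, b, \<xi>). (max a s, max b s, \<xi>))"
  define neg :: "('a, 'n, 'm) simple_process \<Rightarrow> ('a, 'n, 'm) simple_process"
    where "neg = map (\<lambda>(a, b, \<xi>). (a, b, \<lambda>\<omega>. - \<xi> \<omega>))"
  define R where "R n = cut (P n) @ neg (P n) @ Q n" for n
  have cut: "simple_process F T (cut S) \<and> (\<forall>(a, b, \<xi>)\<in>set (cut S). s \<le> a)" if "simple_process F T S" for S
  proof -
    have "0 \<le> a' \<and> a' \<le> b' \<and> b' \<le> T \<and> \<xi> \<in> borel_measurable (F a') \<and> bounded (\<xi> ` space (F a')) \<and> s \<le> a'"
      if m: "(a', b', \<xi>) \<in> set (cut S)" for a' b' \<xi>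
    proof -
      obtain a b where ab: "(a, b, \<xi>) \<in> set S" "a' = max a s" "b' = max b s"
        using m by (auto simp: cut_def)
      note q = simple_process_M[OF \<open>simple_process F T S\<close> ab(1)]
      have "\<xi> \<in> borel_measurable (F a')"
        by (rule measurable_F_mono[OF q(4)]) (simp add: ab)
      then show ?thesis using q(1-3,6) ab(2,3) sT by auto
    qed
    then show ?thesis unfolding simple_process_def by blast
  qed
  have neg: "simple_process F T (neg S)" if "simple_process F T S" for S
    using that unfolding simple_process_def neg_def by (fastforce simp: bounded_iff)
  have QT: "simple_process F T (Q n)" for n
    using Q(1)[of n] sT unfolding simple_process_def by fastforce
  have R: "simple_process F T (R n)" for n
    using cut[OF P(1)[of n]] neg[OF P(1)[of n]] QT[of n] unfolding R_def simple_process_def by auto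
  have "simple_value (cut S) r \<omega> = indicator {s<..T} r *\<^sub>R simple_value S r \<omega>" if "simple_process F T S" for S r \<omega>
    using that
  proof (induction S)
    case (Cons p S)
    obtain a b \<xi> where p: "p = (a, b, \<xi>)" by (cases p) auto
    have ab: "a \<le> b" "b \<le> T" using Cons.prems p by (auto simp: simple_process_def)
    have "indicator {max a s<..max b s} r = (indicator {s<..T} r * indicator {a<..b} r :: real)"
      using ab by (auto simp: indicator_def)
    moreover have "simple_process F T S" using Cons.prems by (auto simp: simple_process_def)
    ultimately show ?case using Cons.IH by (simp add: cut_def p simple_value_def scaleR_add_right)
  qed (simp add: cut_def simple_value_def)
  note vcut = this[OF P(1)]
  have vneg: "simple_value (neg S) r \<omega> = - simple_value S r \<omega>" for S r \<omega>
    by (induction S) (auto simp: neg_def simple_value_def)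
  have ineg: "simple_integral W (neg S) \<omega> = - simple_integral W S \<omega>" for S \<omega>
    by (induction S) (auto simp: neg_def simple_integral_def matrix_vector_mult_def vec_eq_iff sum_negf)
  have supp: "indicator {0<..T'} r *\<^sub>R simple_value S r \<omega> = simple_value S r \<omega>" if "simple_process F T' S" for T' r \<omega> and S :: "('a, 'n, 'm) simple_process"
    using that
  proof (induction S)
    case (Cons p S)
    obtain a b \<xi> where p: "p = (a, b, \<xi>)" by (cases p) auto
    have ab: "0 \<le> a" "b \<le> T'" using Cons.prems p by (auto simp: simple_process_def)
    have "indicator {a<..b} r = (indicator {0<..T'} r * indicator {a<..b} r :: real)"
      using ab by (auto simp: indicator_def)
    moreover have "simple_process F T' S" using Cons.prems by (auto simp: simple_process_def)
    ultimately show ?case using Cons.IH by (simp add: p simple_value_def scaleR_add_right)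
  qed (simp add: simple_value_def)
  have Rval: "simple_value (R n) r \<omega> = indicator {0<..s} r *\<^sub>R (simple_value (Q n) r \<omega> - H r \<omega>)
      + (- 1) *\<^sub>R (indicator {0<..s} r *\<^sub>R (simple_value (P n) r \<omega> - H r \<omega>))" for n r \<omega>
  proof -
    have "simple_value (R n) r \<omega> = indicator {s<..T} r *\<^sub>R simple_value (P n) r \<omega> - simple_value (P n) r \<omega> + simple_value (Q n) r \<omega>"
      by (simp add: R_def simple_value_append vcut vneg)
    also have "indicator {s<..T} r *\<^sub>R simple_value (P n) r \<omega> - simple_value (P n) r \<omega> = - indicator {0<..s} r *\<^sub>R simple_value (P n) r \<omega>"
      using supp[OF P(1), of r n \<omega>] sT by (auto simp: indicator_def split: if_splits)
    also have "simple_value (Q n) r \<omega> = indicator {0<..s} r *\<^sub>R simple_value (Q n) r \<omega>"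
      using supp[OF Q(1)] by simp
    finally show ?thesis by (simp add: algebra_simps)
  qed
  have IJ [measurable]: "I \<in> borel_measurable M" "J \<in> borel_measurable M"
    using HT Hs by (auto simp: has_ito_integral_def)
  have m1: "(\<lambda>p. indicator {0<..s} (fst p) *\<^sub>R (simple_value (S n) (fst p) (snd p) - H (fst p) (snd p))) \<in> borel_measurable (lborel \<Otimes>\<^sub>M M)"
    if "\<And>n. simple_process F T (S n)" for S :: "nat \<Rightarrow> ('a, 'n, 'm) simple_process" and n
    unfolding scaleR_diff_right using measurable_simple_value[OF that, measurable] Hm[of 0 s, measurable] sT by measurable
  have "(\<lambda>n. sqnorm (lborel \<Otimes>\<^sub>M M) (\<lambda>p. simple_value (R n) (fst p) (snd p))) \<longlonglongrightarrow> 0"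
    unfolding Rval
  proof (rule sqnorm_tendsto_add)
    note PP = conv[OF P(1,2), of 0 s] and QQ = conv[OF Q(1,2), of 0 s]
    show "(\<lambda>n. sqnorm (lborel \<Otimes>\<^sub>M M) (\<lambda>p. indicator {0<..s} (fst p) *\<^sub>R (simple_value (Q n) (fst p) (snd p) - H (fst p) (snd p)))) \<longlonglongrightarrow> 0"
      using QQ sT by simp
    show "(\<lambda>n. sqnorm (lborel \<Otimes>\<^sub>M M) (\<lambda>p. (- 1) *\<^sub>R (indicator {0<..s} (fst p) *\<^sub>R (simple_value (P n) (fst p) (snd p) - H (fst p) (snd p))))) \<longlonglongrightarrow> 0"
      using PP sT by (simp add: sqnorm_def)
  qed (intro m1 P(1) QT borel_measurable_scaleR borel_measurable_const)+
  then have Rint: "(\<lambda>n. sqnorm M (simple_integral W (R n))) \<longlonglongrightarrow> 0"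
    by (simp add: simple_isometry(1)[OF R])
  note mi = measurable_simple_integral_M[OF P(1)] measurable_simple_integral_M[OF Q(1)] measurable_simple_integral_M[OF R]
  show ?thesis
    unfolding ito_limit_def
  proof (intro conjI exI[of _ "\<lambda>n. cut (P n)"] allI)
    show "(\<lambda>p. indicator {s<..T} (fst p) *\<^sub>R H (fst p) (snd p)) \<in> borel_measurable (lborel \<Otimes>\<^sub>M M)"
      using Hm sT by simp
    show "simple_process F T (cut (P n))" "\<forall>(a, b, \<xi>)\<in>set (cut (P n)). s \<le> a" for n
      using cut[OF P(1)[of n]] by auto
    show "(\<lambda>n. sqnorm (lborel \<Otimes>\<^sub>M M) (\<lambda>p. simple_value (cut (P n)) (fst p) (snd p) - indicator {s<..T} (fst p) *\<^sub>R H (fst p) (snd p))) \<longlonglongrightarrow> 0"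
      using conv[OF P(1,2), of s T] sT by (simp add: vcut scaleR_diff_right)
    have eq: "simple_integral W (cut (P n)) \<omega> - (I \<omega> - J \<omega>)
        = simple_integral W (R n) \<omega> + ((simple_integral W (P n) \<omega> - I \<omega>) + (- 1) *\<^sub>R (simple_integral W (Q n) \<omega> - J \<omega>))" for n \<omega>
      by (simp add: R_def simple_integral_append ineg)
    show "(\<lambda>n. sqnorm M (\<lambda>\<omega>. simple_integral W (cut (P n)) \<omega> - (I \<omega> - J \<omega>))) \<longlonglongrightarrow> 0"
      unfolding eq
    proof (intro sqnorm_tendsto_add Rint P(3))
      show "(\<lambda>n. sqnorm M (\<lambda>\<omega>. (- 1) *\<^sub>R (simple_integral W (Q n) \<omega> - J \<omega>))) \<longlonglongrightarrow> 0"
        using Q(3) by (simp add: sqnorm_def norm_minus_commute)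
    qed (use mi in measurable)
  qed measurable
qed

section \<open>Sums of orthogonal increments\<close>

text \<open>
  Pythagoras for martingale differences: \<open>X i\<close> is known at time \<open>\<tau> (i + 1)\<close> and orthogonal to everything that
  is known at time \<open>\<tau> i\<close>.
\<close>

lemma expectation_sum_sq_le:
  fixes X :: "nat \<Rightarrow> 'a \<Rightarrow> real"
  assumes adapted: "\<And>i. i < n \<Longrightarrow> X i \<in> borel_measurable (F (\<tau> (Suc i)))"
    and \<tau>: "mono \<tau>"
    and sq: "\<And>i. i < n \<Longrightarrow> integrable M (\<lambda>\<omega>. (X i \<omega>)\<^sup>2)" "\<And>i. i < n \<Longrightarrow> expectation (\<lambda>\<omega>. (X i \<omega>)\<^sup>2) \<le> q"
    and orth: "\<And>i Z. i < n \<Longrightarrow> Z \<in> borel_measurable (F (\<tau> i)) \<Longrightarrow> integrable M (\<lambda>\<omega>. (Z \<omega>)\<^sup>2) \<Longrightarrow>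
      integrable M (\<lambda>\<omega>. Z \<omega> * X i \<omega>) \<Longrightarrow> expectation (\<lambda>\<omega>. Z \<omega> * X i \<omega>) = 0"
  shows "(\<lambda>\<omega>. \<Sum>i<n. X i \<omega>) \<in> borel_measurable (F (\<tau> n)) \<and> integrable M (\<lambda>\<omega>. (\<Sum>i<n. X i \<omega>)\<^sup>2) \<and>
    expectation (\<lambda>\<omega>. (\<Sum>i<n. X i \<omega>)\<^sup>2) \<le> n * q"
  using assms(1,3-)
proof (induction n)
  case (Suc n)
  define S where "S \<omega> = (\<Sum>i<n. X i \<omega>)" for \<omega>
  have S: "S \<in> borel_measurable (F (\<tau> n))" "integrable M (\<lambda>\<omega>. (S \<omega>)\<^sup>2)" "expectation (\<lambda>\<omega>. (S \<omega>)\<^sup>2) \<le> n * q"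
    using Suc.IH Suc.prems unfolding S_def[abs_def] by auto
  have Sm [measurable]: "S \<in> borel_measurable (F (\<tau> (Suc n)))"
    by (rule measurable_F_mono[OF S(1)]) (use \<tau> in \<open>simp add: monoD\<close>)
  have Xm [measurable]: "X n \<in> borel_measurable (F (\<tau> (Suc n)))" by (rule Suc.prems(1)) simp
  note [measurable] = measurable_F_M[OF Sm] measurable_F_M[OF Xm]
  have Xsq: "integrable M (\<lambda>\<omega>. (X n \<omega>)\<^sup>2)" "expectation (\<lambda>\<omega>. (X n \<omega>)\<^sup>2) \<le> q"
    using Suc.prems by auto
  have SX: "integrable M (\<lambda>\<omega>. S \<omega> * X n \<omega>)"
  proof (rule Bochner_Integration.integrable_bound)
    show "integrable M (\<lambda>\<omega>. (S \<omega>)\<^sup>2 + (X n \<omega>)\<^sup>2)" using S Xsq by simp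
    show "AE \<omega> in M. norm (S \<omega> * X n \<omega>) \<le> norm ((S \<omega>)\<^sup>2 + (X n \<omega>)\<^sup>2)"
    proof (rule AE_I2)
      fix \<omega>
      have "2 * \<bar>S \<omega>\<bar> * \<bar>X n \<omega>\<bar> \<le> \<bar>S \<omega>\<bar>\<^sup>2 + \<bar>X n \<omega>\<bar>\<^sup>2" by (rule sum_squares_bound)
      moreover have "0 \<le> \<bar>S \<omega>\<bar> * \<bar>X n \<omega>\<bar>" by simp
      ultimately have "\<bar>S \<omega> * X n \<omega>\<bar> \<le> (S \<omega>)\<^sup>2 + (X n \<omega>)\<^sup>2"
        unfolding abs_mult power2_abs by linarith
      then show "norm (S \<omega> * X n \<omega>) \<le> norm ((S \<omega>)\<^sup>2 + (X n \<omega>)\<^sup>2)" by simp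
    qed
  qed measurable
  have "expectation (\<lambda>\<omega>. S \<omega> * X n \<omega>) = 0"
    by (rule Suc.prems(4)[OF _ S(1,2) SX]) simp
  then have "has_bochner_integral M (\<lambda>\<omega>. (S \<omega>)\<^sup>2 + 2 * (S \<omega> * X n \<omega>) + (X n \<omega>)\<^sup>2)
      (expectation (\<lambda>\<omega>. (S \<omega>)\<^sup>2) + 2 * 0 + expectation (\<lambda>\<omega>. (X n \<omega>)\<^sup>2))"
    using S Xsq SX by (intro has_bochner_integral_add has_bochner_integral_mult_right) (auto simp: has_bochner_integral_iff)
  moreover have "(S \<omega>)\<^sup>2 + 2 * (S \<omega> * X n \<omega>) + (X n \<omega>)\<^sup>2 = (\<Sum>i<Suc n. X i \<omega>)\<^sup>2" for \<omega>
    by (simp add: S_def power2_sum)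
  ultimately have *: "has_bochner_integral M (\<lambda>\<omega>. (\<Sum>i<Suc n. X i \<omega>)\<^sup>2) (expectation (\<lambda>\<omega>. (S \<omega>)\<^sup>2) + expectation (\<lambda>\<omega>. (X n \<omega>)\<^sup>2))"
    by simp
  have "(\<lambda>\<omega>. S \<omega> + X n \<omega>) \<in> borel_measurable (F (\<tau> (Suc n)))" by measurable
  then have "(\<lambda>\<omega>. \<Sum>i<Suc n. X i \<omega>) \<in> borel_measurable (F (\<tau> (Suc n)))"
    by (simp add: S_def)
  moreover have "real (Suc n) * q = real n * q + q" by (simp add: algebra_simps)
  ultimately show ?case
    using * S(3) Xsq(2) unfolding has_bochner_integral_iff by linarith
qed simp

lemma increment_norm4_le:
  assumes "0 \<le> u" "u \<le> v"
  shows "integrable M (\<lambda>\<omega>. (norm (W v \<omega> - W u \<omega>)) ^ 4)"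
    "expectation (\<lambda>\<omega>. (norm (W v \<omega> - W u \<omega>)) ^ 4) \<le> 3 * (real CARD('n))\<^sup>2 * (v - u)\<^sup>2"
proof -
  have [measurable]: "W v \<in> borel_measurable M" "W u \<in> borel_measurable M"
    using assms by (auto intro: measurable_W)
  have le: "(norm x) ^ 4 \<le> real CARD('n) * (\<Sum>k\<in>UNIV. (x $ k) ^ 4)" for x :: "real^'n"
  proof -
    have "(norm x) ^ 4 = (\<Sum>k\<in>UNIV. 1 * (x $ k)\<^sup>2)\<^sup>2"
      by (simp add: norm_vec_def L2_set_def sum_nonneg power4_eq_xxxx power2_eq_square mult.assoc[symmetric])
    also have "\<dots> \<le> (\<Sum>k\<in>(UNIV::'n set). 1\<^sup>2) * (\<Sum>k\<in>UNIV. ((x $ k)\<^sup>2)\<^sup>2)"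
      by (rule Cauchy_Schwarz_ineq_sum)
    finally show ?thesis by simp
  qed
  have s: "has_bochner_integral M (\<lambda>\<omega>. real CARD('n) * (\<Sum>k\<in>UNIV. ((W v \<omega> - W u \<omega>) $ k) ^ 4))
      (real CARD('n) * (\<Sum>k\<in>(UNIV::'n set). 3 * (v - u)\<^sup>2))"
    by (intro has_bochner_integral_mult_right has_bochner_integral_sum increment_moments assms)
  show "integrable M (\<lambda>\<omega>. (norm (W v \<omega> - W u \<omega>)) ^ 4)"
  proof (rule Bochner_Integration.integrable_bound)
    show "integrable M (\<lambda>\<omega>. real CARD('n) * (\<Sum>k\<in>UNIV. ((W v \<omega> - W u \<omega>) $ k) ^ 4))"
      using s by (rule integrable.intros)
    show "AE \<omega> in M. norm ((norm (W v \<omega> - W u \<omega>)) ^ 4) \<le> norm (real CARD('n) * (\<Sum>k\<in>UNIV. ((W v \<omega> - W u \<omega>) $ k) ^ 4))"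
      using order_trans[OF le abs_ge_self] by (intro AE_I2) (simp del: vector_minus_component)
  qed measurable
  then have "expectation (\<lambda>\<omega>. (norm (W v \<omega> - W u \<omega>)) ^ 4) \<le> expectation (\<lambda>\<omega>. real CARD('n) * (\<Sum>k\<in>UNIV. ((W v \<omega> - W u \<omega>) $ k) ^ 4))"
    using s by (intro integral_mono le) (auto simp: has_bochner_integral_iff)
  also have "\<dots> = real CARD('n) * (\<Sum>k\<in>(UNIV::'n set). 3 * (v - u)\<^sup>2)"
    using s by (rule has_bochner_integral_integral_eq)
  finally show "expectation (\<lambda>\<omega>. (norm (W v \<omega> - W u \<omega>)) ^ 4) \<le> 3 * (real CARD('n))\<^sup>2 * (v - u)\<^sup>2"
    by (simp add: power2_eq_square mult_ac)
qed

end

section \<open>Ito processes tangential to spheres\<close>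

lemma bounded_section_integrable:
  fixes f :: "real \<Rightarrow> 'a \<Rightarrow> 'b::{banach, second_countable_topology}"
  assumes m: "(\<lambda>(r, \<omega>). f r \<omega>) \<in> borel_measurable (restrict_space lborel {0..T} \<Otimes>\<^sub>M M)"
    and \<omega>: "\<omega> \<in> space M" and K: "\<And>r. r \<in> {0..T} \<Longrightarrow> norm (f r \<omega>) \<le> K"
  shows "set_integrable lborel {0..T} (\<lambda>r. f r \<omega>)"
  unfolding set_integrable_def
proof (rule Bochner_Integration.integrable_bound)
  have "(\<lambda>r. (\<lambda>(r, \<omega>). f r \<omega>) (r, \<omega>)) \<in> borel_measurable (restrict_space lborel {0..T})"
    by (rule measurable_compose[OF measurable_Pair2'[OF \<omega>] m])
  then show "(\<lambda>r. indicator {0..T} r *\<^sub>R f r \<omega>) \<in> borel_measurable lborel"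
    by (simp add: borel_measurable_restrict_space_iff)
  show "integrable lborel (\<lambda>r. K * indicator {0..T} r)" by (cases "0 \<le> T") auto
  show "AE r in lborel. norm (indicator {0..T} r *\<^sub>R f r \<omega>) \<le> norm (K * indicator {0..T} r)"
    using order_trans[OF K abs_ge_self] by (auto simp: indicator_def)
qed

lemma (in prob_space) sqnorm_le_bound:
  assumes "\<And>\<omega>. \<omega> \<in> space M \<Longrightarrow> norm (f \<omega>) \<le> K"
  shows "sqnorm M f \<le> ennreal (K\<^sup>2)"
proof -
  have "sqnorm M f \<le> sqnorm M (\<lambda>_. K)"
    using assms by (intro sqnorm_mono) (auto intro: order_trans[OF _ abs_ge_self])
  then show ?thesis by (simp add: sqnorm_def emeasure_space_1)
qed

text \<open>
  An Ito process \<open>Y\<close> with bounded drift \<open>A\<close> and bounded, path-continuous diffusion matrix \<open>H\<close> such that \<open>A\<close> and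
  all columns of \<open>H\<close> are orthogonal to \<open>Y\<close> and \<open>H\<close> has constant Frobenius norm. The martingale part enters
  through a process \<open>N\<close> whose increments are the stochastic integrals of \<open>H\<close>. The bounds hold everywhere on
  the sample space and not only almost surely, because \<open>H\<close> frozen at a fixed time has to be an admissible
  coefficient of a simple process.
\<close>

locale tangential_ito_process = standard_brownian_motion M W
  for M :: "'a measure" and W :: "real \<Rightarrow> 'a \<Rightarrow> real^'n" +
  fixes T :: real and Y A :: "real \<Rightarrow> 'a \<Rightarrow> real^'m" and H :: "real \<Rightarrow> 'a \<Rightarrow> real^'n^'m"
    and N :: "real \<Rightarrow> 'a \<Rightarrow> real^'m" and c C :: real
  assumes C_pos: "C > 0"
    and Y_adapted: "\<And>t. 0 \<le> t \<Longrightarrow> t \<le> T \<Longrightarrow> Y t \<in> borel_measurable (augmented_filtration M W t)"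
    and A_measurable: "(\<lambda>(r, \<omega>). A r \<omega>) \<in> borel_measurable (restrict_space lborel {0..T} \<Otimes>\<^sub>M M)"
    and A_bound: "\<And>r \<omega>. 0 \<le> r \<Longrightarrow> r \<le> T \<Longrightarrow> \<omega> \<in> space M \<Longrightarrow> norm (A r \<omega>) \<le> C"
    and H_adapted: "\<And>r. 0 \<le> r \<Longrightarrow> r \<le> T \<Longrightarrow> H r \<in> borel_measurable (augmented_filtration M W r)"
    and H_bound: "\<And>r \<omega>. 0 \<le> r \<Longrightarrow> r \<le> T \<Longrightarrow> \<omega> \<in> space M \<Longrightarrow> norm (H r \<omega>) \<le> C"
    and H_continuous: "AE \<omega> in M. continuous_on {0..T} (\<lambda>r. H r \<omega>)"
    and N: "\<And>s t. 0 \<le> s \<Longrightarrow> s \<le> t \<Longrightarrow> t \<le> T \<Longrightarrow>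
      ito_limit s t (\<lambda>p. indicator {s<..t} (fst p) *\<^sub>R H (fst p) (snd p)) (\<lambda>\<omega>. N t \<omega> - N s \<omega>)"
    and Y_eq: "\<And>t. 0 \<le> t \<Longrightarrow> t \<le> T \<Longrightarrow>
      AE \<omega> in M. Y t \<omega> = Y 0 \<omega> + (LBINT r:{0..t}. A r \<omega>) + (N t \<omega> - N 0 \<omega>)"
    and Y_orth_A: "\<And>r. 0 \<le> r \<Longrightarrow> r \<le> T \<Longrightarrow> AE \<omega> in M. Y r \<omega> \<bullet> A r \<omega> = 0"
    and Y_orth_H: "\<And>r. 0 \<le> r \<Longrightarrow> r \<le> T \<Longrightarrow> AE \<omega> in M. Y r \<omega> v* H r \<omega> = 0"
    and norm_H: "\<And>r. 0 \<le> r \<Longrightarrow> r \<le> T \<Longrightarrow> AE \<omega> in M. (norm (H r \<omega>))\<^sup>2 = c"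
begin

interpretation LM: pair_sigma_finite lborel M ..

lemma H_bounded: "0 \<le> r \<Longrightarrow> r \<le> T \<Longrightarrow> bounded (H r ` space M)"
  using H_bound unfolding bounded_iff by blast

lemma H_measurable: "0 \<le> r \<Longrightarrow> r \<le> T \<Longrightarrow> H r \<in> borel_measurable M"
  using H_adapted measurable_F_M by blast

lemma Y_measurable: "0 \<le> r \<Longrightarrow> r \<le> T \<Longrightarrow> Y r \<in> borel_measurable M"
  using Y_adapted measurable_F_M by blast

text \<open>
  By dominated convergence \<open>E |H\<^sub>r - H\<^sub>u|\<^sup>2\<close> is continuous in \<open>(r, u)\<close>; it vanishes on the diagonal, and the time
  interval is compact.
\<close>

lemma H_mean_square_continuous:
  assumes "\<kappa> > 0"
  obtains \<delta> where "\<delta> > 0" "\<And>r u. r \<in> {0..T} \<Longrightarrow> u \<in> {0..T} \<Longrightarrow> \<bar>r - u\<bar> < \<delta> \<Longrightarrow>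
    sqnorm M (\<lambda>\<omega>. H r \<omega> - H u \<omega>) \<le> ennreal \<kappa>"
proof -
  define g where "g p = expectation (\<lambda>\<omega>. (norm (H (fst p) \<omega> - H (snd p) \<omega>))\<^sup>2)" for p
  have m [measurable]: "H r \<in> borel_measurable M" if "r \<in> {0..T}" for r
    using H_measurable that by auto
  have le: "(norm (H r \<omega> - H u \<omega>))\<^sup>2 \<le> (2 * C)\<^sup>2" if "r \<in> {0..T}" "u \<in> {0..T}" "\<omega> \<in> space M" for r u \<omega>
    using H_bound[of r \<omega>] H_bound[of u \<omega>] that norm_triangle_ineq4[of "H r \<omega>" "H u \<omega>"]
    by (intro power_mono) auto
  have "continuous_on ({0..T} \<times> {0..T}) g"
    unfolding continuous_on_sequentially
  proof (intro allI ballI impI, elim conjE)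
    fix x and p assume p: "p \<in> {0..T} \<times> {0..T}" and x: "\<forall>n. x n \<in> {0..T} \<times> {0..T}" "x \<longlonglongrightarrow> p"
    have x': "fst (x n) \<in> {0..T}" "snd (x n) \<in> {0..T}" for n using x(1) by (auto simp: mem_Times_iff)
    have p': "fst p \<in> {0..T}" "snd p \<in> {0..T}" using p by auto
    have [measurable]: "H (fst (x n)) \<in> borel_measurable M" "H (snd (x n)) \<in> borel_measurable M"
      "H (fst p) \<in> borel_measurable M" "H (snd p) \<in> borel_measurable M" for n
      using x' p' m by auto
    show "(g \<circ> x) \<longlonglongrightarrow> g p"
      unfolding g_def o_def
    proof (rule integral_dominated_convergence)
      show "integrable M (\<lambda>_. (2 * C)\<^sup>2)" by simp
      show "AE \<omega> in M. norm ((norm (H (fst (x n)) \<omega> - H (snd (x n)) \<omega>))\<^sup>2) \<le> (2 * C)\<^sup>2" for n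
        using le[OF x'] by (intro AE_I2) simp
      show "AE \<omega> in M. (\<lambda>n. (norm (H (fst (x n)) \<omega> - H (snd (x n)) \<omega>))\<^sup>2) \<longlonglongrightarrow> (norm (H (fst p) \<omega> - H (snd p) \<omega>))\<^sup>2"
        using H_continuous
      proof eventually_elim
        case (elim \<omega>)
        have "(\<lambda>n. H (fst (x n)) \<omega>) \<longlonglongrightarrow> H (fst p) \<omega>" "(\<lambda>n. H (snd (x n)) \<omega>) \<longlonglongrightarrow> H (snd p) \<omega>"
          using x(2) x' p' by (auto intro!: continuous_on_tendsto_compose[OF elim] tendsto_fst tendsto_snd)
        then show ?case by (intro tendsto_intros)
      qed
    qed measurable
  qed
  then have "uniformly_continuous_on ({0..T} \<times> {0..T}) g"
    by (intro compact_uniformly_continuous compact_Times) auto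
  then obtain \<delta> where \<delta>: "\<delta> > 0" "\<And>p q. p \<in> {0..T} \<times> {0..T} \<Longrightarrow> q \<in> {0..T} \<times> {0..T} \<Longrightarrow> dist q p < \<delta> \<Longrightarrow> dist (g q) (g p) < \<kappa>"
    unfolding uniformly_continuous_on_def using assms by meson
  show thesis
  proof (rule that[OF \<delta>(1)])
    fix r u assume ru: "r \<in> {0..T}" "u \<in> {0..T}" "\<bar>r - u\<bar> < \<delta>"
    have "dist (g (r, u)) (g (u, u)) < \<kappa>"
      using ru by (intro \<delta>(2)) (auto simp: dist_prod_def dist_real_def)
    then have "g (r, u) \<le> \<kappa>" by (auto simp: g_def dist_real_def)
    moreover have "integrable M (\<lambda>\<omega>. (norm (H r \<omega> - H u \<omega>))\<^sup>2)"
      using ru le[of r u] m by (intro integrable_const_bound[of _ "(2 * C)\<^sup>2"]) auto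
    ultimately show "sqnorm M (\<lambda>\<omega>. H r \<omega> - H u \<omega>) \<le> ennreal \<kappa>"
      by (simp add: sqnorm_def nn_integral_eq_integral g_def ennreal_leI)
  qed
qed

lemma A_section_integrable:
  assumes "\<omega> \<in> space M" "{u<..v} \<subseteq> {0..T}"
  shows "set_integrable lborel {0..T} (\<lambda>r. A r \<omega>)" "set_integrable lborel {u<..v} (\<lambda>r. A r \<omega>)"
proof -
  show int: "set_integrable lborel {0..T} (\<lambda>r. A r \<omega>)"
    by (rule bounded_section_integrable[OF A_measurable assms(1)]) (use A_bound assms(1) in auto)
  show "set_integrable lborel {u<..v} (\<lambda>r. A r \<omega>)"
    by (rule set_integrable_subset[OF int _ assms(2)]) simp
qed

text \<open>
  The contribution of \<open>A\<close> to the increment of \<open>Y\<close> over \<open>(u, v]\<close>, defined as the remainder so that the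
  decomposition of the increment holds everywhere; it agrees almost surely with the integral of \<open>A\<close>.
\<close>

definition drift :: "real \<Rightarrow> real \<Rightarrow> 'a \<Rightarrow> real^'m" where
  "drift u v \<omega> = Y v \<omega> - Y u \<omega> - (N v \<omega> - N u \<omega>)"

text \<open>
  The stochastic integral over \<open>(u, v]\<close> with the integrand frozen at its value at time \<open>u\<close>.
\<close>

definition frozen_increment :: "real \<Rightarrow> real \<Rightarrow> 'a \<Rightarrow> real^'m" where
  "frozen_increment u v \<omega> = H u \<omega> *v (W v \<omega> - W u \<omega>)"

context
  fixes u v :: real
  assumes uv: "0 \<le> u" "u \<le> v" "v \<le> T" and uv1: "v - u \<le> 1"
begin

lemma interval_measurable:
  "Y u \<in> borel_measurable M" "Y v \<in> borel_measurable M" "H u \<in> borel_measurable M"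
  "W u \<in> borel_measurable M" "W v \<in> borel_measurable M"
  "(\<lambda>\<omega>. N v \<omega> - N u \<omega>) \<in> borel_measurable M" "drift u v \<in> borel_measurable M" "frozen_increment u v \<in> borel_measurable M"
proof -
  show [measurable]: "Y u \<in> borel_measurable M" "Y v \<in> borel_measurable M" "H u \<in> borel_measurable M"
    "W u \<in> borel_measurable M" "W v \<in> borel_measurable M"
    using uv Y_measurable H_measurable measurable_W by auto
  show [measurable]: "(\<lambda>\<omega>. N v \<omega> - N u \<omega>) \<in> borel_measurable M"
    by (rule ito_limit_measurable(1)[OF N[OF uv]])
  show "drift u v \<in> borel_measurable M" "frozen_increment u v \<in> borel_measurable M"
    unfolding drift_def[abs_def] frozen_increment_def[abs_def] by measurable
qed

lemma drift_eq: "AE \<omega> in M. drift u v \<omega> = (LBINT r:{u<..v}. A r \<omega>)"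
proof -
  have "0 \<le> v" "u \<le> T" using uv by auto
  from Y_eq[OF uv(1) this(2)] Y_eq[OF this(1) uv(3)] AE_space show ?thesis
  proof eventually_elim
    case (elim \<omega>)
    have "(LBINT r:{0..u} \<union> {u<..v}. A r \<omega>) = (LBINT r:{0..u}. A r \<omega>) + (LBINT r:{u<..v}. A r \<omega>)"
    proof (rule set_integral_Un)
      show "set_integrable lborel {0..u} (\<lambda>r. A r \<omega>)"
        by (rule set_integrable_subset[OF A_section_integrable(1)[of _ 0 0]]) (use uv elim in auto)
      show "set_integrable lborel {u<..v} (\<lambda>r. A r \<omega>)"
        by (rule A_section_integrable(2)) (use uv elim in auto)
    qed auto
    moreover have "{0..u} \<union> {u<..v} = {0..v}" using uv by auto
    ultimately show ?case using elim by (simp add: drift_def)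
  qed
qed

lemma norm_drift_le: "AE \<omega> in M. norm (drift u v \<omega>) \<le> C * (v - u)"
  using drift_eq AE_space
proof eventually_elim
  case (elim \<omega>)
  have subset: "{u<..v} \<subseteq> {0..T}" using uv by auto
  have "norm (drift u v \<omega>) \<le> (\<integral>r. norm (indicator {u<..v} r *\<^sub>R A r \<omega>) \<partial>lborel)"
    unfolding elim(1) set_lebesgue_integral_def by (rule integral_norm_bound)
  also have "\<dots> \<le> (\<integral>r. C * indicator {u<..v} r \<partial>lborel)"
  proof (rule integral_mono)
    show "integrable lborel (\<lambda>r. norm (indicator {u<..v} r *\<^sub>R A r \<omega>))"
      using A_section_integrable(2)[OF elim(2) subset] unfolding set_integrable_def
      by (rule integrable_norm)
    show "integrable lborel (\<lambda>r. C * indicator {u<..v} r)" using uv by auto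
    show "norm (indicator {u<..v} r *\<^sub>R A r \<omega>) \<le> C * indicator {u<..v} r" for r
      using A_bound[OF _ _ elim(2), of r] uv by (auto simp: indicator_def)
  qed
  also have "\<dots> = C * (v - u)" using uv by simp
  finally show ?case .
qed

lemma increment_N_le: "sqnorm M (\<lambda>\<omega>. N v \<omega> - N u \<omega>) \<le> ennreal (C\<^sup>2 * (v - u))"
proof -
  note L = N[OF uv]
  have "sqnorm (lborel \<Otimes>\<^sub>M M) (\<lambda>p. indicator {u<..v} (fst p) *\<^sub>R H (fst p) (snd p)) \<le> ennreal (C\<^sup>2 * (v - u))"
  proof (rule sqnorm_time_le)
    fix r assume r: "u < r" "r \<le> v"
    show "sqnorm M (\<lambda>\<omega>. indicator {u<..v} (fst (r, \<omega>)) *\<^sub>R H (fst (r, \<omega>)) (snd (r, \<omega>))) \<le> ennreal (C\<^sup>2)"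
      using r uv H_bound by (intro sqnorm_le_bound) auto
  qed (use ito_limit_measurable(2)[OF L] uv in auto)
  then show ?thesis using ito_limit_sqnorm_le[OF L] by (rule order_trans[rotated])
qed

lemma increment_Y_le: "sqnorm M (\<lambda>\<omega>. Y v \<omega> - Y u \<omega>) \<le> ennreal ((2 * C * sqrt (v - u))\<^sup>2)"
proof -
  note [measurable] = interval_measurable
  have "sqnorm M (\<lambda>\<omega>. Y v \<omega> - Y u \<omega>) = sqnorm M (\<lambda>\<omega>. drift u v \<omega> + (N v \<omega> - N u \<omega>))"
    by (simp add: drift_def)
  also have "\<dots> \<le> 2 * sqnorm M (drift u v) + 2 * sqnorm M (\<lambda>\<omega>. N v \<omega> - N u \<omega>)"
    by (rule sqnorm_add_le2) measurable
  also have "sqnorm M (drift u v) \<le> sqnorm M (\<lambda>_. C * (v - u))"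
    using norm_drift_le C_pos uv by (intro sqnorm_mono_AE) auto
  also have "\<dots> = ennreal ((C * (v - u))\<^sup>2)"
    by (simp add: sqnorm_def emeasure_space_1)
  also note increment_N_le
  also have "2 * ennreal ((C * (v - u))\<^sup>2) + 2 * ennreal (C\<^sup>2 * (v - u)) = ennreal (2 * (C * (v - u))\<^sup>2 + 2 * (C\<^sup>2 * (v - u)))"
    using uv by (simp add: ennreal_mult ennreal_plus)
  also have "\<dots> \<le> ennreal ((2 * C * sqrt (v - u))\<^sup>2)"
  proof (rule ennreal_leI)
    have "(v - u) * (v - u) \<le> 1 * (v - u)"
      using uv uv1 by (intro mult_right_mono) auto
    then have "C\<^sup>2 * ((v - u) * (v - u)) \<le> C\<^sup>2 * (v - u)"
      by (intro mult_left_mono) auto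
    then show "2 * (C * (v - u))\<^sup>2 + 2 * (C\<^sup>2 * (v - u)) \<le> (2 * C * sqrt (v - u))\<^sup>2"
      using uv by (simp add: power_mult_distrib power2_eq_square[of "v - u"] mult.commute[of "C\<^sup>2"])
  qed
  finally show ?thesis by (simp add: add_mono mult_left_mono)
qed

text \<open>
  Freezing the integrand costs as much as the integrand moves in mean square.
\<close>

lemma error_le:
  assumes \<kappa>: "0 \<le> \<kappa>" "\<And>r. u < r \<Longrightarrow> r \<le> v \<Longrightarrow> sqnorm M (\<lambda>\<omega>. H r \<omega> - H u \<omega>) \<le> ennreal \<kappa>"
  shows "sqnorm M (\<lambda>\<omega>. N v \<omega> - N u \<omega> - frozen_increment u v \<omega>) \<le> ennreal (\<kappa> * (v - u))"
proof -
  let ?h = "\<lambda>p. indicator {u<..v} (fst p) *\<^sub>R H (fst p) (snd p) + (- 1) *\<^sub>R (indicator {u<..v} (fst p) *\<^sub>R H u (snd p))"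
  have L: "ito_limit u v ?h (\<lambda>\<omega>. (N v \<omega> - N u \<omega>) + (- 1) *\<^sub>R frozen_increment u v \<omega>)"
    unfolding frozen_increment_def[abs_def] using uv
    by (intro ito_limit_add ito_limit_scaleR N ito_limit_elementary H_adapted H_bounded) auto
  have "sqnorm (lborel \<Otimes>\<^sub>M M) ?h \<le> ennreal (\<kappa> * (v - u))"
  proof (rule sqnorm_time_le)
    fix r assume r: "u < r" "r \<le> v"
    show "sqnorm M (\<lambda>\<omega>. ?h (r, \<omega>)) \<le> ennreal \<kappa>"
      using \<kappa>(2)[OF r] r by simp
  qed (use ito_limit_measurable(2)[OF L] \<kappa> uv in auto)
  then show ?thesis using ito_limit_sqnorm_le[OF L] by simp
qed

text \<open>
  Tangentiality at time \<open>r\<close> makes \<open>Y\<^sub>u\<close> almost orthogonal to the coefficients at a slightly later time \<open>r\<close>.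
\<close>

lemma orth_increments:
  assumes r: "u < r" "r \<le> v"
  shows "AE \<omega> in M. norm (Y u \<omega> v* H r \<omega>) \<le> C * norm (Y r \<omega> - Y u \<omega>)"
    and "AE \<omega> in M. norm (Y u \<omega> \<bullet> A r \<omega>) \<le> C * norm (Y r \<omega> - Y u \<omega>)"
proof -
  have r': "0 \<le> r" "r \<le> T" using r uv by auto
  show "AE \<omega> in M. norm (Y u \<omega> v* H r \<omega>) \<le> C * norm (Y r \<omega> - Y u \<omega>)"
    using Y_orth_H[OF r'] AE_space
  proof eventually_elim
    case (elim \<omega>)
    have "Y u \<omega> v* H r \<omega> = - ((Y r \<omega> - Y u \<omega>) v* H r \<omega>)"
      using elim by (simp add: bounded_bilinear.diff_left[OF bounded_bilinear_vector_matrix])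
    then have "norm (Y u \<omega> v* H r \<omega>) \<le> norm (Y r \<omega> - Y u \<omega>) * norm (H r \<omega>)"
      using norm_vector_matrix_le[of "Y r \<omega> - Y u \<omega>" "H r \<omega>"] by simp
    also have "\<dots> \<le> norm (Y r \<omega> - Y u \<omega>) * C"
      using H_bound r' elim by (intro mult_left_mono) auto
    finally show ?case by (simp add: mult.commute)
  qed
  show "AE \<omega> in M. norm (Y u \<omega> \<bullet> A r \<omega>) \<le> C * norm (Y r \<omega> - Y u \<omega>)"
    using Y_orth_A[OF r'] AE_space
  proof eventually_elim
    case (elim \<omega>)
    have "norm (Y u \<omega> \<bullet> A r \<omega>) = \<bar>(Y r \<omega> - Y u \<omega>) \<bullet> A r \<omega>\<bar>"
      using elim by (simp add: inner_diff_left)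
    also have "\<dots> \<le> norm (Y r \<omega> - Y u \<omega>) * norm (A r \<omega>)"
      by (rule Cauchy_Schwarz_ineq2)
    also have "\<dots> \<le> norm (Y r \<omega> - Y u \<omega>) * C"
      using A_bound r' elim by (intro mult_left_mono) auto
    finally show ?case by (simp add: mult.commute)
  qed
qed

end

lemma increment_Y_sqrt_le:
  assumes "0 \<le> u" "u < r" "r \<le> v" "v \<le> T" "v - u \<le> 1"
  shows "sqnorm M (\<lambda>\<omega>. Y r \<omega> - Y u \<omega>) \<le> ennreal ((2 * C * sqrt (v - u))\<^sup>2)"
proof -
  have "sqnorm M (\<lambda>\<omega>. Y r \<omega> - Y u \<omega>) \<le> ennreal ((2 * C * sqrt (r - u))\<^sup>2)"
    using assms by (intro increment_Y_le) auto
  also have "\<dots> \<le> ennreal ((2 * C * sqrt (v - u))\<^sup>2)"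
    using assms C_pos by (intro ennreal_leI power_mono mult_left_mono) auto
  finally show ?thesis .
qed

context
  fixes u v :: real
  assumes uv: "0 \<le> u" "u \<le> v" "v \<le> T" and uv1: "v - u \<le> 1"
begin

lemma inner_drift_le:
  "integrable M (\<lambda>\<omega>. Y u \<omega> \<bullet> drift u v \<omega>)"
  "expectation (\<lambda>\<omega>. \<bar>Y u \<omega> \<bullet> drift u v \<omega>\<bar>) \<le> 2 * C\<^sup>2 * (v - u) * sqrt (v - u)"
proof -
  note [measurable] = interval_measurable[OF uv uv1]
  let ?d = "2 * C\<^sup>2 * sqrt (v - u)"
  have [measurable]: "(\<lambda>p. indicator {u<..v} (fst p) *\<^sub>R A (fst p) (snd p)) \<in> borel_measurable (lborel \<Otimes>\<^sub>M M)"
    using uv by (intro borel_measurable_indicator_extension[OF A_measurable]) auto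
  have "(\<integral>\<^sup>+\<omega>. ennreal \<bar>Y u \<omega> \<bullet> drift u v \<omega>\<bar> \<partial>M)
      \<le> (\<integral>\<^sup>+\<omega>. \<integral>\<^sup>+r. ennreal \<bar>Y u \<omega> \<bullet> (indicator {u<..v} r *\<^sub>R A r \<omega>)\<bar> \<partial>lborel \<partial>M)"
  proof (rule nn_integral_mono_AE)
    show "AE \<omega> in M. ennreal \<bar>Y u \<omega> \<bullet> drift u v \<omega>\<bar> \<le> (\<integral>\<^sup>+r. ennreal \<bar>Y u \<omega> \<bullet> (indicator {u<..v} r *\<^sub>R A r \<omega>)\<bar> \<partial>lborel)"
      using drift_eq[OF uv uv1] AE_space
    proof eventually_elim
      case (elim \<omega>)
      have subset: "{u<..v} \<subseteq> {0..T}" using uv by auto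
      have i: "integrable lborel (\<lambda>r. indicator {u<..v} r *\<^sub>R A r \<omega>)"
        using A_section_integrable(2)[OF elim(2) subset] unfolding set_integrable_def .
      have "Y u \<omega> \<bullet> drift u v \<omega> = (\<integral>r. Y u \<omega> \<bullet> (indicator {u<..v} r *\<^sub>R A r \<omega>) \<partial>lborel)"
        unfolding elim(1) set_lebesgue_integral_def using i by (intro integral_inner_right[symmetric]) simp
      then show ?case
        using integral_norm_bound_ennreal[of lborel "\<lambda>r. Y u \<omega> \<bullet> (indicator {u<..v} r *\<^sub>R A r \<omega>)"] i
        by (simp add: integrable_inner_right del: inner_scaleR_right)
    qed
  qed
  also have "\<dots> = (\<integral>\<^sup>+r. \<integral>\<^sup>+\<omega>. ennreal \<bar>Y u \<omega> \<bullet> (indicator {u<..v} r *\<^sub>R A r \<omega>)\<bar> \<partial>M \<partial>lborel)"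
  proof -
    have m: "(\<lambda>p. ennreal \<bar>Y u (snd p) \<bullet> (indicator {u<..v} (fst p) *\<^sub>R A (fst p) (snd p))\<bar>) \<in> borel_measurable (lborel \<Otimes>\<^sub>M M)"
      by measurable
    from LM.Fubini[OF m] show ?thesis by simp
  qed
  also have "\<dots> \<le> (\<integral>\<^sup>+r. ennreal ?d * indicator {u<..v} r \<partial>lborel)"
  proof (rule nn_integral_mono)
    fix r
    show "(\<integral>\<^sup>+\<omega>. ennreal \<bar>Y u \<omega> \<bullet> (indicator {u<..v} r *\<^sub>R A r \<omega>)\<bar> \<partial>M) \<le> ennreal ?d * indicator {u<..v} r"
    proof (cases "u < r \<and> r \<le> v")
      case True
      then have r: "u < r" "r \<le> v" by auto
      have [measurable]: "Y r \<in> borel_measurable M" using r uv by (intro Y_measurable) auto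
      note L = L1_le_L2[OF _ increment_Y_sqrt_le[OF uv(1) r uv(3) uv1]]
      have int: "integrable M (\<lambda>\<omega>. Y r \<omega> - Y u \<omega>)"
        and le: "expectation (\<lambda>\<omega>. norm (Y r \<omega> - Y u \<omega>)) \<le> 2 * C * sqrt (v - u)"
        using L(1,4) C_pos uv by auto
      have "(\<integral>\<^sup>+\<omega>. ennreal \<bar>Y u \<omega> \<bullet> (indicator {u<..v} r *\<^sub>R A r \<omega>)\<bar> \<partial>M) \<le> (\<integral>\<^sup>+\<omega>. ennreal (C * norm (Y r \<omega> - Y u \<omega>)) \<partial>M)"
        using orth_increments(2)[OF uv uv1 r] r
        by (intro nn_integral_mono_AE) (auto elim!: eventually_mono intro: ennreal_leI)
      also have "\<dots> = ennreal (C * expectation (\<lambda>\<omega>. norm (Y r \<omega> - Y u \<omega>)))"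
        using int C_pos by (subst nn_integral_eq_integral) auto
      also have "\<dots> \<le> ennreal (C * (2 * C * sqrt (v - u)))"
        using le C_pos by (intro ennreal_leI mult_left_mono) auto
      finally show ?thesis using r by (simp add: power2_eq_square mult_ac)
    qed auto
  qed
  also have "\<dots> = ennreal (?d * (v - u))"
    using uv by (simp add: nn_integral_cmult ennreal_mult)
  finally have le: "(\<integral>\<^sup>+\<omega>. ennreal \<bar>Y u \<omega> \<bullet> drift u v \<omega>\<bar> \<partial>M) \<le> ennreal (?d * (v - u))" .
  show int: "integrable M (\<lambda>\<omega>. Y u \<omega> \<bullet> drift u v \<omega>)"
    using le by (intro integrableI_bounded) (auto elim: order_le_less_trans)
  then have "ennreal (expectation (\<lambda>\<omega>. \<bar>Y u \<omega> \<bullet> drift u v \<omega>\<bar>)) \<le> ennreal (?d * (v - u))"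
    using le by (subst nn_integral_eq_integral[symmetric]) auto
  then show "expectation (\<lambda>\<omega>. \<bar>Y u \<omega> \<bullet> drift u v \<omega>\<bar>) \<le> 2 * C\<^sup>2 * (v - u) * sqrt (v - u)"
    using uv C_pos by (simp add: ennreal_le_iff mult_ac)
qed

lemma inner_increment_N_le:
  "sqnorm M (\<lambda>\<omega>. Y u \<omega> \<bullet> (N v \<omega> - N u \<omega>)) \<le> ennreal ((2 * C\<^sup>2 * (v - u))\<^sup>2)"
proof -
  note [measurable] = interval_measurable[OF uv uv1]
  note L = N[OF uv]
  have "sqnorm (lborel \<Otimes>\<^sub>M M) (\<lambda>p. Y u (snd p) v* (indicator {u<..v} (fst p) *\<^sub>R H (fst p) (snd p)))
      \<le> ennreal ((C\<^sup>2 * (2 * C * sqrt (v - u))\<^sup>2) * (v - u))"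
  proof (rule sqnorm_time_le)
    fix r assume r: "u < r" "r \<le> v"
    have [measurable]: "Y r \<in> borel_measurable M" using r uv by (intro Y_measurable) auto
    have "sqnorm M (\<lambda>\<omega>. Y u \<omega> v* H r \<omega>) \<le> sqnorm M (\<lambda>\<omega>. C *\<^sub>R (Y r \<omega> - Y u \<omega>))"
      using orth_increments(1)[OF uv uv1 r] C_pos by (intro sqnorm_mono_AE) auto
    also have "\<dots> \<le> ennreal (C\<^sup>2) * sqnorm M (\<lambda>\<omega>. Y r \<omega> - Y u \<omega>)"
      using C_pos by (intro sqnorm_scale_le) auto
    also have "\<dots> \<le> ennreal (C\<^sup>2) * ennreal ((2 * C * sqrt (v - u))\<^sup>2)"
      by (intro mult_left_mono increment_Y_sqrt_le uv uv1 r) auto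
    finally show "sqnorm M (\<lambda>\<omega>. Y u (snd (r, \<omega>)) v* (indicator {u<..v} (fst (r, \<omega>)) *\<^sub>R H (fst (r, \<omega>)) (snd (r, \<omega>))))
        \<le> ennreal (C\<^sup>2 * (2 * C * sqrt (v - u))\<^sup>2)"
      using r by (simp add: ennreal_mult)
  next
    show "(\<lambda>p. Y u (snd p) v* (indicator {u<..v} (fst p) *\<^sub>R H (fst p) (snd p))) \<in> borel_measurable (lborel \<Otimes>\<^sub>M M)"
      using ito_limit_measurable(2)[OF L, measurable] by measurable
  qed (use uv in \<open>auto simp: bounded_bilinear.zero_right[OF bounded_bilinear_vector_matrix]\<close>)
  also have "(C\<^sup>2 * (2 * C * sqrt (v - u))\<^sup>2) * (v - u) = (2 * C\<^sup>2 * (v - u))\<^sup>2"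
    using uv by (simp add: power_mult_distrib power2_eq_square)
  finally show ?thesis
    using ito_limit_inner(1)[OF L Y_adapted] uv by auto
qed

lemma inner_increment_N_orth:
  assumes "Z \<in> borel_measurable (F u)" "integrable M (\<lambda>\<omega>. Z \<omega> * (Y u \<omega> \<bullet> (N v \<omega> - N u \<omega>)))"
  shows "expectation (\<lambda>\<omega>. Z \<omega> * (Y u \<omega> \<bullet> (N v \<omega> - N u \<omega>))) = 0"
proof -
  have "Y u \<in> borel_measurable (F u)" using Y_adapted uv by auto
  note [measurable] = this assms(1)
  have "(\<lambda>\<omega>. Z \<omega> *\<^sub>R Y u \<omega>) \<in> borel_measurable (F u)" by measurable
  from ito_limit_inner(2)[OF N[OF uv] this] assms(2) show ?thesis by simp
qed

lemma frozen_square_mean: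
  "has_bochner_integral M (\<lambda>\<omega>. (norm (frozen_increment u v \<omega>))\<^sup>2) (c * (v - u))"
proof -
  note [measurable] = interval_measurable[OF uv uv1]
  have uT: "u \<le> T" using uv by simp
  have "has_bochner_integral M (\<lambda>\<omega>. frozen_increment u v \<omega> \<bullet> frozen_increment u v \<omega>) (expectation (\<lambda>\<omega>. H u \<omega> \<bullet> H u \<omega>) * (v - u))"
    unfolding frozen_increment_def using uv uT by (intro isometry_same_interval H_adapted H_bounded)
  also have "expectation (\<lambda>\<omega>. H u \<omega> \<bullet> H u \<omega>) = expectation (\<lambda>\<omega>. c)"
    using norm_H[OF uv(1) uT] by (intro integral_cong_AE) (auto simp: power2_norm_eq_inner)
  finally show ?thesis by (simp add: power2_norm_eq_inner prob_space)
qed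

text \<open>
  Given the past, \<open>|H\<^sub>u (W\<^sub>v - W\<^sub>u)|\<^sup>2\<close> has mean \<open>c (v - u)\<close>, since \<open>|H\<^sub>u|\<^sup>2 = c\<close> is not random.
\<close>

lemma frozen_square_orth:
  assumes Z: "Z \<in> borel_measurable (F u)" "integrable M Z"
  shows "expectation (\<lambda>\<omega>. Z \<omega> * ((norm (frozen_increment u v \<omega>))\<^sup>2 - c * (v - u))) = 0"
proof -
  note [measurable] = interval_measurable[OF uv uv1]
  have uT: "u \<le> T" using uv by simp
  have Hu [measurable]: "H u \<in> borel_measurable (F u)" using H_adapted uv uT by auto
  note [measurable] = Z(1)
  have int: "integrable M (\<lambda>\<omega>. (Z \<omega> *\<^sub>R H u \<omega>) $ i $ k * H u \<omega> $ i $ l)" for i k l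
  proof (rule Bochner_Integration.integrable_bound)
    show "integrable M (\<lambda>\<omega>. C\<^sup>2 * Z \<omega>)" using Z by simp
    show "(\<lambda>\<omega>. (Z \<omega> *\<^sub>R H u \<omega>) $ i $ k * H u \<omega> $ i $ l) \<in> borel_measurable M"
      by (rule measurable_F_M[of _ u]) measurable
    show "AE \<omega> in M. norm ((Z \<omega> *\<^sub>R H u \<omega>) $ i $ k * H u \<omega> $ i $ l) \<le> norm (C\<^sup>2 * Z \<omega>)"
    proof (rule AE_I2)
      fix \<omega> assume \<omega>: "\<omega> \<in> space M"
      have "\<bar>H u \<omega> $ i $ j\<bar> \<le> C" for j
        using component_le_norm_cart[of "H u \<omega> $ i" j] Finite_Cartesian_Product.norm_nth_le[of "H u \<omega>" i] H_bound[OF uv(1) uT \<omega>] by simp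
      then have "\<bar>H u \<omega> $ i $ k\<bar> * \<bar>H u \<omega> $ i $ l\<bar> \<le> C * C"
        using C_pos by (intro mult_mono) auto
      then have "\<bar>Z \<omega>\<bar> * (\<bar>H u \<omega> $ i $ k\<bar> * \<bar>H u \<omega> $ i $ l\<bar>) \<le> \<bar>Z \<omega>\<bar> * (C * C)"
        by (rule mult_left_mono) simp
      then show "norm ((Z \<omega> *\<^sub>R H u \<omega>) $ i $ k * H u \<omega> $ i $ l) \<le> norm (C\<^sup>2 * Z \<omega>)"
        using C_pos by (simp add: abs_mult power2_eq_square mult_ac)
    qed
  qed
  have "has_bochner_integral M (\<lambda>\<omega>. ((Z \<omega> *\<^sub>R H u \<omega>) *v (W v \<omega> - W u \<omega>)) \<bullet> frozen_increment u v \<omega>)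
      (expectation (\<lambda>\<omega>. (Z \<omega> *\<^sub>R H u \<omega>) \<bullet> H u \<omega>) * (v - u))"
    unfolding frozen_increment_def using uv(1,2) by (rule isometry_same_interval_integrable) (measurable, rule int)
  also have "expectation (\<lambda>\<omega>. (Z \<omega> *\<^sub>R H u \<omega>) \<bullet> H u \<omega>) = expectation (\<lambda>\<omega>. Z \<omega> * c)"
    using norm_H[OF uv(1) uT] measurable_F_M[OF Z(1)]
    by (intro integral_cong_AE) (auto simp: power2_norm_eq_inner)
  also have "(\<lambda>\<omega>. ((Z \<omega> *\<^sub>R H u \<omega>) *v (W v \<omega> - W u \<omega>)) \<bullet> frozen_increment u v \<omega>) = (\<lambda>\<omega>. Z \<omega> * (norm (frozen_increment u v \<omega>))\<^sup>2)"
    by (simp add: frozen_increment_def scaleR_matrix_vector_assoc[symmetric] power2_norm_eq_inner)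
  finally have "has_bochner_integral M (\<lambda>\<omega>. Z \<omega> * (norm (frozen_increment u v \<omega>))\<^sup>2) (expectation Z * c * (v - u))"
    using Z(2) by simp
  then have "has_bochner_integral M (\<lambda>\<omega>. Z \<omega> * (norm (frozen_increment u v \<omega>))\<^sup>2 - Z \<omega> * (c * (v - u))) (expectation Z * c * (v - u) - expectation Z * (c * (v - u)))"
    using Z(2) by (intro has_bochner_integral_diff) (auto simp: has_bochner_integral_iff)
  then show ?thesis
    by (simp add: right_diff_distrib has_bochner_integral_iff)
qed

lemma frozen_square_variance:
  "integrable M (\<lambda>\<omega>. ((norm (frozen_increment u v \<omega>))\<^sup>2 - c * (v - u))\<^sup>2)"
  "expectation (\<lambda>\<omega>. ((norm (frozen_increment u v \<omega>))\<^sup>2 - c * (v - u))\<^sup>2) \<le> (6 * C ^ 4 * (real CARD('n))\<^sup>2 + 2 * c\<^sup>2) * (v - u)\<^sup>2"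
proof -
  note [measurable] = interval_measurable[OF uv uv1]
  have uT: "u \<le> T" using uv by simp
  have arith: "2 * (a * (3 * b * d)) + 2 * (e * d) = (6 * a * b + 2 * e) * d" for a b d e :: real
    by (simp add: algebra_simps)
  let ?b = "\<lambda>\<omega>. 2 * (C ^ 4 * (norm (W v \<omega> - W u \<omega>)) ^ 4) + 2 * (c * (v - u))\<^sup>2"
  note W4 = increment_norm4_le[OF uv(1,2)]
  have b: "integrable M ?b" using W4(1) by simp
  have le: "((norm (frozen_increment u v \<omega>))\<^sup>2 - c * (v - u))\<^sup>2 \<le> ?b \<omega>" if "\<omega> \<in> space M" for \<omega>
  proof -
    have "norm (frozen_increment u v \<omega>) \<le> norm (H u \<omega>) * norm (W v \<omega> - W u \<omega>)"
      unfolding frozen_increment_def by (rule norm_matrix_vector_le)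
    also have "\<dots> \<le> C * norm (W v \<omega> - W u \<omega>)"
      using H_bound[OF uv(1) uT that] by (rule mult_right_mono) simp
    finally have "(norm (frozen_increment u v \<omega>)) ^ 4 \<le> (C * norm (W v \<omega> - W u \<omega>)) ^ 4"
      by (rule power_mono) simp
    moreover have "(a - b)\<^sup>2 \<le> 2 * a\<^sup>2 + 2 * b\<^sup>2" for a b :: real
      using zero_le_power2[of "a + b"] by (simp add: power2_sum power2_diff)
    from this[of "(norm (frozen_increment u v \<omega>))\<^sup>2" "c * (v - u)"]
    have "((norm (frozen_increment u v \<omega>))\<^sup>2 - c * (v - u))\<^sup>2 \<le> 2 * (norm (frozen_increment u v \<omega>)) ^ 4 + 2 * (c * (v - u))\<^sup>2"
      by simp
    ultimately show ?thesis by (simp add: power_mult_distrib)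
  qed
  show int: "integrable M (\<lambda>\<omega>. ((norm (frozen_increment u v \<omega>))\<^sup>2 - c * (v - u))\<^sup>2)"
    by (rule Bochner_Integration.integrable_bound[OF b]) (use le in \<open>auto intro!: order_trans[OF _ abs_ge_self]\<close>)
  have "expectation (\<lambda>\<omega>. ((norm (frozen_increment u v \<omega>))\<^sup>2 - c * (v - u))\<^sup>2) \<le> expectation ?b"
    using int b le by (rule integral_mono)
  also have "\<dots> = 2 * (C ^ 4 * expectation (\<lambda>\<omega>. (norm (W v \<omega> - W u \<omega>)) ^ 4)) + 2 * (c * (v - u))\<^sup>2"
    using W4(1) by (simp add: prob_space)
  also have "\<dots> \<le> 2 * (C ^ 4 * (3 * (real CARD('n))\<^sup>2 * (v - u)\<^sup>2)) + 2 * (c * (v - u))\<^sup>2"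
    using W4(2) C_pos by (intro add_right_mono mult_left_mono) auto
  also have "\<dots> = (6 * C ^ 4 * (real CARD('n))\<^sup>2 + 2 * c\<^sup>2) * (v - u)\<^sup>2"
    using arith[of "C ^ 4" _ "(v - u)\<^sup>2"] by (simp only: power_mult_distrib[of c])
  finally show "expectation (\<lambda>\<omega>. ((norm (frozen_increment u v \<omega>))\<^sup>2 - c * (v - u))\<^sup>2) \<le> (6 * C ^ 4 * (real CARD('n))\<^sup>2 + 2 * c\<^sup>2) * (v - u)\<^sup>2" .
qed

end

text \<open>
  The Ito formula for \<open>|Y|\<^sup>2\<close>. For every \<open>\<kappa>\<close> in \<open>(0, 1]\<close> a suitable partition shows that the two sides
  differ by at most \<open>K \<kappa>\<close> in mean, with \<open>K\<close> independent of \<open>\<kappa>\<close>.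
\<close>

theorem norm_square_deterministic:
  assumes t: "0 \<le> t" "t \<le> T"
  shows "AE \<omega> in M. (norm (Y t \<omega>))\<^sup>2 = (norm (Y 0 \<omega>))\<^sup>2 + c * t"
proof -
  define R where "R \<omega> = (norm (Y t \<omega>))\<^sup>2 - (norm (Y 0 \<omega>))\<^sup>2 - c * t" for \<omega>
  define Q where "Q = 6 * C ^ 4 * (real CARD('n))\<^sup>2 + 2 * c\<^sup>2"
  define K where "K = 4 * C\<^sup>2 * t + 4 * C\<^sup>2 * sqrt t + sqrt (t * Q) + (c * t + (2 * C\<^sup>2 + 2) * t) + (2 * C\<^sup>2 + 2) * t"
  have Q: "0 \<le> Q" by (simp add: Q_def)
  have c: "0 \<le> c"
  proof (rule ccontr)
    assume "\<not> 0 \<le> c"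
    have "AE \<omega> in M. False"
      using norm_H[OF t]
    proof eventually_elim
      case (elim \<omega>)
      then show False using \<open>\<not> 0 \<le> c\<close> zero_le_power2[of "norm (H t \<omega>)"] by simp
    qed
    then show False by simp
  qed
  have main: "(\<integral>\<^sup>+\<omega>. ennreal \<bar>R \<omega>\<bar> \<partial>M) \<le> ennreal (K * \<kappa>)" if \<kappa>: "0 < \<kappa>" "\<kappa> \<le> 1" for \<kappa>
  proof -
    obtain \<delta> where \<delta>: "\<delta> > 0" "\<And>r u. r \<in> {0..T} \<Longrightarrow> u \<in> {0..T} \<Longrightarrow> \<bar>r - u\<bar> < \<delta> \<Longrightarrow>
        sqnorm M (\<lambda>\<omega>. H r \<omega> - H u \<omega>) \<le> ennreal (\<kappa>\<^sup>2)"
      using H_mean_square_continuous[of "\<kappa>\<^sup>2"] \<kappa> by auto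
    \<comment> \<open>With \<open>n\<close> steps the mesh is below \<open>\<delta>\<close> and below \<open>\<kappa>\<^sup>2\<close>, so that \<open>\<surd>\<Delta> \<le> \<kappa>\<close>.\<close>
    obtain n :: nat where n: "t / min \<delta> (\<kappa>\<^sup>2) < real n"
      using reals_Archimedean2 by blast
    have "0 \<le> t / min \<delta> (\<kappa>\<^sup>2)" using t \<delta> \<kappa> by simp
    then have n0: "0 < real n" using n by linarith
    define \<Delta> where "\<Delta> = t / real n"
    have "t < real n * min \<delta> (\<kappa>\<^sup>2)"
      using n \<delta>(1) \<kappa>(1) by (simp add: pos_divide_less_eq)
    then have "\<Delta> < min \<delta> (\<kappa>\<^sup>2)"
      using n0 by (simp add: \<Delta>_def pos_divide_less_eq mult.commute del: min_less_iff_conj)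
    then have \<Delta>: "0 \<le> \<Delta>" "\<Delta> < \<delta>" "\<Delta> \<le> \<kappa>\<^sup>2" "real n * \<Delta> = t"
      using t n0 by (auto simp: \<Delta>_def)
    have "\<kappa>\<^sup>2 \<le> 1" using \<kappa> by (simp add: power_le_one)
    then have \<Delta>1: "\<Delta> \<le> 1" using \<Delta> by simp
    have sqrt\<Delta>: "sqrt \<Delta> \<le> \<kappa>" using \<Delta>(3) \<kappa> real_le_lsqrt by auto
    define \<tau> where "\<tau> i = real i * \<Delta>" for i :: nat
    have \<tau>mono: "mono \<tau>" using \<Delta> by (auto simp: mono_def \<tau>_def mult_right_mono)
    have \<tau>: "0 \<le> \<tau> i" "\<tau> i \<le> \<tau> (Suc i)" "\<tau> (Suc i) \<le> T" "\<tau> (Suc i) - \<tau> i \<le> 1" and \<tau>\<Delta>: "\<tau> (Suc i) - \<tau> i = \<Delta>" if "i < n" for i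
    proof -
      show "\<tau> (Suc i) - \<tau> i = \<Delta>" by (simp add: \<tau>_def algebra_simps)
      then show "\<tau> (Suc i) - \<tau> i \<le> 1" "\<tau> i \<le> \<tau> (Suc i)" "0 \<le> \<tau> i"
        using \<Delta> \<Delta>1 by (auto simp: \<tau>_def)
      have "\<tau> (Suc i) \<le> \<tau> n" using that by (intro monoD[OF \<tau>mono]) simp
      then show "\<tau> (Suc i) \<le> T" using \<Delta> t by (simp add: \<tau>_def)
    qed
    \<comment> \<open>The increment of \<open>Y\<close> in step \<open>i\<close> is \<open>G i + E i\<close>, and \<open>D i + X i\<close> is its inner product with \<open>Y\<close>.\<close>
    define D where "D i \<omega> = Y (\<tau> i) \<omega> \<bullet> drift (\<tau> i) (\<tau> (Suc i)) \<omega>" for i \<omega>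
    define X where "X i \<omega> = Y (\<tau> i) \<omega> \<bullet> (N (\<tau> (Suc i)) \<omega> - N (\<tau> i) \<omega>)" for i \<omega>
    define G where "G i = frozen_increment (\<tau> i) (\<tau> (Suc i))" for i
    define V where "V i \<omega> = (norm (G i \<omega>))\<^sup>2 - c * \<Delta>" for i \<omega>
    define E where "E i \<omega> = drift (\<tau> i) (\<tau> (Suc i)) \<omega> + (N (\<tau> (Suc i)) \<omega> - N (\<tau> i) \<omega> - G i \<omega>)" for i \<omega>
    have meas: "D i \<in> borel_measurable M" "X i \<in> borel_measurable M" "G i \<in> borel_measurable M"
      "V i \<in> borel_measurable M" "E i \<in> borel_measurable M" if i: "i < n" for i
    proof -
      note [measurable] = interval_measurable[OF \<tau>[OF i]]
      show "D i \<in> borel_measurable M" unfolding D_def[abs_def] by measurable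
      show "X i \<in> borel_measurable M" unfolding X_def[abs_def] by measurable
      show [measurable]: "G i \<in> borel_measurable M" unfolding G_def by measurable
      show "V i \<in> borel_measurable M" unfolding V_def[abs_def] by measurable
      show "E i \<in> borel_measurable M" unfolding E_def[abs_def] by measurable
    qed

    have D: "integrable M (D i)" "expectation (\<lambda>\<omega>. \<bar>D i \<omega>\<bar>) \<le> 2 * C\<^sup>2 * \<Delta> * \<kappa>" if "i < n" for i
    proof -
      note d = inner_drift_le[OF \<tau>[OF that], folded D_def]
      show "integrable M (D i)" using d(1) by (simp add: D_def[abs_def])
      have "2 * C\<^sup>2 * \<Delta> * sqrt \<Delta> \<le> 2 * C\<^sup>2 * \<Delta> * \<kappa>"
        using sqrt\<Delta> \<Delta> by (intro mult_left_mono) auto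
      then show "expectation (\<lambda>\<omega>. \<bar>D i \<omega>\<bar>) \<le> 2 * C\<^sup>2 * \<Delta> * \<kappa>"
        using d(2) \<tau>\<Delta>[OF that] by simp
    qed
    have X: "integrable M (\<lambda>\<omega>. (X i \<omega>)\<^sup>2)" "expectation (\<lambda>\<omega>. (X i \<omega>)\<^sup>2) \<le> (2 * C\<^sup>2 * \<Delta>)\<^sup>2" if "i < n" for i
    proof -
      have "sqnorm M (X i) \<le> ennreal ((2 * C\<^sup>2 * \<Delta>)\<^sup>2)"
        using inner_increment_N_le[OF \<tau>[OF that]] \<tau>\<Delta>[OF that] by (simp add: X_def[abs_def])
      from L1_le_L2(2,3)[OF meas(2)[OF that] this] \<Delta> show "integrable M (\<lambda>\<omega>. (X i \<omega>)\<^sup>2)" "expectation (\<lambda>\<omega>. (X i \<omega>)\<^sup>2) \<le> (2 * C\<^sup>2 * \<Delta>)\<^sup>2"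
        by auto
    qed
    have V: "integrable M (\<lambda>\<omega>. (V i \<omega>)\<^sup>2)" "expectation (\<lambda>\<omega>. (V i \<omega>)\<^sup>2) \<le> Q * \<Delta>\<^sup>2" if "i < n" for i
      using frozen_square_variance[OF \<tau>[OF that]] \<tau>\<Delta>[OF that] by (simp_all add: V_def G_def Q_def)
    have G: "integrable M (\<lambda>\<omega>. (norm (G i \<omega>))\<^sup>2)" "expectation (\<lambda>\<omega>. (norm (G i \<omega>))\<^sup>2) = c * \<Delta>" if "i < n" for i
      using frozen_square_mean[OF \<tau>[OF that]] \<tau>\<Delta>[OF that] by (simp_all add: G_def has_bochner_integral_iff)
    have E: "integrable M (\<lambda>\<omega>. (norm (E i \<omega>))\<^sup>2)" "expectation (\<lambda>\<omega>. (norm (E i \<omega>))\<^sup>2) \<le> (2 * C\<^sup>2 + 2) * \<kappa>\<^sup>2 * \<Delta>" if i: "i < n" for i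
    proof -
      note [measurable] = interval_measurable[OF \<tau>[OF i]]
      have "sqnorm M (drift (\<tau> i) (\<tau> (Suc i))) \<le> sqnorm M (\<lambda>_. C * \<Delta>)"
        using norm_drift_le[OF \<tau>[OF i]] \<tau>\<Delta>[OF i] C_pos \<Delta> by (intro sqnorm_mono_AE) auto
      also have "\<dots> = ennreal ((C * \<Delta>)\<^sup>2)"
        by (simp add: sqnorm_def emeasure_space_1)
      also have "\<dots> \<le> ennreal (C\<^sup>2 * (\<kappa>\<^sup>2 * \<Delta>))"
        unfolding power_mult_distrib power2_eq_square[of \<Delta>] using \<Delta>
        by (intro ennreal_leI mult_left_mono mult_right_mono) auto
      finally have d: "sqnorm M (drift (\<tau> i) (\<tau> (Suc i))) \<le> ennreal (C\<^sup>2 * (\<kappa>\<^sup>2 * \<Delta>))" .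
      have e: "sqnorm M (\<lambda>\<omega>. N (\<tau> (Suc i)) \<omega> - N (\<tau> i) \<omega> - G i \<omega>) \<le> ennreal (\<kappa>\<^sup>2 * \<Delta>)"
        unfolding G_def \<tau>\<Delta>[OF i, symmetric]
        using \<tau>[OF i] \<tau>\<Delta>[OF i] \<Delta> by (intro error_le \<delta>(2)) auto
      have "sqnorm M (E i) \<le> 2 * sqnorm M (drift (\<tau> i) (\<tau> (Suc i))) + 2 * sqnorm M (\<lambda>\<omega>. N (\<tau> (Suc i)) \<omega> - N (\<tau> i) \<omega> - G i \<omega>)"
        unfolding E_def[abs_def] G_def by (rule sqnorm_add_le2) measurable
      also have "\<dots> \<le> 2 * ennreal (C\<^sup>2 * (\<kappa>\<^sup>2 * \<Delta>)) + 2 * ennreal (\<kappa>\<^sup>2 * \<Delta>)"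
        using d e by (intro add_mono mult_left_mono) auto
      also have "\<dots> = ennreal ((2 * C\<^sup>2 + 2) * \<kappa>\<^sup>2 * \<Delta>)"
        using \<Delta> by (simp add: ennreal_mult ennreal_plus distrib_right mult.assoc)
      finally have "sqnorm M (E i) \<le> ennreal ((sqrt ((2 * C\<^sup>2 + 2) * \<kappa>\<^sup>2 * \<Delta>))\<^sup>2)"
        using \<Delta> by simp
      from L1_le_L2(2,3)[OF meas(5)[OF i] this] \<Delta> show "integrable M (\<lambda>\<omega>. (norm (E i \<omega>))\<^sup>2)"
        "expectation (\<lambda>\<omega>. (norm (E i \<omega>))\<^sup>2) \<le> (2 * C\<^sup>2 + 2) * \<kappa>\<^sup>2 * \<Delta>"
        by auto
    qed

    have square_sum: "integrable M (\<lambda>\<omega>. \<Sum>i<n. S i \<omega>) \<and> expectation (\<lambda>\<omega>. \<bar>\<Sum>i<n. S i \<omega>\<bar>) \<le> sqrt (real n * q)"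
      if meas: "\<And>i. i < n \<Longrightarrow> S i \<in> borel_measurable (F (\<tau> (Suc i)))"
        and sq: "\<And>i. i < n \<Longrightarrow> integrable M (\<lambda>\<omega>. (S i \<omega>)\<^sup>2)" "\<And>i. i < n \<Longrightarrow> expectation (\<lambda>\<omega>. (S i \<omega>)\<^sup>2) \<le> q"
        and orth: "\<And>i Z. i < n \<Longrightarrow> Z \<in> borel_measurable (F (\<tau> i)) \<Longrightarrow> integrable M (\<lambda>\<omega>. (Z \<omega>)\<^sup>2) \<Longrightarrow>
          integrable M (\<lambda>\<omega>. Z \<omega> * S i \<omega>) \<Longrightarrow> expectation (\<lambda>\<omega>. Z \<omega> * S i \<omega>) = 0" and "0 \<le> q"
      for S :: "nat \<Rightarrow> 'a \<Rightarrow> real" and q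
    proof -
      have "(\<lambda>\<omega>. \<Sum>i<n. S i \<omega>) \<in> borel_measurable (F (\<tau> n)) \<and> integrable M (\<lambda>\<omega>. (\<Sum>i<n. S i \<omega>)\<^sup>2) \<and>
          expectation (\<lambda>\<omega>. (\<Sum>i<n. S i \<omega>)\<^sup>2) \<le> real n * q"
        by (rule expectation_sum_sq_le) (fact meas \<tau>mono sq orth)+
      then have e: "(\<lambda>\<omega>. \<Sum>i<n. S i \<omega>) \<in> borel_measurable (F (\<tau> n))" "integrable M (\<lambda>\<omega>. (\<Sum>i<n. S i \<omega>)\<^sup>2)"
          "expectation (\<lambda>\<omega>. (\<Sum>i<n. S i \<omega>)\<^sup>2) \<le> real n * q"
        by blast+
      then have "sqnorm M (\<lambda>\<omega>. \<Sum>i<n. S i \<omega>) \<le> ennreal ((sqrt (real n * q))\<^sup>2)"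
        using \<open>0 \<le> q\<close> by (simp add: sqnorm_def nn_integral_eq_integral ennreal_leI)
      from L1_le_L2(1,4)[OF measurable_F_M[OF e(1)] this] \<open>0 \<le> q\<close> show ?thesis by simp
    qed
    have SX: "integrable M (\<lambda>\<omega>. \<Sum>i<n. X i \<omega>) \<and> expectation (\<lambda>\<omega>. \<bar>\<Sum>i<n. X i \<omega>\<bar>) \<le> sqrt (real n * (2 * C\<^sup>2 * \<Delta>)\<^sup>2)"
    proof (rule square_sum)
      fix i assume i: "i < n"
      have "(\<lambda>\<omega>. N (\<tau> (Suc i)) \<omega> - N (\<tau> i) \<omega>) \<in> borel_measurable (F (\<tau> (Suc i)))"
        by (rule ito_limit_adapted[OF N[OF \<tau>(1-3)[OF i]]])
      moreover have "Y (\<tau> i) \<in> borel_measurable (F (\<tau> (Suc i)))"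
        using \<tau>[OF i] by (intro measurable_F_mono[OF Y_adapted]) auto
      ultimately show "X i \<in> borel_measurable (F (\<tau> (Suc i)))"
        unfolding X_def[abs_def] by measurable
    next
      fix i and Z :: "'a \<Rightarrow> real" assume "i < n" "Z \<in> borel_measurable (F (\<tau> i))" "integrable M (\<lambda>\<omega>. Z \<omega> * X i \<omega>)"
      then show "expectation (\<lambda>\<omega>. Z \<omega> * X i \<omega>) = 0"
        unfolding X_def by (intro inner_increment_N_orth \<tau>)
    qed (use X in auto)
    have SV: "integrable M (\<lambda>\<omega>. \<Sum>i<n. V i \<omega>) \<and> expectation (\<lambda>\<omega>. \<bar>\<Sum>i<n. V i \<omega>\<bar>) \<le> sqrt (real n * (Q * \<Delta>\<^sup>2))"
    proof (rule square_sum)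
      fix i assume i: "i < n"
      have "W (\<tau> (Suc i)) \<in> borel_measurable (F (\<tau> (Suc i)))" "W (\<tau> i) \<in> borel_measurable (F (\<tau> (Suc i)))"
        using \<tau>[OF i] by (auto intro!: W_measurable_F)
      moreover have "H (\<tau> i) \<in> borel_measurable (F (\<tau> (Suc i)))"
        using \<tau>[OF i] by (intro measurable_F_mono[OF H_adapted]) auto
      ultimately show "V i \<in> borel_measurable (F (\<tau> (Suc i)))"
        unfolding V_def[abs_def] G_def frozen_increment_def by measurable
    next
      fix i and Z :: "'a \<Rightarrow> real" assume i: "i < n" and Z: "Z \<in> borel_measurable (F (\<tau> i))" "integrable M (\<lambda>\<omega>. (Z \<omega>)\<^sup>2)"
      have "integrable M Z"
        using square_integrable_imp_integrable[OF measurable_F_M[OF Z(1)] Z(2)] .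
      then show "expectation (\<lambda>\<omega>. Z \<omega> * V i \<omega>) = 0"
        using frozen_square_orth[OF \<tau>[OF i] Z(1)] \<tau>\<Delta>[OF i] by (simp add: V_def G_def)
    qed (use V Q in auto)

    \<comment> \<open>The mixed terms \<open>2 G \<bullet> E\<close> are split by Young's inequality with weight \<open>\<kappa>\<close>.\<close>
    define B where "B \<omega> = 2 * (\<Sum>i<n. \<bar>D i \<omega>\<bar>) + 2 * \<bar>\<Sum>i<n. X i \<omega>\<bar> + \<bar>\<Sum>i<n. V i \<omega>\<bar>
      + (\<Sum>i<n. \<kappa> * (norm (G i \<omega>))\<^sup>2 + (norm (E i \<omega>))\<^sup>2 / \<kappa>) + (\<Sum>i<n. (norm (E i \<omega>))\<^sup>2)" for \<omega>
    have R_le: "\<bar>R \<omega>\<bar> \<le> B \<omega>" for \<omega>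
    proof -
      have step: "(norm (Y (\<tau> (Suc i)) \<omega>))\<^sup>2 - (norm (Y (\<tau> i) \<omega>))\<^sup>2 - c * \<Delta>
          = 2 * D i \<omega> + 2 * X i \<omega> + V i \<omega> + 2 * (G i \<omega> \<bullet> E i \<omega>) + (norm (E i \<omega>))\<^sup>2" for i
      proof -
        define y where "y = Y (\<tau> i) \<omega>"
        have 1: "Y (\<tau> (Suc i)) \<omega> = y + (G i \<omega> + E i \<omega>)"
          by (simp add: E_def drift_def y_def)
        have 2: "D i \<omega> + X i \<omega> = y \<bullet> (G i \<omega> + E i \<omega>)"
          by (simp add: D_def X_def E_def y_def inner_add_right inner_diff_right)
        show ?thesis
          unfolding 1 V_def y_def[symmetric] using 2
          by (simp add: power2_norm_eq_inner inner_add_left inner_add_right inner_commute)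
      qed
      have "(\<Sum>i<n. (norm (Y (\<tau> (Suc i)) \<omega>))\<^sup>2 - (norm (Y (\<tau> i) \<omega>))\<^sup>2) = (norm (Y (\<tau> n) \<omega>))\<^sup>2 - (norm (Y (\<tau> 0) \<omega>))\<^sup>2"
        by (rule sum_lessThan_telescope)
      then have "R \<omega> = (\<Sum>i<n. (norm (Y (\<tau> (Suc i)) \<omega>))\<^sup>2 - (norm (Y (\<tau> i) \<omega>))\<^sup>2 - c * \<Delta>)"
        using \<Delta>(4) by (simp add: R_def \<tau>_def sum_subtractf mult.left_commute)
      also have "\<dots> = 2 * (\<Sum>i<n. D i \<omega>) + 2 * (\<Sum>i<n. X i \<omega>) + (\<Sum>i<n. V i \<omega>) + (\<Sum>i<n. 2 * (G i \<omega> \<bullet> E i \<omega>)) + (\<Sum>i<n. (norm (E i \<omega>))\<^sup>2)"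
        unfolding step by (simp add: sum.distrib sum_distrib_left)
      finally have R_eq: "R \<omega> = \<dots>" .
      have "\<bar>\<Sum>i<n. D i \<omega>\<bar> \<le> (\<Sum>i<n. \<bar>D i \<omega>\<bar>)" by (rule sum_abs)
      moreover have "\<bar>\<Sum>i<n. 2 * (G i \<omega> \<bullet> E i \<omega>)\<bar> \<le> (\<Sum>i<n. \<kappa> * (norm (G i \<omega>))\<^sup>2 + (norm (E i \<omega>))\<^sup>2 / \<kappa>)"
      proof (rule order_trans[OF sum_abs sum_mono])
        fix i
        have "0 \<le> (sqrt \<kappa> * norm (G i \<omega>) - norm (E i \<omega>) / sqrt \<kappa>)\<^sup>2" by simp
        also have "\<dots> = \<kappa> * (norm (G i \<omega>))\<^sup>2 + (norm (E i \<omega>))\<^sup>2 / \<kappa> - 2 * (norm (G i \<omega>) * norm (E i \<omega>))"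
          using \<kappa> by (simp add: power2_diff power_mult_distrib power_divide)
        finally show "\<bar>2 * (G i \<omega> \<bullet> E i \<omega>)\<bar> \<le> \<kappa> * (norm (G i \<omega>))\<^sup>2 + (norm (E i \<omega>))\<^sup>2 / \<kappa>"
          using Cauchy_Schwarz_ineq2[of "G i \<omega>" "E i \<omega>"] by simp
      qed
      moreover have "0 \<le> (\<Sum>i<n. (norm (E i \<omega>))\<^sup>2)" by (simp add: sum_nonneg)
      ultimately show ?thesis unfolding R_eq B_def by linarith
    qed
    have "has_bochner_integral M B (2 * (\<Sum>i<n. expectation (\<lambda>\<omega>. \<bar>D i \<omega>\<bar>)) + 2 * expectation (\<lambda>\<omega>. \<bar>\<Sum>i<n. X i \<omega>\<bar>) + expectation (\<lambda>\<omega>. \<bar>\<Sum>i<n. V i \<omega>\<bar>)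
      + (\<Sum>i<n. \<kappa> * expectation (\<lambda>\<omega>. (norm (G i \<omega>))\<^sup>2) + expectation (\<lambda>\<omega>. (norm (E i \<omega>))\<^sup>2) / \<kappa>) + (\<Sum>i<n. expectation (\<lambda>\<omega>. (norm (E i \<omega>))\<^sup>2)))"
    proof -
      have "integrable M (\<lambda>\<omega>. \<bar>D i \<omega>\<bar>)" if "i < n" for i using D(1)[OF that] by (rule integrable_abs)
      moreover have "integrable M (\<lambda>\<omega>. \<bar>\<Sum>i<n. X i \<omega>\<bar>)" "integrable M (\<lambda>\<omega>. \<bar>\<Sum>i<n. V i \<omega>\<bar>)"
        by (rule integrable_abs, rule SX[THEN conjunct1], rule integrable_abs, rule SV[THEN conjunct1])
      ultimately show ?thesis
        unfolding B_def[abs_def] using G(1) E(1)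
        by (intro has_bochner_integral_add has_bochner_integral_mult_right has_bochner_integral_sum
            has_bochner_integral_divide_zero has_bochner_integral_integrable) auto
    qed
    then have B_int: "integrable M B" and B_eq: "expectation B = 2 * (\<Sum>i<n. expectation (\<lambda>\<omega>. \<bar>D i \<omega>\<bar>)) + 2 * expectation (\<lambda>\<omega>. \<bar>\<Sum>i<n. X i \<omega>\<bar>) + expectation (\<lambda>\<omega>. \<bar>\<Sum>i<n. V i \<omega>\<bar>)
      + (\<Sum>i<n. \<kappa> * expectation (\<lambda>\<omega>. (norm (G i \<omega>))\<^sup>2) + expectation (\<lambda>\<omega>. (norm (E i \<omega>))\<^sup>2) / \<kappa>) + (\<Sum>i<n. expectation (\<lambda>\<omega>. (norm (E i \<omega>))\<^sup>2))"
      unfolding has_bochner_integral_iff by blast+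
    note B_eq
    also have "\<dots> \<le> 2 * (\<Sum>i<n. 2 * C\<^sup>2 * \<Delta> * \<kappa>) + 2 * sqrt (real n * (2 * C\<^sup>2 * \<Delta>)\<^sup>2) + sqrt (real n * (Q * \<Delta>\<^sup>2))
      + (\<Sum>i<n. \<kappa> * (c * \<Delta>) + (2 * C\<^sup>2 + 2) * \<kappa>\<^sup>2 * \<Delta> / \<kappa>) + (\<Sum>i<n. (2 * C\<^sup>2 + 2) * \<kappa>\<^sup>2 * \<Delta>)"
      using D(2) SX SV G(2) E(2) \<kappa> by (intro add_mono mult_left_mono sum_mono divide_right_mono) auto
    also have "\<dots> \<le> K * \<kappa>"
    proof -
      have a: "2 * (\<Sum>i<n. 2 * C\<^sup>2 * \<Delta> * \<kappa>) = 4 * C\<^sup>2 * t * \<kappa>"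
        by (simp add: \<Delta>(4)[symmetric] mult_ac)
      have "real n * (2 * C\<^sup>2 * \<Delta>)\<^sup>2 = (2 * C\<^sup>2)\<^sup>2 * t * \<Delta>"
        by (simp add: \<Delta>(4)[symmetric] power_mult_distrib power2_eq_square[of \<Delta>] mult_ac)
      then have b: "2 * sqrt (real n * (2 * C\<^sup>2 * \<Delta>)\<^sup>2) = 4 * C\<^sup>2 * sqrt t * sqrt \<Delta>"
        by (simp only: real_sqrt_mult real_sqrt_abs) (simp add: abs_mult)
      have b': "4 * C\<^sup>2 * sqrt t * sqrt \<Delta> \<le> 4 * C\<^sup>2 * sqrt t * \<kappa>"
        using sqrt\<Delta> t by (intro mult_left_mono) auto
      have "real n * (Q * \<Delta>\<^sup>2) = (t * Q) * \<Delta>"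
        by (simp add: \<Delta>(4)[symmetric] power2_eq_square mult_ac)
      then have d: "sqrt (real n * (Q * \<Delta>\<^sup>2)) = sqrt (t * Q) * sqrt \<Delta>"
        by (simp only: real_sqrt_mult)
      have d': "sqrt (t * Q) * sqrt \<Delta> \<le> sqrt (t * Q) * \<kappa>"
        using sqrt\<Delta> t Q by (intro mult_left_mono) auto
      have "(2 * C\<^sup>2 + 2) * \<kappa>\<^sup>2 * \<Delta> / \<kappa> = (2 * C\<^sup>2 + 2) * \<kappa> * \<Delta>"
        using \<kappa> by (simp add: power2_eq_square)
      then have e: "(\<Sum>i<n. \<kappa> * (c * \<Delta>) + (2 * C\<^sup>2 + 2) * \<kappa>\<^sup>2 * \<Delta> / \<kappa>) = (c * t + (2 * C\<^sup>2 + 2) * t) * \<kappa>"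
        by (simp add: \<Delta>(4)[symmetric] algebra_simps)
      have "\<kappa>\<^sup>2 \<le> \<kappa>" using \<kappa> by (simp add: power2_eq_square mult_left_le)
      then have "(2 * C\<^sup>2 + 2) * t * \<kappa>\<^sup>2 \<le> (2 * C\<^sup>2 + 2) * t * \<kappa>"
        using t by (intro mult_left_mono) auto
      moreover have "(\<Sum>i<n. (2 * C\<^sup>2 + 2) * \<kappa>\<^sup>2 * \<Delta>) = (2 * C\<^sup>2 + 2) * t * \<kappa>\<^sup>2"
        by (simp add: \<Delta>(4)[symmetric] mult_ac)
      ultimately have f: "(\<Sum>i<n. (2 * C\<^sup>2 + 2) * \<kappa>\<^sup>2 * \<Delta>) \<le> (2 * C\<^sup>2 + 2) * t * \<kappa>" by (simp only:)
      have "K * \<kappa> = 4 * C\<^sup>2 * t * \<kappa> + 4 * C\<^sup>2 * sqrt t * \<kappa> + sqrt (t * Q) * \<kappa>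
          + (c * t + (2 * C\<^sup>2 + 2) * t) * \<kappa> + (2 * C\<^sup>2 + 2) * t * \<kappa>"
        by (simp add: K_def algebra_simps)
      then show ?thesis unfolding a b d e using b' d' f by linarith
    qed
    finally have "expectation B \<le> K * \<kappa>" .
    have "(\<integral>\<^sup>+\<omega>. ennreal \<bar>R \<omega>\<bar> \<partial>M) \<le> (\<integral>\<^sup>+\<omega>. ennreal (B \<omega>) \<partial>M)"
      by (intro nn_integral_mono ennreal_leI R_le)
    also have "\<dots> = ennreal (expectation B)"
      using order_trans[OF abs_ge_zero R_le] by (intro nn_integral_eq_integral B_int) auto
    also have "\<dots> \<le> ennreal (K * \<kappa>)"
      using \<open>expectation B \<le> K * \<kappa>\<close> by (rule ennreal_leI)
    finally show ?thesis .
  qed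
  have [measurable]: "Y t \<in> borel_measurable M" "Y 0 \<in> borel_measurable M"
    using t by (auto intro!: Y_measurable)
  have [measurable]: "R \<in> borel_measurable M" unfolding R_def by measurable
  have "(\<integral>\<^sup>+\<omega>. ennreal \<bar>R \<omega>\<bar> \<partial>M) \<le> ennreal (K * 0)"
  proof (rule LIMSEQ_le_const)
    show "(\<lambda>n. ennreal (K * inverse (real (Suc n)))) \<longlonglongrightarrow> ennreal (K * 0)"
      by (intro tendsto_ennrealI tendsto_mult tendsto_const LIMSEQ_inverse_real_of_nat)
    show "\<exists>n0. \<forall>n\<ge>n0. (\<integral>\<^sup>+\<omega>. ennreal \<bar>R \<omega>\<bar> \<partial>M) \<le> ennreal (K * inverse (real (Suc n)))"
      by (intro exI allI impI main) (auto simp: inverse_le_1_iff)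
  qed
  then have "AE \<omega> in M. ennreal \<bar>R \<omega>\<bar> = 0"
    by (subst nn_integral_0_iff_AE[symmetric]) auto
  then show ?thesis by eventually_elim (simp add: R_def)
qed

end

section \<open>The magnetic moment\<close>

unbundle cross3_syntax

text \<open>
  The matrix \<open>H\<close> with \<open>H dW = - \<epsilon> (x \<and> dW) - \<alpha> \<epsilon> (x \<and> (x \<and> dW))\<close>.
\<close>

definition diffusion_matrix :: "real \<Rightarrow> real \<Rightarrow> real^3 \<Rightarrow> real^3^3" where
  "diffusion_matrix \<alpha> \<epsilon> x = (- \<epsilon>) *\<^sub>R (L x + \<alpha> *\<^sub>R (L x ** L x))"

lemma L_components:
  "L x $ 1 $ 1 = 0" "L x $ 1 $ 2 = - x $ 3" "L x $ 1 $ 3 = x $ 2"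
  "L x $ 2 $ 1 = x $ 3" "L x $ 2 $ 2 = 0" "L x $ 2 $ 3 = - x $ 1"
  "L x $ 3 $ 1 = - x $ 2" "L x $ 3 $ 2 = x $ 1" "L x $ 3 $ 3 = 0"
  by (simp_all add: L_def matrix_def cross_components axis_def)

lemma norm_diffusion_matrix:
  "(norm (diffusion_matrix \<alpha> \<epsilon> x))\<^sup>2 = 2 * \<epsilon>\<^sup>2 * ((x \<bullet> x) + \<alpha>\<^sup>2 * (x \<bullet> x)\<^sup>2)"
  unfolding power2_norm_eq_inner diffusion_matrix_def
  by (simp add: inner_vec_def sum_3 matrix_matrix_mult_def L_components power2_eq_square algebra_simps)

lemma vector_diffusion_matrix: "x v* diffusion_matrix \<alpha> \<epsilon> x = 0"
  unfolding diffusion_matrix_def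
  by (simp add: vec_eq_iff forall_3 vector_matrix_mult_def sum_3 matrix_matrix_mult_def L_components algebra_simps)

lemma continuous_on_diffusion_matrix:
  assumes "continuous_on S f" shows "continuous_on S (\<lambda>r. diffusion_matrix \<alpha> \<epsilon> (f r))"
proof -
  have "linear L"
    by (auto intro!: linearI simp: vec_eq_iff forall_3 L_components)
  then have L: "continuous_on S (\<lambda>r. L (f r))"
    by (intro continuous_on_compose2[OF linear_continuous_on[of L UNIV] assms]) (simp_all add: linear_conv_bounded_linear)
  then show ?thesis
    unfolding diffusion_matrix_def
    by (intro continuous_intros bounded_bilinear.continuous_on[OF bounded_bilinear_matrix_matrix] L)
qed

text \<open>
  The deterministic part of the dynamics: precession around the field \<open>v\<close> and damping.
\<close>

definition drift_vector :: "real \<Rightarrow> real^3 \<Rightarrow> real^3 \<Rightarrow> real^3" where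
  "drift_vector \<alpha> x v = - (x \<times> v) - \<alpha> *\<^sub>R (x \<times> (x \<times> v))"

lemma drift_vector_orth: "x \<bullet> drift_vector \<alpha> x v = 0"
  by (simp add: drift_vector_def inner_diff_right dot_cross_self)

lemma norm_cross_le: "norm (x \<times> y) \<le> norm x * norm y"
proof -
  have "(norm (x \<times> y))\<^sup>2 \<le> (norm x * norm y)\<^sup>2"
    using norm_cross_dot[of x y] zero_le_power2[of "x \<bullet> y"] by linarith
  then show ?thesis by (rule power2_le_imp_le) simp
qed

lemma norm_drift_vector_le:
  assumes "norm x \<le> 1" "norm v \<le> 1" "0 \<le> \<alpha>"
  shows "norm (drift_vector \<alpha> x v) \<le> 1 + \<alpha>"
proof -
  have 1: "norm (x \<times> y) \<le> 1" if "norm y \<le> 1" for y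
    using norm_cross_le[of x y] mult_mono[OF assms(1) that] by simp
  have "norm (drift_vector \<alpha> x v) \<le> norm (x \<times> v) + norm (\<alpha> *\<^sub>R (x \<times> (x \<times> v)))"
    unfolding drift_vector_def by (rule order_trans[OF norm_triangle_ineq4]) simp
  also have "\<dots> \<le> 1 + \<alpha> * 1"
    using 1[OF assms(2)] 1[OF 1[OF assms(2)]] assms(3) by (simp add: add_mono mult_left_le)
  finally show ?thesis by simp
qed

text \<open>The damping term pushes the moment towards the direction of the external field.\<close>

lemma drift_vector_inner_nonneg:
  assumes "0 \<le> \<alpha>" "0 \<le> k"
  shows "0 \<le> drift_vector \<alpha> x (k *\<^sub>R b) \<bullet> b"
proof -
  have "drift_vector \<alpha> x (k *\<^sub>R b) \<bullet> b = \<alpha> * k * ((x \<bullet> x) * (b \<bullet> b) - (x \<bullet> b)\<^sup>2)"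
    by (simp add: drift_vector_def cross3_simps inner_vec_def sum_3 power2_eq_square)
  moreover have "(x \<bullet> b)\<^sup>2 \<le> (x \<bullet> x) * (b \<bullet> b)" by (rule Cauchy_Schwarz_ineq)
  ultimately show ?thesis using assms by simp
qed

text \<open>
  A solution of the system on the original time scale \<open>[0, 1/\<eta>]\<close>.
\<close>

locale magnetic_moment = standard_brownian_motion M W
  for M :: "'a measure" and W :: "real \<Rightarrow> 'a \<Rightarrow> real^3" +
  fixes \<alpha> \<epsilon> \<eta> :: real and b :: "real^3" and Y \<mu> :: "real \<Rightarrow> 'a \<Rightarrow> real^3"
  assumes params: "\<alpha> > 0" "\<epsilon> > 0" "\<eta> > 0" "norm b = 1"
    and solution: "is_solution M W \<alpha> \<epsilon> \<eta> b Y \<mu>"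
begin

lemma \<mu>_eq: "t \<in> {0..1/\<eta>} \<Longrightarrow> \<omega> \<in> space M \<Longrightarrow> \<mu> t \<omega> = Y t \<omega> /\<^sub>R norm (Y t \<omega>)"
  using solution by (auto simp: is_solution_def)

lemma norm_\<mu>_le: "t \<in> {0..1/\<eta>} \<Longrightarrow> \<omega> \<in> space M \<Longrightarrow> norm (\<mu> t \<omega>) \<le> 1"
  by (cases "Y t \<omega> = 0") (simp_all add: \<mu>_eq)

lemma norm_\<mu>: "AE \<omega> in M. \<forall>t\<in>{0..1/\<eta>}. norm (\<mu> t \<omega>) = 1"
proof -
  have "AE \<omega> in M. \<forall>t\<in>{0..1/\<eta>}. Y t \<omega> \<noteq> 0"
    using solution by (auto simp: is_solution_def)
  then show ?thesis
    using AE_space by eventually_elim (simp add: \<mu>_eq)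
qed

lemma norm_b_eta_le:
  assumes "r \<in> {0..1/\<eta>}" shows "norm (b_eta \<eta> b r) \<le> 1"
proof -
  have "0 \<le> r * \<eta>" "r * \<eta> \<le> 1" using assms params by (auto simp: field_simps)
  then have "\<bar>1 - 2 * r * \<eta>\<bar> \<le> 1" by (simp only: mult.assoc abs_le_iff) linarith
  then show ?thesis using params by (simp only: b_eta_def norm_scaleR mult_1_right)
qed

text \<open>
  The growth rate of \<open>|Y|\<^sup>2\<close>, which is the squared Frobenius norm of \<open>diffusion_matrix\<close> at unit vectors.
\<close>

definition rate :: real where
  "rate = 2 * (1 + \<alpha>\<^sup>2) * \<epsilon>\<^sup>2"

text \<open>
  The coefficients of the equation along the solution.
\<close>

definition A :: "real \<Rightarrow> 'a \<Rightarrow> real^3" where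
  "A r \<omega> = drift_vector \<alpha> (\<mu> r \<omega>) (b_eta \<eta> b r)"

definition H :: "real \<Rightarrow> 'a \<Rightarrow> real^3^3" where
  "H r \<omega> = diffusion_matrix \<alpha> \<epsilon> (\<mu> r \<omega>)"

lemma norm_H_le:
  assumes "r \<in> {0..1/\<eta>}" "\<omega> \<in> space M"
  shows "norm (H r \<omega>) \<le> sqrt rate"
proof (rule real_le_rsqrt)
  have "(\<mu> r \<omega> \<bullet> \<mu> r \<omega>) \<le> 1"
    using norm_\<mu>_le[OF assms] by (simp add: norm_le_square)
  moreover from this have "(\<mu> r \<omega> \<bullet> \<mu> r \<omega>)\<^sup>2 \<le> 1"
    by (intro power_le_one) auto
  ultimately have "2 * \<epsilon>\<^sup>2 * ((\<mu> r \<omega> \<bullet> \<mu> r \<omega>) + \<alpha>\<^sup>2 * (\<mu> r \<omega> \<bullet> \<mu> r \<omega>)\<^sup>2) \<le> 2 * \<epsilon>\<^sup>2 * (1 + \<alpha>\<^sup>2 * 1)"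
    by (intro mult_left_mono add_mono) auto
  moreover have "rate = 2 * \<epsilon>\<^sup>2 * (1 + \<alpha>\<^sup>2 * 1)" by (simp add: rate_def)
  ultimately show "(norm (H r \<omega>))\<^sup>2 \<le> rate"
    by (simp only: H_def norm_diffusion_matrix)
qed

text \<open>
  The stochastic integrals at different times come from separate existence statements, hence \<open>N\<close> is built by
  choice; \<open>ito_limit_increment\<close> relates its values at two times.
\<close>

lemma tangential:
  obtains N where "tangential_ito_process M W (1/\<eta>) Y A H N rate (1 + \<alpha> + sqrt rate)"
proof -
  let ?T = "1/\<eta>"
  define ito where "ito t I J \<longleftrightarrow>
        has_ito_integral M F W t (\<lambda>s \<omega>. L (\<mu> s \<omega>)) I \<and>
        has_ito_integral M F W t (\<lambda>s \<omega>. L (\<mu> s \<omega>) ** L (\<mu> s \<omega>)) J \<and>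
        (AE \<omega> in M. Y t \<omega> = Y 0 \<omega>
           - ((LBINT s:{0..t}. \<mu> s \<omega> \<times> b_eta \<eta> b s) + \<epsilon> *\<^sub>R I \<omega>)
           - \<alpha> *\<^sub>R ((LBINT s:{0..t}. \<mu> s \<omega> \<times> (\<mu> s \<omega> \<times> b_eta \<eta> b s)) + \<epsilon> *\<^sub>R J \<omega>))" for t I J
  have "\<forall>t\<in>{0..?T}. \<exists>I J. ito t I J"
    using solution unfolding is_solution_def ito_def by blast
  then obtain I J where "\<And>t. t \<in> {0..?T} \<Longrightarrow> ito t (I t) (J t)"
    by metis
  note IJ = this[unfolded ito_def, THEN conjunct1] this[unfolded ito_def, THEN conjunct2, THEN conjunct1]
    this[unfolded ito_def, THEN conjunct2, THEN conjunct2]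
  define N where "N t \<omega> = (- \<epsilon>) *\<^sub>R I t \<omega> + (- \<epsilon> * \<alpha>) *\<^sub>R J t \<omega>" for t \<omega>
  have T: "0 \<le> ?T" "?T \<in> {0..?T}" "0 \<in> {0..?T}" using params by auto
  have rate: "0 < rate" using params by (simp add: rate_def add_pos_nonneg)
  have Lm [measurable]: "(\<lambda>(r, \<omega>). L (\<mu> r \<omega>)) \<in> borel_measurable (restrict_space lborel {0..?T} \<Otimes>\<^sub>M M)"
    using IJ(1)[OF T(2)] by (simp add: has_ito_integral_def)
  have bm [measurable]: "b_eta \<eta> b \<in> borel_measurable (restrict_space lborel {0..?T})"
    unfolding b_eta_def by (intro measurable_restrict_space1) measurable
  have m1: "(\<lambda>(r, \<omega>). \<mu> r \<omega> \<times> b_eta \<eta> b r) \<in> borel_measurable (restrict_space lborel {0..?T} \<Otimes>\<^sub>M M)"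
  proof -
    have "(\<lambda>p. (case p of (r, \<omega>) \<Rightarrow> L (\<mu> r \<omega>)) *v b_eta \<eta> b (fst p)) \<in> borel_measurable (restrict_space lborel {0..?T} \<Otimes>\<^sub>M M)"
      by measurable
    then show ?thesis by (simp add: L_mult_vec case_prod_beta')
  qed
  have m2: "(\<lambda>(r, \<omega>). \<mu> r \<omega> \<times> (\<mu> r \<omega> \<times> b_eta \<eta> b r)) \<in> borel_measurable (restrict_space lborel {0..?T} \<Otimes>\<^sub>M M)"
  proof -
    have "(\<lambda>p. (case p of (r, \<omega>) \<Rightarrow> L (\<mu> r \<omega>)) *v (case p of (r, \<omega>) \<Rightarrow> \<mu> r \<omega> \<times> b_eta \<eta> b r)) \<in> borel_measurable (restrict_space lborel {0..?T} \<Otimes>\<^sub>M M)"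
      using Lm m1 by (intro borel_measurable_matrix_vector)
    then show ?thesis by (simp add: L_mult_vec case_prod_beta')
  qed
  have n1: "norm (\<mu> r \<omega> \<times> b_eta \<eta> b r) \<le> 1" if "r \<in> {0..?T}" "\<omega> \<in> space M" for r \<omega>
    using order_trans[OF norm_cross_le mult_mono[OF norm_\<mu>_le[OF that] norm_b_eta_le[OF that(1)]]] by simp
  have n2: "norm (\<mu> r \<omega> \<times> (\<mu> r \<omega> \<times> b_eta \<eta> b r)) \<le> 1" if "r \<in> {0..?T}" "\<omega> \<in> space M" for r \<omega>
    using order_trans[OF norm_cross_le mult_mono[OF norm_\<mu>_le[OF that] n1[OF that]]] by simp
  have Lad: "(\<lambda>\<omega>. L (\<mu> r \<omega>)) \<in> borel_measurable (F r)" if "r \<in> {0..?T}" for r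
    using IJ(1)[OF T(2)] that by (simp add: has_ito_integral_def)
  have "tangential_ito_process M W ?T Y A H N rate (1 + \<alpha> + sqrt rate)"
  proof
    show "1 + \<alpha> + sqrt rate > 0" using params rate by (simp add: add_pos_pos)
    show "Y t \<in> borel_measurable (F t)" if "0 \<le> t" "t \<le> ?T" for t
      using solution that by (auto simp: is_solution_def)
    show "(\<lambda>(r, \<omega>). A r \<omega>) \<in> borel_measurable (restrict_space lborel {0..?T} \<Otimes>\<^sub>M M)"
    proof -
      have "(\<lambda>p. - (case p of (r, \<omega>) \<Rightarrow> \<mu> r \<omega> \<times> b_eta \<eta> b r) - \<alpha> *\<^sub>R (case p of (r, \<omega>) \<Rightarrow> \<mu> r \<omega> \<times> (\<mu> r \<omega> \<times> b_eta \<eta> b r)))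
          \<in> borel_measurable (restrict_space lborel {0..?T} \<Otimes>\<^sub>M M)"
        using m1[measurable] m2[measurable] by measurable
      then show ?thesis by (simp add: A_def drift_vector_def case_prod_beta')
    qed
    show "norm (A r \<omega>) \<le> 1 + \<alpha> + sqrt rate" if "0 \<le> r" "r \<le> ?T" "\<omega> \<in> space M" for r \<omega>
      using norm_drift_vector_le[OF norm_\<mu>_le norm_b_eta_le, of r \<omega> r \<alpha>] that params rate
      by (simp add: A_def add_increasing2)
    show "H r \<in> borel_measurable (F r)" if "0 \<le> r" "r \<le> ?T" for r
    proof -
      have [measurable]: "(\<lambda>\<omega>. L (\<mu> r \<omega>)) \<in> borel_measurable (F r)" using that by (intro Lad) simp
      show ?thesis unfolding H_def diffusion_matrix_def by measurable
    qed
    show "norm (H r \<omega>) \<le> 1 + \<alpha> + sqrt rate" if "0 \<le> r" "r \<le> ?T" "\<omega> \<in> space M" for r \<omega>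
      using norm_H_le[of r \<omega>] that params by simp
    show "AE \<omega> in M. continuous_on {0..?T} (\<lambda>r. H r \<omega>)"
    proof -
      have "AE \<omega> in M. continuous_on {0..?T} (\<lambda>r. Y r \<omega>)" "AE \<omega> in M. \<forall>t\<in>{0..?T}. Y t \<omega> \<noteq> 0"
        using solution by (auto simp: is_solution_def)
      then show ?thesis
        using AE_space
      proof eventually_elim
        case (elim \<omega>)
        have "continuous_on {0..?T} (\<lambda>r. diffusion_matrix \<alpha> \<epsilon> (Y r \<omega> /\<^sub>R norm (Y r \<omega>)))"
          using elim by (intro continuous_on_diffusion_matrix continuous_intros) auto
        then show ?case
          by (rule continuous_on_eq) (use \<mu>_eq elim in \<open>simp add: H_def\<close>)
      qed
    qed
    show "ito_limit s t (\<lambda>p. indicator {s<..t} (fst p) *\<^sub>R H (fst p) (snd p)) (\<lambda>\<omega>. N t \<omega> - N s \<omega>)"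
      if "0 \<le> s" "s \<le> t" "t \<le> ?T" for s t
    proof -
      have st: "t \<in> {0..?T}" "s \<in> {0..?T}" using that by auto
      have "ito_limit s t (\<lambda>p. (- \<epsilon>) *\<^sub>R (indicator {s<..t} (fst p) *\<^sub>R L (\<mu> (fst p) (snd p)))
            + (- \<epsilon> * \<alpha>) *\<^sub>R (indicator {s<..t} (fst p) *\<^sub>R (L (\<mu> (fst p) (snd p)) ** L (\<mu> (fst p) (snd p)))))
          (\<lambda>\<omega>. (- \<epsilon>) *\<^sub>R (I t \<omega> - I s \<omega>) + (- \<epsilon> * \<alpha>) *\<^sub>R (J t \<omega> - J s \<omega>))"
        by (intro ito_limit_add ito_limit_scaleR ito_limit_increment[OF IJ(1)[OF st(1)] IJ(1)[OF st(2)] that(1,2)]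
            ito_limit_increment[OF IJ(2)[OF st(1)] IJ(2)[OF st(2)] that(1,2)])
      then show ?thesis
        by (simp add: N_def H_def diffusion_matrix_def algebra_simps)
    qed
    show "AE \<omega> in M. Y t \<omega> = Y 0 \<omega> + (LBINT r:{0..t}. A r \<omega>) + (N t \<omega> - N 0 \<omega>)" if t: "0 \<le> t" "t \<le> ?T" for t
    proof -
      have tT: "t \<in> {0..?T}" using t by auto
      show ?thesis
        using IJ(3)[OF tT] IJ(3)[OF T(3)] AE_space
      proof eventually_elim
        case (elim \<omega>)
        have sub: "{0..t} \<subseteq> {0..?T}" using t by auto
        have i1: "set_integrable lborel {0..t} (\<lambda>r. \<mu> r \<omega> \<times> b_eta \<eta> b r)"
          by (rule set_integrable_subset[OF bounded_section_integrable[OF m1 elim(3) n1] _ sub]) (use elim in auto)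
        have i2: "set_integrable lborel {0..t} (\<lambda>r. \<mu> r \<omega> \<times> (\<mu> r \<omega> \<times> b_eta \<eta> b r))"
          by (rule set_integrable_subset[OF bounded_section_integrable[OF m2 elim(3) n2] _ sub]) (use elim in auto)
        have "(LBINT r:{0..t}. A r \<omega>) = (LBINT r:{0..t}. (- 1) *\<^sub>R (\<mu> r \<omega> \<times> b_eta \<eta> b r) - \<alpha> *\<^sub>R (\<mu> r \<omega> \<times> (\<mu> r \<omega> \<times> b_eta \<eta> b r)))"
          by (simp add: A_def drift_vector_def)
        also have "\<dots> = (- 1) *\<^sub>R (LBINT r:{0..t}. \<mu> r \<omega> \<times> b_eta \<eta> b r) - \<alpha> *\<^sub>R (LBINT r:{0..t}. \<mu> r \<omega> \<times> (\<mu> r \<omega> \<times> b_eta \<eta> b r))"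
          by (subst set_integral_diff(2)) (intro set_integrable_scaleR_right i1 i2, intro set_integrable_scaleR_right i1 i2,
              simp only: set_integral_scaleR_right)
        finally have A: "(LBINT r:{0..t}. A r \<omega>) = \<dots>" .
        \<comment> \<open>At time \<open>0\<close> the equation reads \<open>Y\<^sub>0 = Y\<^sub>0 + N\<^sub>0\<close>, hence \<open>N\<^sub>0 = 0\<close>.\<close>
        have z: "(LBINT s:{0..0}. f s) = 0" for f :: "real \<Rightarrow> real^3"
          unfolding set_lebesgue_integral_def
          by (rule integral_eq_zero_AE) (rule AE_mp[OF AE_lborel_singleton[of "0::real"]], simp)
        have "N 0 \<omega> = 0"
          using elim(2) unfolding z by (simp add: N_def algebra_simps eq_neg_iff_add_eq_0 neg_eq_iff_add_eq_0)
        moreover have "N t \<omega> = - (\<epsilon> *\<^sub>R I t \<omega>) - \<alpha> *\<^sub>R (\<epsilon> *\<^sub>R J t \<omega>)"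
          by (simp add: N_def mult.commute)
        ultimately show ?case
          unfolding A elim(1) by (simp add: scaleR_add_right)
      qed
    qed
    show "AE \<omega> in M. Y r \<omega> \<bullet> A r \<omega> = 0" if r: "0 \<le> r" "r \<le> ?T" for r
    proof (rule AE_I2)
      fix \<omega> assume "\<omega> \<in> space M"
      then have "Y r \<omega> = norm (Y r \<omega>) *\<^sub>R \<mu> r \<omega>" using r by (cases "Y r \<omega> = 0") (simp_all add: \<mu>_eq)
      then show "Y r \<omega> \<bullet> A r \<omega> = 0"
        by (metis A_def drift_vector_orth inner_scaleR_left mult_zero_right)
    qed
    show "AE \<omega> in M. Y r \<omega> v* H r \<omega> = 0" if r: "0 \<le> r" "r \<le> ?T" for r
    proof (rule AE_I2)
      fix \<omega> assume "\<omega> \<in> space M"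
      then have "Y r \<omega> = norm (Y r \<omega>) *\<^sub>R \<mu> r \<omega>" using r by (cases "Y r \<omega> = 0") (simp_all add: \<mu>_eq)
      then show "Y r \<omega> v* H r \<omega> = 0"
        by (metis H_def vector_diffusion_matrix vector_matrix_add_distribs(3) scaleR_zero_right)
    qed
    show "AE \<omega> in M. (norm (H r \<omega>))\<^sup>2 = rate" if r: "0 \<le> r" "r \<le> ?T" for r
      using norm_\<mu>
    proof eventually_elim
      case (elim \<omega>)
      then have "\<mu> r \<omega> \<bullet> \<mu> r \<omega> = 1" using r by (simp add: power2_norm_eq_inner[symmetric])
      then show ?case by (simp add: H_def norm_diffusion_matrix rate_def)
    qed
  qed
  then show thesis by (rule that)
qed

text \<open>
  The norm of \<open>Y\<close> is deterministic, the martingale part has mean zero, and the drift points towards \<open>b\<close>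
  before the field is reversed at time \<open>1 / (2 \<eta>)\<close>.
\<close>

lemma mean_alignment:
  assumes t: "0 \<le> t" "t \<le> 1 / (2 * \<eta>)"
  shows "expectation (\<lambda>\<omega>. \<mu> t \<omega> \<bullet> b) \<ge> 1 / sqrt (1 + rate * t)"
proof -
  obtain N where "tangential_ito_process M W (1/\<eta>) Y A H N rate (1 + \<alpha> + sqrt rate)"
    by (rule tangential)
  then interpret tangential_ito_process M W "1/\<eta>" Y A H N rate "1 + \<alpha> + sqrt rate" .
  have tT: "t \<le> 1/\<eta>" using t params by (simp add: field_simps)
  define h where "h = sqrt (1 + rate * t)"
  have "0 \<le> rate" by (simp add: rate_def)
  then have h: "1 \<le> h" using t by (simp add: h_def)
  have Y0: "AE \<omega> in M. Y 0 \<omega> = b" using solution by (simp add: is_solution_def)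
  have [measurable]: "Y t \<in> borel_measurable M" using t tT by (intro Y_measurable)
  have Yh: "AE \<omega> in M. norm (Y t \<omega>) = h"
    using norm_square_deterministic[OF t(1) tT] Y0
  proof eventually_elim
    case (elim \<omega>)
    then have "(norm (Y t \<omega>))\<^sup>2 = 1 + rate * t" using params by simp
    then show ?case unfolding h_def by (metis norm_ge_zero real_sqrt_unique)
  qed
  have Yint: "integrable M (\<lambda>\<omega>. Y t \<omega> \<bullet> b)"
  proof (rule integrable_const_bound)
    show "AE \<omega> in M. norm (Y t \<omega> \<bullet> b) \<le> h"
      using Yh by eventually_elim (use Cauchy_Schwarz_ineq2[of _ b] params in \<open>metis mult_1_right real_norm_def\<close>)
  qed measurable
  note Nt = N[OF order_refl t(1) tT]
  note Nint = ito_limit_square_integrable(1)[OF Nt]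
  have "1 = expectation (\<lambda>\<omega>. 1 + (N t \<omega> - N 0 \<omega>) \<bullet> b)"
    using Nint ito_limit_mean_zero[OF Nt] by (simp add: prob_space)
  also have "\<dots> \<le> expectation (\<lambda>\<omega>. Y t \<omega> \<bullet> b)"
  proof (rule integral_mono_AE)
    show "integrable M (\<lambda>\<omega>. 1 + (N t \<omega> - N 0 \<omega>) \<bullet> b)" using Nint by simp
    show "AE \<omega> in M. 1 + (N t \<omega> - N 0 \<omega>) \<bullet> b \<le> Y t \<omega> \<bullet> b"
      using Y_eq[OF t(1) tT] Y0 AE_space
    proof eventually_elim
      case (elim \<omega>)
      have "set_integrable lborel {0..t} (\<lambda>r. A r \<omega>)"
        by (rule set_integrable_subset[OF A_section_integrable(1)[OF elim(3), of 0 0]]) (use tT in auto)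
      then have "(LBINT r:{0..t}. A r \<omega>) \<bullet> b = (\<integral>r. (indicator {0..t} r *\<^sub>R A r \<omega>) \<bullet> b \<partial>lborel)"
        unfolding set_lebesgue_integral_def set_integrable_def by (intro integral_inner_left[symmetric]) simp
      also have "0 \<le> \<dots>"
      proof (rule Bochner_Integration.integral_nonneg)
        fix r
        show "0 \<le> (indicator {0..t} r *\<^sub>R A r \<omega>) \<bullet> b"
        proof (cases "r \<in> {0..t}")
          case True
          then have "2 * r * \<eta> \<le> 1" using t(2) params by (simp add: field_simps) (smt (verit) mult_left_mono)
          then show ?thesis
            using drift_vector_inner_nonneg[of \<alpha> "1 - 2 * r * \<eta>" "\<mu> r \<omega>" b] params True
            by (simp add: A_def b_eta_def)
        qed simp
      qed
      finally have "0 \<le> (LBINT r:{0..t}. A r \<omega>) \<bullet> b" .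
      moreover have "b \<bullet> b = 1" using params by (simp add: power2_norm_eq_inner[symmetric])
      ultimately show ?case unfolding elim(1) using elim(2) by (simp add: inner_add_left)
    qed
  qed (rule Yint)
  finally have "1 / h \<le> expectation (\<lambda>\<omega>. Y t \<omega> \<bullet> b) / h"
    using h by (intro divide_right_mono) auto
  also have "\<dots> = expectation (\<lambda>\<omega>. (Y t \<omega> \<bullet> b) / h)" by simp
  also have "\<dots> = expectation (\<lambda>\<omega>. \<mu> t \<omega> \<bullet> b)"
  proof (rule integral_cong_AE)
    have "(\<lambda>\<omega>. Y t \<omega> /\<^sub>R norm (Y t \<omega>)) \<in> borel_measurable M" by measurable
    then have "\<mu> t \<in> borel_measurable M"
      by (rule measurable_cong[THEN iffD1, rotated]) (use t tT in \<open>simp add: \<mu>_eq\<close>)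
    then show "(\<lambda>\<omega>. \<mu> t \<omega> \<bullet> b) \<in> borel_measurable M" by measurable
    show "(\<lambda>\<omega>. (Y t \<omega> \<bullet> b) / h) \<in> borel_measurable M" by measurable
    show "AE \<omega> in M. (Y t \<omega> \<bullet> b) / h = \<mu> t \<omega> \<bullet> b"
      using Yh AE_space
    proof eventually_elim
      case (elim \<omega>)
      have "\<mu> t \<omega> = inverse h *\<^sub>R Y t \<omega>"
        using \<mu>_eq[of t \<omega>] elim t(1) tT by simp
      then show ?case by (simp add: divide_inverse mult.commute)
    qed
  qed
  finally show ?thesis by (simp add: h_def)
qed

end

unbundle no cross3_syntax

theorem proposition10:
  fixes M :: "'a measure" and W Y \<mu> :: "real \<Rightarrow> 'a \<Rightarrow> real^3"
    and \<alpha> \<epsilon> \<eta> :: real and b :: "real^3"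
  assumes "standard_brownian_motion M W"
    and "\<alpha> > 0" and "\<epsilon> > 0" and "\<eta> > 0" and "b \<in> sphere 0 1"
    and "is_solution M W \<alpha> \<epsilon> \<eta> b Y \<mu>"
  shows "\<forall>t\<in>{0..1/2}.
    prob_space.expectation M (\<lambda>\<omega>. lambda_eta \<eta> \<mu> t \<omega> \<bullet> b) \<ge> 1 / h_eta \<alpha> \<epsilon> \<eta> t \<and>
    1 / h_eta \<alpha> \<epsilon> \<eta> t \<ge> 1 / sqrt (1 + (1 + \<alpha>\<^sup>2) * \<epsilon>\<^sup>2 / \<eta>)"
proof (intro ballI conjI)
  interpret standard_brownian_motion M W by fact
  interpret magnetic_moment M W \<alpha> \<epsilon> \<eta> b Y \<mu>
    by standard (use assms in auto)
  fix t :: real assume t: "t \<in> {0..1/2}"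
  have "h_eta \<alpha> \<epsilon> \<eta> t = sqrt (1 + rate * (t / \<eta>))"
    by (simp add: h_eta_def rate_def add.commute)
  moreover have "0 \<le> t / \<eta>" "t / \<eta> \<le> 1 / (2 * \<eta>)" using t \<open>\<eta> > 0\<close> by (simp_all add: field_simps)
  ultimately show "1 / h_eta \<alpha> \<epsilon> \<eta> t \<le> expectation (\<lambda>\<omega>. lambda_eta \<eta> \<mu> t \<omega> \<bullet> b)"
    using mean_alignment[of "t / \<eta>"] by (simp only: lambda_eta_def)
  have "2 * (1 + \<alpha>\<^sup>2) * \<epsilon>\<^sup>2 * t / \<eta> = (1 + \<alpha>\<^sup>2) * \<epsilon>\<^sup>2 / \<eta> * (2 * t)" by simp
  also have "\<dots> \<le> (1 + \<alpha>\<^sup>2) * \<epsilon>\<^sup>2 / \<eta> * 1"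
    using t \<open>\<eta> > 0\<close> by (intro mult_left_mono) auto
  finally have "h_eta \<alpha> \<epsilon> \<eta> t \<le> sqrt (1 + (1 + \<alpha>\<^sup>2) * \<epsilon>\<^sup>2 / \<eta>)"
    by (simp add: h_eta_def)
  moreover have "0 \<le> 2 * (1 + \<alpha>\<^sup>2) * \<epsilon>\<^sup>2 * t / \<eta>" using t \<open>\<eta> > 0\<close> by simp
  then have "0 < h_eta \<alpha> \<epsilon> \<eta> t" unfolding h_eta_def by simp
  ultimately show "1 / sqrt (1 + (1 + \<alpha>\<^sup>2) * \<epsilon>\<^sup>2 / \<eta>) \<le> 1 / h_eta \<alpha> \<epsilon> \<eta> t"
    by (intro frac_le) simp_all
qed

end
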